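(* Let $d\in\mathbb{N}$ and $Q=[0,1]^d$. If the prescribed Jacobian equation (in dimension $d$) has strong Lipschitz non-regularity, then the top-dimensional case of Lang's Flat Chain Conjecture fails, i.e. there exists a metric $d$-current $T$ on $\mathbb{R}^d$ supported inside $Q$ for which there is no $u\in L^1(Q)$ satisfying $$T(\varphi,x^1,\dots,x^d)=\int_Q u\varphi\,\mathrm{d}\mathcal{L}^d\quad\text{for all }\varphi\in C^\infty_c(\mathbb{R}^d),$$ where $x^j$ denotes the $j$-th coordinate function on $\mathbb{R}^d$.
   Context: $\operatorname{Lip}(f)$ denotes the least Lipschitz constant of $f$; $\mathrm{D}\pi$ is the a.e. defined derivative matrix of a Lipschitz $\pi\colon Q\to\mathbb{R}^d$; $\mathcal{L}^d$ is Lebesgue measure. Strong Lipschitz non-regularity of the prescribed Jacobian equation means: there is a sequence $u_n\in L^1(Q)$, $n\in\mathbb{N}$, such that for each $n$, $\|u_n\|_{L^1(Q)}\geq1$ and $\sup\{|\int_Q u_n f\det\mathrm{D}\pi\,\mathrm{d}\mathcal{L}^d| : \max\{\operatorname{Lip}(f),\|f\|_\infty\}\prod_{j=1}^d\operatorname{Lip}(\pi^j)\leq1\}\leq\frac1n$, the supremum being over Lipschitz $f\colon Q\to\mathbb{R}$ and Lipschitz $\pi=(\pi^1,\dots,\pi^d)\colon Q\to\mathbb{R}^d$. For a locally compact metric space $X$, $\operatorname{Lip}(X)$ is the space of real-valued Lipschitz functions on $X$ and $\operatorname{Lip}_c(X)$ the subspace of compactly supported ones. A metric $k$-current on $X$ is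 a multilinear functional $T\colon\operatorname{Lip}_c(X)\times[\operatorname{Lip}(X)]^k\to\mathbb{R}$ such that: (locality) if some $\pi^j$ is constant on a neighbourhood of $\operatorname{spt}f$, then $T(f,\pi^1,\dots,\pi^k)=0$; (joint continuity) if $f_i\to f$ and $\pi^j_i\to\pi^j$ for each $j$, pointwise with a uniform bound on Lipschitz constants, and there is a compact $K$ with $\operatorname{spt}f_i,\operatorname{spt}f\subset K$, then $T(f_i,\pi_i^1,\dots,\pi_i^k)\to T(f,\pi^1,\dots,\pi^k)$. The support of $T$ is the least closed set $F\subset X$ such that $T(f,\pi^1,\dots,\pi^k)=0$ whenever $f=0$ on $F$. *)

theory Defs
  imports "HOL-Analysis.Analysis"
begin

abbreviation unit_cube :: "(real ^ 'n) set"
  where "unit_cube \<equiv> cbox 0 1"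

definition Lipschitz_fun_on :: "'a::metric_space set \<Rightarrow> ('a \<Rightarrow> 'b::metric_space) \<Rightarrow> bool"
  where "Lipschitz_fun_on S f \<longleftrightarrow> (\<exists>L. L-lipschitz_on S f)"

text \<open>Only meaningful for Lipschitz \<open>f\<close>; the set of Lipschitz constants is then a
  nonempty closed subset of the nonnegative reals, so the infimum is attained.\<close>
definition Lip_const :: "'a::metric_space set \<Rightarrow> ('a \<Rightarrow> 'b::metric_space) \<Rightarrow> real"
  where "Lip_const S f = Inf {L. L-lipschitz_on S f}"


section \<open>Strong Lipschitz non-regularity\<close>

text \<open>Functions on \<open>Q\<close> are total functions of which only the values on \<open>Q\<close> matter; this is why
  the derivative matrix is taken \<open>within Q\<close>. By Rademacher's theorem the (arbitrary) value of
  \<open>jacobian\<close> at points of non-differentiability does not affect the integral. The supremum is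
  taken in the extended reals, where it is meaningful without a boundedness proviso.\<close>
definition strong_Lipschitz_nonregularity :: "(real ^ 'n::finite) set \<Rightarrow> bool"
  where "strong_Lipschitz_nonregularity Q \<longleftrightarrow>
    (\<exists>u :: nat \<Rightarrow> real ^ 'n \<Rightarrow> real. \<forall>n\<ge>1.
       set_integrable lebesgue Q (u n) \<and>
       (LINT x:Q|lebesgue. \<bar>u n x\<bar>) \<ge> 1 \<and>
       Sup {ereal \<bar>LINT x:Q|lebesgue. u n x * f x * det (jacobian \<pi> (at x within Q))\<bar>
            | (f :: real ^ 'n \<Rightarrow> real) (\<pi> :: real ^ 'n \<Rightarrow> real ^ 'n).
              Lipschitz_fun_on Q f \<and> Lipschitz_fun_on Q \<pi> \<and>
              max (Lip_const Q f) (SUP x\<in>Q. \<bar>f x\<bar>)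
                * (\<Prod>j\<in>UNIV. Lip_const Q (\<lambda>x. \<pi> x $ j)) \<le> 1}
         \<le> ereal (1 / real n))"


section \<open>Metric currents\<close>

definition spt :: "('a::topological_space \<Rightarrow> real) \<Rightarrow> 'a set"
  where "spt f = closure {x. f x \<noteq> 0}"

definition Lip :: "('a::metric_space \<Rightarrow> real) set"
  where "Lip = {f. Lipschitz_fun_on UNIV f}"

definition Lip_c :: "('a::metric_space \<Rightarrow> real) set"
  where "Lip_c = {f \<in> Lip. compact (spt f)}"

text \<open>A \<open>k\<close>-current takes its \<open>k\<close> Lipschitz arguments as a family indexed by a finite type
  \<open>'k\<close> with \<open>k\<close> elements. The values of \<open>T\<close> outside \<open>Lip_c\<close> and \<open>Lip\<close> are irrelevant.\<close>
definition metric_current ::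
    "(('a::metric_space \<Rightarrow> real) \<Rightarrow> ('k::finite \<Rightarrow> 'a \<Rightarrow> real) \<Rightarrow> real) \<Rightarrow> bool"
  where "metric_current T \<longleftrightarrow>
    \<comment> \<open>multilinearity\<close>
    (\<forall>f\<in>Lip_c. \<forall>g\<in>Lip_c. \<forall>\<pi>. \<forall>a b. (\<forall>j. \<pi> j \<in> Lip) \<longrightarrow>
       T (\<lambda>x. a * f x + b * g x) \<pi> = a * T f \<pi> + b * T g \<pi>) \<and>
    (\<forall>f\<in>Lip_c. \<forall>\<pi>. \<forall>j. \<forall>\<sigma>\<in>Lip. \<forall>\<tau>\<in>Lip. \<forall>a b. (\<forall>j. \<pi> j \<in> Lip) \<longrightarrow>
       T f (\<pi>(j := (\<lambda>x. a * \<sigma> x + b * \<tau> x))) = a * T f (\<pi>(j := \<sigma>)) + b * T f (\<pi>(j := \<tau>))) \<and>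
    \<comment> \<open>locality\<close>
    (\<forall>f\<in>Lip_c. \<forall>\<pi>. (\<forall>j. \<pi> j \<in> Lip) \<and>
       (\<exists>j U c. open U \<and> spt f \<subseteq> U \<and> (\<forall>x\<in>U. \<pi> j x = c)) \<longrightarrow> T f \<pi> = 0) \<and>
    \<comment> \<open>joint continuity\<close>
    (\<forall>F f P \<pi> L K.
       (\<forall>i. F i \<in> Lip_c) \<and> f \<in> Lip_c \<and> (\<forall>i j. P i j \<in> Lip) \<and> (\<forall>j. \<pi> j \<in> Lip) \<and>
       (\<forall>x. (\<lambda>i. F i x) \<longlonglongrightarrow> f x) \<and> (\<forall>j x. (\<lambda>i. P i j x) \<longlonglongrightarrow> \<pi> j x) \<and>
       (\<forall>i. L-lipschitz_on UNIV (F i)) \<and> (\<forall>i j. L-lipschitz_on UNIV (P i j)) \<and>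
       compact K \<and> (\<forall>i. spt (F i) \<subseteq> K) \<and> spt f \<subseteq> K \<longrightarrow>
       (\<lambda>i. T (F i) (P i)) \<longlonglongrightarrow> T f \<pi>)"

definition current_carrier ::
    "(('a::metric_space \<Rightarrow> real) \<Rightarrow> ('k::finite \<Rightarrow> 'a \<Rightarrow> real) \<Rightarrow> real) \<Rightarrow> 'a set \<Rightarrow> bool"
  where "current_carrier T F \<longleftrightarrow> closed F \<and>
    (\<forall>f\<in>Lip_c. \<forall>\<pi>. (\<forall>j. \<pi> j \<in> Lip) \<and> (\<forall>x\<in>F. f x = 0) \<longrightarrow> T f \<pi> = 0)"

text \<open>That a least such set exists for every metric current is proved in
  \<open>current_carrier_support\<close> below.\<close>
definition current_support ::
    "(('a::metric_space \<Rightarrow> real) \<Rightarrow> ('k::finite \<Rightarrow> 'a \<Rightarrow> real) \<Rightarrow> real) \<Rightarrow> 'a set"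
  where "current_support T = (LEAST F. current_carrier T F)"


section \<open>Test functions\<close>

primrec C_k :: "nat \<Rightarrow> ('a::real_normed_vector \<Rightarrow> real) \<Rightarrow> bool"
  where
    "C_k 0 f \<longleftrightarrow> continuous_on UNIV f"
  | "C_k (Suc k) f \<longleftrightarrow> (\<forall>x. f differentiable (at x)) \<and>
       (\<forall>v. C_k k (\<lambda>x. frechet_derivative f (at x) v))"

definition test_functions :: "('a::real_normed_vector \<Rightarrow> real) set"
  where "test_functions = {\<phi>. (\<forall>k. C_k k \<phi>) \<and> compact (spt \<phi>)}"


section \<open>Existence of the support\<close>

lemma Lip_I: "L-lipschitz_on UNIV f \<Longrightarrow> f \<in> Lip"
  by (auto simp: Lip_def Lipschitz_fun_on_def)

lemma lipschitz_on_min_max_real: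
  fixes f g :: "'a::metric_space \<Rightarrow> real"
  assumes "L-lipschitz_on S f" "M-lipschitz_on S g"
  shows "(L + M)-lipschitz_on S (\<lambda>x. min (f x) (g x))"
    and "(L + M)-lipschitz_on S (\<lambda>x. max (f x) (g x))"
proof -
  have *: "dist (min (f x) (g x)) (min (f y) (g y)) \<le> (L + M) * dist x y \<and>
           dist (max (f x) (g x)) (max (f y) (g y)) \<le> (L + M) * dist x y"
    if "x \<in> S" "y \<in> S" for x y
  proof -
    have "\<bar>f x - f y\<bar> \<le> L * dist x y" "\<bar>g x - g y\<bar> \<le> M * dist x y"
      using lipschitz_onD[OF assms(1) that] lipschitz_onD[OF assms(2) that]
      by (auto simp: dist_real_def)
    moreover have "\<bar>min a b - min a' b'\<bar> \<le> c + e \<and> \<bar>max a b - max a' b'\<bar> \<le> c + e"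
      if "\<bar>a - a'\<bar> \<le> c" "\<bar>b - b'\<bar> \<le> e" for a b a' b' c e :: real
      using that by linarith
    ultimately show ?thesis unfolding dist_real_def distrib_right by blast
  qed
  show "(L + M)-lipschitz_on S (\<lambda>x. min (f x) (g x))"
       "(L + M)-lipschitz_on S (\<lambda>x. max (f x) (g x))"
    using * assms[THEN lipschitz_on_nonneg] by (auto intro!: lipschitz_onI)
qed

lemma Lip_c_I:
  assumes "L-lipschitz_on UNIV g" "f \<in> Lip_c" "\<And>x. f x = 0 \<Longrightarrow> g x = 0"
  shows "g \<in> Lip_c" "spt g \<subseteq> spt f"
proof -
  show *: "spt g \<subseteq> spt f"
    unfolding spt_def by (rule closure_mono) (use assms(3) in auto)
  have "closed (spt g)" by (simp add: spt_def)
  then have "compact (spt g)"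
    using * assms(2) compact_Int_closed[of "spt f" "spt g"] by (simp add: Lip_c_def inf.absorb2)
  with assms(1) show "g \<in> Lip_c" by (auto simp: Lip_c_def intro: Lip_I)
qed

lemma Lip_c_bounded:
  assumes "f \<in> Lip_c" obtains B where "B > 0" "\<And>x. \<bar>f x\<bar> \<le> B"
proof -
  obtain L where L: "L-lipschitz_on UNIV f"
    using assms by (auto simp: Lip_c_def Lip_def Lipschitz_fun_on_def)
  have "continuous_on (spt f) f"
    using lipschitz_on_continuous_on[OF L] continuous_on_subset by blast
  then have "compact (f ` spt f)" using assms by (auto simp: Lip_c_def intro: compact_continuous_image)
  then obtain B where B: "B > 0" "\<And>y. y \<in> f ` spt f \<Longrightarrow> norm y \<le> B"
    using compact_imp_bounded bounded_pos by metis
  have "\<bar>f x\<bar> \<le> B" for x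
  proof (cases "f x = 0")
    case False
    then have "x \<in> spt f" unfolding spt_def using closure_subset[of "{x. f x \<noteq> 0}"] by auto
    then show ?thesis using B by auto
  qed (use B in auto)
  with B that show ?thesis by blast
qed

lemma metric_current_lincomb:
  assumes "metric_current T" "\<And>j. \<pi> j \<in> Lip" "f \<in> Lip_c" "g \<in> Lip_c"
  shows "T (\<lambda>x. a * f x + b * g x) \<pi> = a * T f \<pi> + b * T g \<pi>"
proof -
  from assms(1) have "\<forall>f\<in>Lip_c. \<forall>g\<in>Lip_c. \<forall>\<pi>. \<forall>a b. (\<forall>j. \<pi> j \<in> Lip) \<longrightarrow>
       T (\<lambda>x. a * f x + b * g x) \<pi> = a * T f \<pi> + b * T g \<pi>"
    unfolding metric_current_def by (rule conjunct1)
  from this[rule_format, OF assms(3,4,2)] show ?thesis .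
qed

lemma metric_current_finite_cover:
  fixes T :: "('a::metric_space \<Rightarrow> real) \<Rightarrow> ('k::finite \<Rightarrow> 'a \<Rightarrow> real) \<Rightarrow> real"
  assumes T: "metric_current T" and \<pi>: "\<And>j. \<pi> j \<in> Lip"
    and "finite I"
    and "\<And>x r. (x, r) \<in> I \<Longrightarrow> r > 0 \<and> (\<exists>F. current_carrier T F \<and> ball x (2 * r) \<inter> F = {})"
    and "f \<in> Lip_c" "\<And>x. f x \<ge> 0"
    and "{x. f x \<noteq> 0} \<subseteq> (\<Union>(x, r)\<in>I. ball x r)"
  shows "T f \<pi> = 0"
  using assms(3-)
proof (induction I arbitrary: f rule: finite_induct)
  case empty
  then have eq: "(\<lambda>x. 0 * f x + 0 * f x) = f" by auto
  have "T (\<lambda>x. 0 * f x + 0 * f x) \<pi> = 0 * T f \<pi> + 0 * T f \<pi>"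
    by (rule metric_current_lincomb[OF T \<pi>]) (rule empty)+
  then show ?case unfolding eq by simp
next
  case (insert p I)
  obtain z r where p: "p = (z, r)" by force
  obtain F where r: "r > 0" and F: "current_carrier T F" "ball z (2 * r) \<inter> F = {}"
    using insert.prems(1)[of z r] p by auto
  obtain B where B: "B > 0" "\<And>x. \<bar>f x\<bar> \<le> B" using Lip_c_bounded insert.prems(2) by blast
  obtain L where L: "L-lipschitz_on UNIV f"
    using insert.prems(2) by (auto simp: Lip_c_def Lip_def Lipschitz_fun_on_def)
  define w where "w y = (B / r) * max 0 (2 * r - dist y z)" for y
  define g where "g y = min (f y) (w y)" for y
  have "1-lipschitz_on UNIV (\<lambda>y. 2 * r - dist y z)"
    proof (rule lipschitz_onI)
    fix x y
    have "\<bar>dist y z - dist x z\<bar> \<le> dist x y"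
      using dist_triangle[of y z x] dist_triangle[of x z y] by (simp add: dist_commute abs_le_iff)
    then show "dist (2 * r - dist x z) (2 * r - dist y z) \<le> 1 * dist x y"
      by (simp add: dist_real_def abs_minus_commute)
  qed simp
  from lipschitz_on_cmult_real[OF lipschitz_on_min_max_real(2)[OF lipschitz_on_constant this], of "B / r" 0]
  obtain M where "M-lipschitz_on UNIV w" unfolding w_def by blast
  from lipschitz_on_min_max_real(1)[OF L this] have gL: "(L + M)-lipschitz_on UNIV g"
    unfolding g_def .
  have w0: "w y \<ge> 0" for y using B r by (auto simp: w_def)
  have g: "g \<in> Lip_c" by (rule Lip_c_I[OF gL insert.prems(2)]) (use w0 in \<open>auto simp: g_def min_def\<close>)
  have "g y = 0" if "y \<in> F" for y
  proof -
    have "dist y z \<ge> 2 * r" using F(2) that by (force simp: dist_commute not_less[symmetric])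
    then show ?thesis using insert.prems(3)[of y] by (simp add: g_def w_def max_def min_def)
  qed
  then have Tg: "T g \<pi> = 0" using F(1) g \<pi> unfolding current_carrier_def by blast
  define h where "h y = f y - g y" for y
  have hL: "(L + (L + M))-lipschitz_on UNIV h"
    unfolding h_def by (rule lipschitz_on_diff[OF L gL])
  have h: "h \<in> Lip_c"
    by (rule Lip_c_I[OF hL insert.prems(2)]) (use w0 in \<open>auto simp: h_def g_def min_def\<close>)
  have Th: "T h \<pi> = 0"
  proof (rule insert.IH[OF _ h])
    show "h x \<ge> 0" for x by (simp add: h_def g_def)
    show "{x. h x \<noteq> 0} \<subseteq> (\<Union>(x, r)\<in>I. ball x r)"
    proof
      fix y assume "y \<in> {x. h x \<noteq> 0}"
      then have hy: "f y > w y" by (auto simp: h_def g_def min_def split: if_splits)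
      then have "f y \<noteq> 0" using w0[of y] by auto
      moreover have "y \<notin> ball z r"
      proof
        assume "y \<in> ball z r"
        then have "2 * r - dist y z \<ge> r" by (simp add: dist_commute)
        then have "w y \<ge> (B / r) * r" unfolding w_def using B r by (intro mult_left_mono) auto
        then show False using hy B(2)[of y] r by auto
      qed
      ultimately show "y \<in> (\<Union>(x, r)\<in>I. ball x r)" using subsetD[OF insert.prems(4), of y] p by auto
    qed
    show "r' > 0 \<and> (\<exists>F. current_carrier T F \<and> ball x (2 * r') \<inter> F = {})"
      if "(x, r') \<in> I" for x r'
      by (rule insert.prems(1)) (use that in blast)
  qed
  have eq: "(\<lambda>x. 1 * g x + 1 * h x) = f" by (auto simp: h_def)
  have "T (\<lambda>x. 1 * g x + 1 * h x) \<pi> = 1 * T g \<pi> + 1 * T h \<pi>"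
    by (rule metric_current_lincomb[OF T \<pi> g h])
  then show ?case unfolding eq Tg Th by simp
qed

lemma metric_current_nonneg:
  fixes T :: "('a::metric_space \<Rightarrow> real) \<Rightarrow> ('k::finite \<Rightarrow> 'a \<Rightarrow> real) \<Rightarrow> real"
  assumes T: "metric_current T" and \<pi>: "\<And>j. \<pi> j \<in> Lip"
    and f: "f \<in> Lip_c" "\<And>x. f x \<ge> 0" "\<And>x. x \<in> \<Inter>{F. current_carrier T F} \<Longrightarrow> f x = 0"
  shows "T f \<pi> = 0"
proof -
  define g where "g i x = max 0 (f x - 1 / real (Suc i))" for i x
  obtain L where L: "L-lipschitz_on UNIV f"
    using f(1) by (auto simp: Lip_c_def Lip_def Lipschitz_fun_on_def)
  have gL: "L-lipschitz_on UNIV (g i)" for i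
    using lipschitz_on_min_max_real(2)[OF lipschitz_on_constant
        lipschitz_on_diff[OF L lipschitz_on_constant], of 0 "1 / real (Suc i)"]
    by (simp add: g_def[abs_def])
  have g0: "g i x = 0" if "f x = 0" for i x using that by (simp add: g_def)
  have g: "g i \<in> Lip_c" "spt (g i) \<subseteq> spt f" for i
    using Lip_c_I[OF gL f(1) g0] by auto
  have Tg: "T (g i) \<pi> = 0" for i
  proof -
    define K where "K = {x. f x \<ge> 1 / real (Suc i)}"
    have "closed K" unfolding K_def
      by (intro closed_Collect_le continuous_on_const lipschitz_on_continuous_on[OF L])
    moreover have "K \<subseteq> spt f"
    proof
      fix x assume "x \<in> K"
      then have "f x \<ge> 1 / real (Suc i)" by (simp add: K_def)
      moreover have "1 / real (Suc i) > 0" by simp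
      ultimately have "f x \<noteq> 0" by linarith
      then show "x \<in> spt f" unfolding spt_def using closure_subset[of "{x. f x \<noteq> 0}"] by auto
    qed
    ultimately have K: "compact K"
      using f(1) compact_Int_closed[of "spt f" K] by (simp add: Lip_c_def inf.absorb2)
    have "\<exists>r. r > 0 \<and> (\<exists>F. current_carrier T F \<and> ball x (2 * r) \<inter> F = {})" if "x \<in> K" for x
    proof -
      have "f x \<ge> 1 / real (Suc i)" using that by (simp add: K_def)
      moreover have "1 / real (Suc i) > 0" by simp
      ultimately have "f x \<noteq> 0" by linarith
      then obtain F where F: "current_carrier T F" "x \<notin> F" using f(3) by blast
      then have "open (- F)" by (auto simp: current_carrier_def)
      then obtain e where "e > 0" "ball x e \<subseteq> - F" using F(2) openE by blast
      with F show ?thesis by (intro exI[of _ "e / 2"]) auto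
    qed
    then obtain R where R: "\<And>x. x \<in> K \<Longrightarrow> R x > 0 \<and>
        (\<exists>F. current_carrier T F \<and> ball x (2 * R x) \<inter> F = {})" by metis
    obtain J where J: "J \<subseteq> K" "finite J" "K \<subseteq> (\<Union>x\<in>J. ball x (R x))"
      by (rule compactE_image[OF K, of K "\<lambda>x. ball x (R x)"]) (use R in force)+
    show ?thesis
    proof (rule metric_current_finite_cover[OF T \<pi>, where I = "(\<lambda>x. (x, R x)) ` J"])
      show "{x. g i x \<noteq> 0} \<subseteq> (\<Union>(x, r)\<in>(\<lambda>x. (x, R x)) ` J. ball x r)"
      proof
        fix x assume "x \<in> {x. g i x \<noteq> 0}"
        then have "x \<in> K" by (auto simp: g_def K_def max_def split: if_splits)
        then show "x \<in> (\<Union>(x, r)\<in>(\<lambda>x. (x, R x)) ` J. ball x r)"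
          using subsetD[OF J(3)] by auto
      qed
      show "0 \<le> g i x" for x by (simp add: g_def)
    qed (use J R g in auto)
  qed
  have lim: "(\<lambda>i. g i x) \<longlonglongrightarrow> f x" for x
  proof -
    have "(\<lambda>i. max 0 (f x - 1 / real (Suc i))) \<longlonglongrightarrow> max 0 (f x - 0)"
      by (intro tendsto_intros LIMSEQ_Suc[OF lim_1_over_n])
    then show ?thesis using f(2)[of x] by (simp add: g_def max_def)
  qed
  obtain M where M: "\<And>j. (M j)-lipschitz_on UNIV (\<pi> j)"
    using \<pi> unfolding Lip_def Lipschitz_fun_on_def mem_Collect_eq by metis
  define N where "N = L + (\<Sum>j\<in>UNIV. M j)"
  have M0: "M j \<ge> 0" for j using M lipschitz_on_nonneg by blast
  have L0: "L \<ge> 0" using L lipschitz_on_nonneg by blast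
  have "L \<le> N" using M0 by (simp add: N_def sum_nonneg)
  then have gN: "N-lipschitz_on UNIV (g i)" for i using gL lipschitz_on_le by blast
  have "M j \<le> N" for j
    using member_le_sum[of j UNIV M] M0 L0 by (simp add: N_def)
  then have \<pi>N: "N-lipschitz_on UNIV (\<pi> j)" for j using M lipschitz_on_le by blast
  have "(\<lambda>i. T (g i) \<pi>) \<longlonglongrightarrow> T f \<pi>"
    using T unfolding metric_current_def
    apply (elim conjE)
    apply (drule spec[of _ g], drule spec[of _ f], drule spec[of _ "\<lambda>_. \<pi>"], drule spec[of _ \<pi>],
        drule spec[of _ N], drule spec[of _ "spt f"])
    apply (erule mp)
    using g f(1) \<pi> lim gN \<pi>N by (auto simp: Lip_c_def)
  with Tg show ?thesis by (simp add: LIMSEQ_const_iff)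
qed

lemma current_carrier_Inter:
  fixes T :: "('a::metric_space \<Rightarrow> real) \<Rightarrow> ('k::finite \<Rightarrow> 'a \<Rightarrow> real) \<Rightarrow> real"
  assumes T: "metric_current T"
  shows "current_carrier T (\<Inter>{F. current_carrier T F})"
  unfolding current_carrier_def[of T "\<Inter>_"]
proof (intro conjI ballI allI impI closed_Inter)
  show "closed F" if "F \<in> {F. current_carrier T F}" for F
    using that by (simp add: current_carrier_def)
next
  fix f :: "'a \<Rightarrow> real" and \<pi> :: "'k \<Rightarrow> 'a \<Rightarrow> real"
  assume f: "f \<in> Lip_c"
    and "(\<forall>j. \<pi> j \<in> Lip) \<and> (\<forall>x\<in>\<Inter>{F. current_carrier T F}. f x = 0)"
  then have \<pi>: "\<And>j. \<pi> j \<in> Lip" and f0: "\<And>x. x \<in> \<Inter>{F. current_carrier T F} \<Longrightarrow> f x = 0"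
    by blast+
  obtain L where L: "L-lipschitz_on UNIV f"
    using f by (auto simp: Lip_c_def Lip_def Lipschitz_fun_on_def)
  define p where "p x = max 0 (f x)" for x
  define q where "q x = max 0 (- f x)" for x
  have pq: "L-lipschitz_on UNIV p" "L-lipschitz_on UNIV q"
    using lipschitz_on_min_max_real(2)[OF lipschitz_on_constant L, of 0]
      lipschitz_on_min_max_real(2)[OF lipschitz_on_constant lipschitz_on_minus[OF L], of 0]
    by (simp_all add: p_def[abs_def] q_def[abs_def])
  have p: "p \<in> Lip_c" by (rule Lip_c_I[OF pq(1) f]) (simp add: p_def)
  have q: "q \<in> Lip_c" by (rule Lip_c_I[OF pq(2) f]) (simp add: q_def)
  have "T p \<pi> = 0"
    by (rule metric_current_nonneg[OF T \<pi> p]) (use f0 in \<open>simp_all add: p_def\<close>)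
  moreover have "T q \<pi> = 0"
    by (rule metric_current_nonneg[OF T \<pi> q]) (use f0 in \<open>simp_all add: q_def\<close>)
  moreover have eq: "(\<lambda>x. 1 * p x + (-1) * q x) = f" by (auto simp: p_def q_def)
  ultimately show "T f \<pi> = 0"
    using metric_current_lincomb[OF T \<pi> p q, of 1 "-1"] unfolding eq by simp
qed

lemma current_support_eq_Inter:
  assumes "metric_current T"
  shows "current_support T = \<Inter>{F. current_carrier T F}"
  unfolding current_support_def
  by (rule Least_equality) (use current_carrier_Inter[OF assms] in auto)

lemma current_carrier_support:
  assumes "metric_current T"
  shows "current_carrier T (current_support T)"
    and "current_carrier T F \<Longrightarrow> current_support T \<subseteq> F"
  using current_carrier_Inter[OF assms] current_support_eq_Inter[OF assms] by auto

end

theory Submission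
  imports Defs
begin

text \<open>
  Write \<open>[g]\<close> for the functional \<open>(f, \<pi>) \<mapsto> \<integral> g f det D\<pi>\<close>. Let \<open>w n\<close> be the functions given by strong
  nonregularity, extended by zero and normalised to have norm one in \<open>L\<^sup>1\<close>. The current is
  \<open>T = \<Sum>k. 4 ^ k * [w (\<nu> k)]\<close> for a rapidly increasing sequence \<open>\<nu>\<close>. Nonregularity says that
  \<open>[w n]\<close> is of size \<open>1 / n\<close> when measured by the Lipschitz constants of its arguments and the maximum
  of the first one, so the series converges. Evaluated on the coordinate functions, however, \<open>[w n]\<close> is integration against \<open>w n\<close>,
  whose norm is one. Choose test functions \<open>\<phi> n\<close> with \<open>\<bar>\<phi> n\<bar> \<le> 1\<close> and \<open>\<integral> w n * \<phi> n \<ge> 2/5\<close>. In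
  \<open>T (\<phi> (\<nu> k))\<close> the \<open>k\<close>-th term is at least \<open>2/5 * 4 ^ k\<close>, the earlier terms add up to at
  most \<open>4 ^ k / 3\<close>, and the later ones are negligible because \<open>\<nu>\<close> was chosen with regard to the
  Lipschitz constant of \<open>\<phi> (\<nu> k)\<close>. Hence \<open>T\<close> is unbounded on test functions bounded by one, which
  is impossible for integration against a function in \<open>L\<^sup>1\<close>.

  What needs analysis is that \<open>[g]\<close> is a metric current for every integrable \<open>g\<close> of bounded support,
  and here the point is joint continuity: Jacobian determinants converge weakly when the maps converge
  uniformly with bounded Lipschitz constants. For twice continuously differentiable maps this is
  \<open>Jac_weak_continuity\<close>. The cofactors of a Jacobian matrix are divergence free, so
  integration against a smooth compactly supported \<open>h\<close> can be arranged to put the derivative on \<open>h\<close>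
  instead of on the difference of the two maps; a general \<open>g\<close> is approximated in \<open>L\<^sup>1\<close> by such \<open>h\<close>,
  the determinants being uniformly bounded.

  For Lipschitz maps \<open>\<pi>\<close> the functional \<open>[g]\<close> is defined as the limit of its values on mollifications
  of \<open>\<pi>\<close>. Weak continuity makes these values a Cauchy sequence and yields the axioms of a current
  in the limit; and since mollification does not increase Lipschitz constants, the
  bound from nonregularity passes to the limit as well.
\<close>

section \<open>Gradients, determinants and integration by parts\<close>

definition gradient :: "(real ^ 'n::finite \<Rightarrow> real) \<Rightarrow> real ^ 'n \<Rightarrow> real ^ 'n"
  where "gradient f x = (\<chi> j. frechet_derivative f (at x) (axis j 1))"

lemma has_derivative_gradient:
  assumes "f differentiable (at x)"
  shows "(f has_derivative (\<lambda>v. gradient f x \<bullet> v)) (at x)"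
proof -
  define f' where "f' = frechet_derivative f (at x)"
  have f': "(f has_derivative f') (at x)"
    using assms by (simp add: f'_def frechet_derivative_works)
  then have lin: "linear f'" by (rule has_derivative_linear)
  have "f' v = gradient f x \<bullet> v" for v
  proof -
    have "f' v = f' (\<Sum>j\<in>UNIV. v $ j *\<^sub>R axis j 1)"
      using basis_expansion[of v] by (simp add: scalar_mult_eq_scaleR)
    also have "\<dots> = (\<Sum>j\<in>UNIV. v $ j * f' (axis j 1))"
      by (simp add: linear_sum[OF lin] linear_scale[OF lin])
    finally show ?thesis
      by (simp add: gradient_def f'_def inner_vec_def mult.commute)
  qed
  then have "f' = (\<lambda>v. gradient f x \<bullet> v)" by auto
  with f' show ?thesis by simp
qed

lemma gradient_eqI:
  assumes "(f has_derivative (\<lambda>v. a \<bullet> v)) (at x)"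
  shows "gradient f x = a"
proof -
  have "frechet_derivative f (at x) = (\<lambda>v. a \<bullet> v)"
    using frechet_derivative_at[OF assms] by simp
  then show ?thesis by (simp add: gradient_def vec_eq_iff inner_axis)
qed

lemma gradient_component: "gradient (\<lambda>x :: real ^ 'n::finite. x $ i) z = axis i 1"
  by (rule gradient_eqI) (simp add: inner_axis' bounded_linear_imp_has_derivative[OF bounded_linear_vec_nth])

lemma gradient_lincomb:
  assumes "f differentiable (at x)" "g differentiable (at x)"
  shows "gradient (\<lambda>x. a * f x + b * g x) x = a *\<^sub>R gradient f x + b *\<^sub>R gradient g x"
  by (rule gradient_eqI)
     (auto intro!: derivative_eq_intros has_derivative_gradient assms simp: inner_add_left)

lemma gradient_mult:
  assumes "f differentiable (at x)" "g differentiable (at x)"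
  shows "gradient (\<lambda>x. f x * g x) x = f x *\<^sub>R gradient g x + g x *\<^sub>R gradient f x"
  by (rule gradient_eqI)
     (auto intro!: derivative_eq_intros has_derivative_gradient assms simp: inner_add_left)

lemma gradient_locally_const:
  assumes "open U" "x \<in> U" "\<And>y. y \<in> U \<Longrightarrow> f y = c"
  shows "gradient f x = 0"
proof (rule gradient_eqI)
  have "((\<lambda>_. c) has_derivative (\<lambda>v. 0 \<bullet> v)) (at x)" by simp
  then show "(f has_derivative (\<lambda>v. 0 \<bullet> v)) (at x)"
    by (rule has_derivative_transform_within_open[OF _ assms(1,2)]) (use assms(3) in simp)
qed

lemma gradient_zero_outside:
  assumes "\<And>x. norm x > R \<Longrightarrow> f x = 0" "norm x > R"
  shows "gradient f x = 0"
  by (rule gradient_locally_const[of "{x. norm x > R}" _ _ 0])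
     (use assms in \<open>auto intro!: open_Collect_less continuous_intros\<close>)

text \<open>The difference quotients of \<open>f\<close> in the direction of its own gradient are at
  most \<open>L * norm (gradient f x)\<close> and converge to the square of that norm.\<close>

lemma norm_gradient_le:
  assumes L: "L-lipschitz_on UNIV f" and "f differentiable (at x)"
  shows "norm (gradient f x) \<le> L"
proof -
  let ?g = "gradient f x"
  have L0: "L \<ge> 0" using L by (rule lipschitz_on_nonneg)
  have "((\<lambda>t. f (x + t *\<^sub>R ?g)) has_derivative (\<lambda>t. ?g \<bullet> (t *\<^sub>R ?g))) (at 0)"
  proof -
    have "((\<lambda>t. x + t *\<^sub>R ?g) has_derivative (\<lambda>t. t *\<^sub>R ?g)) (at 0)"
      by (auto intro!: derivative_eq_intros)
    moreover have "(f has_derivative (\<lambda>v. ?g \<bullet> v)) (at (x + 0 *\<^sub>R ?g))"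
      using has_derivative_gradient[OF assms(2)] by simp
    ultimately show ?thesis by (rule has_derivative_compose)
  qed
  then have "((\<lambda>t. f (x + t *\<^sub>R ?g)) has_real_derivative (?g \<bullet> ?g)) (at 0)"
    by (simp add: has_field_derivative_def mult.commute[of _ "?g \<bullet> ?g"])
  then have lim: "((\<lambda>t. (f (x + t *\<^sub>R ?g) - f x) / t) \<longlongrightarrow> ?g \<bullet> ?g) (at 0)"
    by (simp add: DERIV_def)
  have "?g \<bullet> ?g \<le> L * norm ?g"
  proof (rule tendsto_upperbound[OF lim])
    show "\<forall>\<^sub>F t in at 0. (f (x + t *\<^sub>R ?g) - f x) / t \<le> L * norm ?g"
    proof (rule eventually_at_filter[THEN iffD2], intro always_eventually allI impI)
      fix t :: real assume "t \<noteq> 0"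
      have "\<bar>f (x + t *\<^sub>R ?g) - f x\<bar> \<le> L * (\<bar>t\<bar> * norm ?g)"
        using lipschitz_onD[OF L, of "x + t *\<^sub>R ?g" x] by (simp add: dist_norm)
      then have "\<bar>(f (x + t *\<^sub>R ?g) - f x) / t\<bar> \<le> L * norm ?g"
        using \<open>t \<noteq> 0\<close> by (simp add: divide_simps abs_divide mult_ac)
      then show "(f (x + t *\<^sub>R ?g) - f x) / t \<le> L * norm ?g" by linarith
    qed
  qed simp
  then have "norm ?g * norm ?g \<le> L * norm ?g"
    by (simp add: dot_square_norm power2_eq_square)
  then show ?thesis
    using L0 by (cases "norm ?g = 0") (auto simp: mult_le_cancel_right)
qed

lemma gradient_component_le:
  assumes "L-lipschitz_on UNIV f" and "f differentiable (at x)"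
  shows "\<bar>gradient f x $ j\<bar> \<le> L"
  using component_le_norm_cart[of "gradient f x" j] norm_gradient_le[OF assms] by linarith

lemma abs_det_le:
  fixes A :: "real ^ 'n::finite ^ 'n"
  assumes "\<And>i j. \<bar>A $ i $ j\<bar> \<le> b i"
  shows "\<bar>det A\<bar> \<le> fact CARD('n) * (\<Prod>i\<in>UNIV. b i)"
proof -
  let ?P = "{p. p permutes (UNIV::'n set)}"
  have "\<bar>det A\<bar> \<le> (\<Sum>p\<in>?P. \<bar>of_int (sign p) * (\<Prod>i\<in>UNIV. A $ i $ p i)\<bar>)"
    unfolding det_def by (rule sum_abs)
  also have "\<dots> \<le> (\<Sum>p\<in>?P. \<Prod>i\<in>UNIV. b i)"
  proof (rule sum_mono)
    fix p assume "p \<in> ?P"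
    have "\<bar>\<Prod>i\<in>UNIV. A $ i $ p i\<bar> \<le> (\<Prod>i\<in>UNIV. b i)"
      unfolding abs_prod by (rule prod_mono) (use assms in auto)
    moreover have "\<bar>of_int (sign p) :: real\<bar> = 1" by (simp add: sign_def)
    ultimately show "\<bar>of_int (sign p) * (\<Prod>i\<in>UNIV. A $ i $ p i)\<bar> \<le> (\<Prod>i\<in>UNIV. b i)"
      by (simp add: abs_mult)
  qed
  also have "\<dots> = fact CARD('n) * (\<Prod>i\<in>UNIV. b i)"
    by (simp add: card_permutations)
  finally show ?thesis .
qed

text \<open>The gradient is bounded because it is continuous and vanishes outside a ball.\<close>

lemma C1_zero_outside_lipschitz:
  assumes diff: "\<And>x. f differentiable (at x)"
    and cont: "continuous_on UNIV (gradient f)"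
    and supp: "\<And>x. norm x > R \<Longrightarrow> f x = 0"
  obtains L where "L > 0" "L-lipschitz_on UNIV f"
proof -
  have zero: "gradient f x = 0" if "norm x > R" for x
    using gradient_zero_outside supp that by blast
  have "compact (gradient f ` cball 0 R)"
    by (intro compact_continuous_image continuous_on_subset[OF cont]) auto
  then obtain B where B: "B > 0" "\<And>x. x \<in> cball 0 R \<Longrightarrow> norm (gradient f x) \<le> B"
    using compact_imp_bounded bounded_pos by (metis imageI)
  have B': "norm (gradient f x) \<le> B" for x
    using B zero[of x] by (cases "norm x > R") auto
  have "B-lipschitz_on UNIV f"
  proof (rule bounded_derivative_imp_lipschitz)
    show "(f has_derivative (\<lambda>v. gradient f x \<bullet> v)) (at x within UNIV)" for x
      using has_derivative_gradient[OF diff] by simp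
    show "onorm (\<lambda>v. gradient f x \<bullet> v) \<le> B" for x
    proof (rule onorm_bound)
      show "norm (gradient f x \<bullet> v) \<le> B * norm v" for v
        using Cauchy_Schwarz_ineq2[of "gradient f x" v] mult_right_mono[OF B'[of x], of "norm v"]
        by simp
    qed (use B in auto)
  qed (use B in auto)
  with B that show ?thesis by blast
qed

lemma integrable_lborel_continuous_bounded_support:
  fixes f :: "'a::euclidean_space \<Rightarrow> real"
  assumes "continuous_on UNIV f" "\<And>x. norm x > R \<Longrightarrow> f x = 0"
  shows "integrable lborel f"
proof -
  have "integrable lborel (\<lambda>x. indicator (cball 0 R) x *\<^sub>R f x)"
    by (rule borel_integrable_compact) (auto intro: continuous_on_subset[OF assms(1)])
  moreover have "(\<lambda>x. indicator (cball 0 R) x *\<^sub>R f x) = f"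
    using assms(2) by (auto simp: indicator_def fun_eq_iff not_le)
  ultimately show ?thesis by simp
qed

lemma integral_lborel_translate:
  fixes f :: "'a::euclidean_space \<Rightarrow> real"
  shows "(LINT x|lborel. f (c + x)) = (LINT x|lborel. f x)"
proof (cases "f \<in> borel_measurable borel")
  case True
  have "(LINT x|distr lborel borel ((+) c). f x) = (LINT x|lborel. f (c + x))"
    by (rule integral_distr) (use True in auto)
  then show ?thesis by (simp add: lborel_distr_plus)
next
  case False
  have "(\<lambda>x. f (c + x)) \<notin> borel_measurable borel"
  proof
    assume "(\<lambda>x. f (c + x)) \<in> borel_measurable borel"
    then have "(\<lambda>x. f (c + (- c + x))) \<in> borel_measurable borel"
      by (rule measurable_compose[rotated]) auto
    with False show False by simp
  qed
  then have "\<not> integrable lborel (\<lambda>x. f (c + x))" "\<not> integrable lborel f"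
    using False borel_measurable_integrable by force+
  then show ?thesis by (simp add: not_integrable_integral_eq)
qed

text \<open>By translation invariance every difference quotient of \<open>f\<close> has integral
  zero; these quotients are bounded by the Lipschitz constant of \<open>f\<close> and vanish outside
  a common ball, so dominated convergence applies.\<close>

lemma integral_gradient_component_eq_0:
  fixes f :: "real ^ 'n::finite \<Rightarrow> real"
  assumes diff: "\<And>x. f differentiable (at x)"
    and cont: "continuous_on UNIV (gradient f)"
    and supp: "\<And>x. norm x > R \<Longrightarrow> f x = 0"
  shows "(LINT x|lborel. gradient f x $ j) = 0"
proof -
  obtain L where L: "L > 0" "L-lipschitz_on UNIV f"
    using C1_zero_outside_lipschitz[OF diff cont supp] by blast
  have fc: "continuous_on UNIV f" using L(2) by (rule lipschitz_on_continuous_on)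
  have fi: "integrable lborel f"
    using fc supp by (rule integrable_lborel_continuous_bounded_support)
  define e where "e n = 1 / real (Suc n)" for n
  define s where "s n x = (f (e n *\<^sub>R axis j 1 + x) - f x) / e n" for n x
  have e: "0 < e n" "e n \<le> 1" for n by (auto simp: e_def)
  have int_s: "(LINT x|lborel. s n x) = 0" for n
  proof -
    have "integrable lborel (\<lambda>x. f (e n *\<^sub>R axis j 1 + x))"
    proof (rule integrable_lborel_continuous_bounded_support[of _ "R + 1"])
      show "continuous_on UNIV (\<lambda>x. f (e n *\<^sub>R axis j 1 + x))"
        by (rule continuous_on_compose2[OF fc]) (auto intro!: continuous_intros)
      fix x :: "real ^ 'n" assume "norm x > R + 1"
      moreover have "norm x \<le> norm (e n *\<^sub>R axis j 1 + x) + norm (e n *\<^sub>R axis j (1::real) :: real ^ 'n)"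
        using norm_triangle_ineq4[of "e n *\<^sub>R axis j 1 + x" "e n *\<^sub>R axis j 1"] by simp
      ultimately show "f (e n *\<^sub>R axis j 1 + x) = 0"
        using e[of n] by (intro supp) (simp add: norm_axis_1)
    qed
    then show ?thesis
      unfolding s_def by (simp add: fi integral_lborel_translate)
  qed
  have lim: "(\<lambda>n. s n x) \<longlonglongrightarrow> gradient f x $ j" for x
  proof -
    have "((\<lambda>t. f (x + t *\<^sub>R axis j 1)) has_derivative (\<lambda>t. gradient f x \<bullet> (t *\<^sub>R axis j 1))) (at 0)"
    proof -
      have "((\<lambda>t. x + t *\<^sub>R axis j 1) has_derivative (\<lambda>t. t *\<^sub>R axis j 1)) (at (0::real))"
        by (auto intro!: derivative_eq_intros)
      moreover have "(f has_derivative (\<lambda>v. gradient f x \<bullet> v)) (at (x + 0 *\<^sub>R axis j 1))"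
        using has_derivative_gradient[OF diff] by simp
      ultimately show ?thesis by (rule has_derivative_compose)
    qed
    then have "((\<lambda>t. f (x + t *\<^sub>R axis j 1)) has_real_derivative gradient f x $ j) (at 0)"
      by (simp add: has_field_derivative_def mult.commute[of _ "gradient f x $ j"] inner_axis)
    then have "((\<lambda>t. (f (x + t *\<^sub>R axis j 1) - f x) / t) \<longlongrightarrow> gradient f x $ j) (at 0)"
      by (simp add: DERIV_def)
    moreover have "filterlim e (at 0) sequentially"
      unfolding filterlim_at using e(1) LIMSEQ_Suc[OF lim_1_over_n] less_imp_neq[OF e(1)]
      by (auto simp: e_def[abs_def])
    ultimately have "(\<lambda>n. (f (x + e n *\<^sub>R axis j 1) - f x) / e n) \<longlonglongrightarrow> gradient f x $ j"
      by (rule filterlim_compose)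
    then show ?thesis by (simp add: s_def add.commute)
  qed
  have "(\<lambda>n. LINT x|lborel. s n x) \<longlonglongrightarrow> (LINT x|lborel. gradient f x $ j)"
  proof (rule integral_dominated_convergence[where w = "\<lambda>x. L * indicator (cball 0 (R + 1)) x"])
    show "(\<lambda>x. gradient f x $ j) \<in> borel_measurable lborel"
      using continuous_on_component[OF cont] borel_measurable_continuous_onI by fastforce
    show "s n \<in> borel_measurable lborel" for n
    proof -
      have "continuous_on UNIV (s n)"
        unfolding s_def[abs_def] using e[of n]
        by (intro continuous_intros continuous_on_compose2[OF fc]) auto
      then show ?thesis using borel_measurable_continuous_onI by fastforce
    qed
    show "integrable lborel (\<lambda>x. L * indicator (cball 0 (R + 1)) x :: real)"
      by (intro integrable_mult_right integrable_real_indicator emeasure_bounded_finite[of "cball 0 (R + 1)"]) auto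
    show "AE x in lborel. (\<lambda>n. s n x) \<longlonglongrightarrow> gradient f x $ j"
      using lim by simp
    show "AE x in lborel. norm (s n x) \<le> L * indicator (cball 0 (R + 1)) x" for n
    proof (intro always_eventually allI)
      fix x :: "real ^ 'n"
      have "\<bar>f (e n *\<^sub>R axis j 1 + x) - f x\<bar> \<le> L * e n"
        using lipschitz_onD[OF L(2), of "e n *\<^sub>R axis j 1 + x" x] e[of n]
        by (simp add: dist_norm norm_axis_1)
      then have *: "\<bar>s n x\<bar> \<le> L" using e[of n] by (simp add: s_def divide_simps abs_divide)
      show "norm (s n x) \<le> L * indicator (cball 0 (R + 1)) x"
      proof (cases "norm x \<le> R + 1")
        case False
        moreover have "norm x \<le> norm (e n *\<^sub>R axis j 1 + x) + norm (e n *\<^sub>R axis j (1::real) :: real ^ 'n)"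
          using norm_triangle_ineq4[of "e n *\<^sub>R axis j 1 + x" "e n *\<^sub>R axis j 1"] by simp
        ultimately have "f (e n *\<^sub>R axis j 1 + x) = 0" "f x = 0"
          using e[of n] by (auto intro!: supp simp: norm_axis_1)
        then show ?thesis using L by (simp add: s_def)
      qed (use * in auto)
    qed
  qed
  then show ?thesis using int_s by (simp add: LIMSEQ_const_iff)
qed

section \<open>The Jacobian determinant is a null Lagrangian\<close>

text \<open>Symmetry of the Hessian is built in. It is what makes the cofactors divergence free, and
  mollified functions inherit it from the kernel.\<close>

definition C2 :: "(real ^ 'n::finite \<Rightarrow> real) \<Rightarrow> bool"
  where "C2 f \<longleftrightarrow>
    (\<forall>x. f differentiable (at x)) \<and>
    (\<forall>i x. (\<lambda>x. gradient f x $ i) differentiable (at x)) \<and>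
    (\<forall>i. continuous_on UNIV (gradient (\<lambda>x. gradient f x $ i))) \<and>
    (\<forall>i j x. gradient (\<lambda>x. gradient f x $ i) x $ j = gradient (\<lambda>x. gradient f x $ j) x $ i)"

lemma C2D:
  assumes "C2 f"
  shows "f differentiable (at x)" "(\<lambda>x. gradient f x $ i) differentiable (at x)"
    "continuous_on UNIV (gradient (\<lambda>x. gradient f x $ i))"
    "gradient (\<lambda>x. gradient f x $ i) x $ j = gradient (\<lambda>x. gradient f x $ j) x $ i"
  using assms by (auto simp: C2_def)

lemma differentiable_imp_continuous_UNIV:
  assumes "\<And>x. f differentiable (at x)"
  shows "continuous_on UNIV f"
  using assms by (intro differentiable_imp_continuous_on) (simp add: differentiable_on_def)

lemma C2_continuous_gradient:
  assumes "C2 f"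
  shows "continuous_on UNIV (gradient f)"
proof -
  have "continuous_on UNIV (\<lambda>x. gradient f x $ i)" for i
    by (rule differentiable_imp_continuous_UNIV) (rule C2D(2)[OF assms])
  then have "continuous_on UNIV (\<lambda>x. \<chi> i. gradient f x $ i)"
    by (intro continuous_on_vec_lambda)
  then show ?thesis by simp
qed

lemma continuous_on_det:
  fixes A :: "'a::topological_space \<Rightarrow> real ^ 'n::finite ^ 'n"
  assumes "\<And>i j. continuous_on S (\<lambda>x. A x $ i $ j)"
  shows "continuous_on S (\<lambda>x. det (A x))"
  unfolding det_def by (intro continuous_intros assms)

text \<open>The product rule, applied in each summand of the Leibniz formula and collected by the
  row that is differentiated.\<close>

lemma has_derivative_det:
  fixes A :: "'n::finite \<Rightarrow> real ^ 'n \<Rightarrow> real ^ 'n"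
  assumes "\<And>b l. (\<lambda>x. A b x $ l) differentiable (at x)"
  shows "((\<lambda>x. det (\<chi> b. A b x)) has_derivative
    (\<lambda>v. \<Sum>b\<in>UNIV. det (\<chi> c. if c = b then (\<chi> l. gradient (\<lambda>x. A b x $ l) x \<bullet> v) else A c x))) (at x)"
proof -
  let ?P = "{p. p permutes (UNIV :: 'n set)}"
  define g where "g b l = gradient (\<lambda>x. A b x $ l) x" for b l
  have 1: "((\<lambda>x. A b x $ l) has_derivative (\<lambda>v. g b l \<bullet> v)) (at x)" for b l
    unfolding g_def by (rule has_derivative_gradient[OF assms])
  have 2: "((\<lambda>x. \<Sum>p\<in>?P. of_int (sign p) * (\<Prod>b\<in>UNIV. A b x $ p b)) has_derivative
      (\<lambda>v. \<Sum>p\<in>?P. of_int (sign p) *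
        (\<Sum>b\<in>UNIV. (g b (p b) \<bullet> v) * (\<Prod>c\<in>UNIV - {b}. A c x $ p c)))) (at x)"
    by (intro has_derivative_sum has_derivative_mult_right has_derivative_prod 1)
  have 3: "(\<Sum>p\<in>?P. of_int (sign p) *
        (\<Sum>b\<in>UNIV. (g b (p b) \<bullet> v) * (\<Prod>c\<in>UNIV - {b}. A c x $ p c))) =
     (\<Sum>b\<in>UNIV. det (\<chi> c. if c = b then (\<chi> l. g b l \<bullet> v) else A c x))" for v
  proof -
    have "(\<Prod>c\<in>UNIV. (if c = b then (\<chi> l. g b l \<bullet> v) else A c x) $ p c) =
        (g b (p b) \<bullet> v) * (\<Prod>c\<in>UNIV - {b}. A c x $ p c)" for p b
    proof -
      have "(\<Prod>c\<in>UNIV. (if c = b then (\<chi> l. g b l \<bullet> v) else A c x) $ p c) =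
        (if b = b then (\<chi> l. g b l \<bullet> v) else A b x) $ p b *
        (\<Prod>c\<in>UNIV - {b}. (if c = b then (\<chi> l. g b l \<bullet> v) else A c x) $ p c)"
        by (rule prod.remove) auto
      also have "(\<Prod>c\<in>UNIV - {b}. (if c = b then (\<chi> l. g b l \<bullet> v) else A c x) $ p c) =
        (\<Prod>c\<in>UNIV - {b}. A c x $ p c)"
        by (rule prod.cong) auto
      finally show ?thesis by simp
    qed
    then have "(\<Sum>b\<in>UNIV. det (\<chi> c. if c = b then (\<chi> l. g b l \<bullet> v) else A c x)) =
      (\<Sum>b\<in>UNIV. \<Sum>p\<in>?P. of_int (sign p) * ((g b (p b) \<bullet> v) * (\<Prod>c\<in>UNIV - {b}. A c x $ p c)))"
      by (simp add: det_def)
    then show ?thesis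
      by (subst (asm) sum.swap) (simp add: sum_distrib_left)
  qed
  have 4: "det (\<chi> b. A b x) = (\<Sum>p\<in>?P. of_int (sign p) * (\<Prod>b\<in>UNIV. A b x $ p b))" for x
    by (simp add: det_def)
  show ?thesis
    using 2 unfolding 3 4 unfolding g_def .
qed

lemma gradient_det_component:
  fixes A :: "'n::finite \<Rightarrow> real ^ 'n \<Rightarrow> real ^ 'n"
  assumes "\<And>b l. (\<lambda>x. A b x $ l) differentiable (at x)"
  shows "gradient (\<lambda>x. det (\<chi> b. A b x)) x $ k =
    (\<Sum>b\<in>UNIV. det (\<chi> c. if c = b then (\<chi> l. gradient (\<lambda>x. A b x $ l) x $ k) else A c x))"
proof -
  have "gradient (\<lambda>x. det (\<chi> b. A b x)) x $ k = frechet_derivative (\<lambda>x. det (\<chi> b. A b x)) (at x) (axis k 1)"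
    by (simp add: gradient_def)
  also have "\<dots> = (\<Sum>b\<in>UNIV. det (\<chi> c. if c = b then (\<chi> l. gradient (\<lambda>x. A b x $ l) x \<bullet> axis k 1) else A c x))"
    using frechet_derivative_at[OF has_derivative_det[of A x, OF assms]] by (rule fun_cong[OF sym])
  finally show ?thesis unfolding inner_axis inner_real_def mult_1_right .
qed

text \<open>The \<open>(a, i)\<close> entry of the cofactor matrix of the Jacobian matrix, whose
  rows are the gradients.\<close>

definition cofactor_comp ::
    "('n::finite \<Rightarrow> real ^ 'n \<Rightarrow> real) \<Rightarrow> 'n \<Rightarrow> 'n \<Rightarrow> real ^ 'n \<Rightarrow> real"
  where "cofactor_comp \<pi> a i x = det (\<chi> b. if b = a then axis i 1 else gradient (\<pi> b) x)"

lemma cofactor_row_diff: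
  assumes "\<And>b. C2 (\<pi> b)"
  shows "(\<lambda>x. (if b = a then axis i 1 else gradient (\<pi> b) x) $ l) differentiable (at x)"
  using C2D(2)[OF assms] by (cases "b = a") auto

lemma cofactor_comp_differentiable:
  assumes "\<And>b. C2 (\<pi> b)"
  shows "cofactor_comp \<pi> a i differentiable (at x)"
proof -
  define A where "A b x = (if b = a then axis i 1 else gradient (\<pi> b) x)" for b x
  have "(\<lambda>x. det (\<chi> b. A b x)) differentiable (at x)"
    by (rule differentiableI, rule has_derivative_det) (unfold A_def, rule cofactor_row_diff[OF assms])
  then show ?thesis by (simp add: cofactor_comp_def[abs_def] A_def)
qed

lemma gradient_cofactor_comp:
  assumes "\<And>b. C2 (\<pi> b)"
  shows "gradient (cofactor_comp \<pi> a i) x $ k =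
    (\<Sum>b\<in>UNIV - {a}. det (\<chi> c. if c = b then (\<chi> l. gradient (\<lambda>x. gradient (\<pi> b) x $ l) x $ k)
      else if c = a then axis i 1 else gradient (\<pi> c) x))"
proof -
  define A where "A b x = (if b = a then axis i 1 else gradient (\<pi> b) x)" for b x
  have "gradient (cofactor_comp \<pi> a i) x $ k =
    (\<Sum>b\<in>UNIV. det (\<chi> c. if c = b then (\<chi> l. gradient (\<lambda>x. A b x $ l) x $ k) else A c x))"
    unfolding cofactor_comp_def[abs_def] A_def
    by (rule gradient_det_component) (rule cofactor_row_diff[OF assms])
  also have "\<dots> = det (\<chi> c. if c = a then (\<chi> l. gradient (\<lambda>x. A a x $ l) x $ k) else A c x) +
    (\<Sum>b\<in>UNIV - {a}. det (\<chi> c. if c = b then (\<chi> l. gradient (\<lambda>x. A b x $ l) x $ k) else A c x))"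
    by (rule sum.remove) auto
  also have "(\<chi> l. gradient (\<lambda>x. A a x $ l) x $ k) = 0"
  proof -
    have "gradient (\<lambda>x. A a x $ l) x = 0" for l
      by (rule gradient_eqI) (simp add: A_def)
    then show ?thesis by (simp add: vec_eq_iff)
  qed
  also have "det (\<chi> c. if c = a then 0 else A c x) = 0" by (rule det_row_0)
  also have "(\<Sum>b\<in>UNIV - {a}. det (\<chi> c. if c = b then (\<chi> l. gradient (\<lambda>x. A b x $ l) x $ k) else A c x)) =
    (\<Sum>b\<in>UNIV - {a}. det (\<chi> c. if c = b then (\<chi> l. gradient (\<lambda>x. gradient (\<pi> b) x $ l) x $ k)
      else if c = a then axis i 1 else gradient (\<pi> c) x))"
  proof (rule sum.cong[OF refl])
    fix b assume "b \<in> UNIV - {a}"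
    then have Ab: "A b = gradient (\<pi> b)" by (simp add: A_def fun_eq_iff)
    show "det (\<chi> c. if c = b then (\<chi> l. gradient (\<lambda>x. A b x $ l) x $ k) else A c x) =
      det (\<chi> c. if c = b then (\<chi> l. gradient (\<lambda>x. gradient (\<pi> b) x $ l) x $ k)
        else if c = a then axis i 1 else gradient (\<pi> c) x)"
      unfolding Ab A_def[of _ x] ..
  qed
  finally show ?thesis by simp
qed

text \<open>The Piola identity. Differentiating row \<open>b\<close> turns the divergence into the
  sum over \<open>i\<close> and \<open>l\<close> of the Hessian entry \<open>H b l i\<close> times a
  determinant having the \<open>l\<close>-th and the \<open>i\<close>-th unit vector in rows
  \<open>b\<close> and \<open>a\<close>. The first factor is symmetric in \<open>i\<close> and
  \<open>l\<close>, the second antisymmetric, so each \<open>b\<close> contributes zero.\<close>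

lemma cofactor_comp_divergence_free:
  assumes "\<And>b. C2 (\<pi> b)"
  shows "(\<Sum>i\<in>UNIV. gradient (cofactor_comp \<pi> a i) x $ i) = 0"
proof -
  define H where "H b l i = gradient (\<lambda>x. gradient (\<pi> b) x $ l) x $ i" for b l i
  define D where "D b i l = det (\<chi> c. if c = b then axis l 1 else if c = a then axis i 1 else gradient (\<pi> c) x)" for b i l
  have sym: "H b l i = H b i l" for b l i unfolding H_def by (rule C2D(4)[OF assms])
  have anti: "D b l i = - D b i l" if "b \<noteq> a" for b i l
  proof -
    define M where "M = (\<chi> c. if c = b then axis l 1 else if c = a then axis i 1 else gradient (\<pi> c) x)"
    have "(\<chi> c. if c = b then axis i 1 else if c = a then axis l 1 else gradient (\<pi> c) x) =
      (\<chi> c. M $ Transposition.transpose a b c)"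
      using that by (auto simp: vec_eq_iff M_def Transposition.transpose_def)
    then have "D b l i = of_int (sign (Transposition.transpose a b)) * det M"
      using det_permute_rows[of "Transposition.transpose a b" M] by (simp add: D_def permutes_swap_id)
    then show ?thesis using that by (simp add: sign_swap_id D_def M_def)
  qed
  have expand: "det (\<chi> c. if c = b then (\<chi> l. H b l i) else if c = a then axis i 1 else gradient (\<pi> c) x)
      = (\<Sum>l\<in>UNIV. H b l i * D b i l)" for b i
  proof -
    have "(\<chi> l. H b l i) = (\<Sum>l\<in>UNIV. H b l i *s axis l 1)"
      using basis_expansion[of "\<chi> l. H b l i"] by simp
    then have "det (\<chi> c. if c = b then (\<chi> l. H b l i) else if c = a then axis i 1 else gradient (\<pi> c) x)
      = det (\<chi> c. if c = b then (\<Sum>l\<in>UNIV. H b l i *s axis l 1) else if c = a then axis i 1 else gradient (\<pi> c) x)"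
      by (rule arg_cong[where f = "\<lambda>v. det (\<chi> c. if c = b then v else if c = a then axis i 1 else gradient (\<pi> c) x)"])
    also have "\<dots> = (\<Sum>l\<in>UNIV. det (\<chi> c. if c = b then H b l i *s axis l 1 else if c = a then axis i 1 else gradient (\<pi> c) x))"
      by (rule det_linear_row_sum[where a = "\<lambda>_ l. H b l i *s axis l 1"]) simp
    also have "\<dots> = (\<Sum>l\<in>UNIV. H b l i * D b i l)"
      unfolding D_def by (rule sum.cong[OF refl], rule det_row_mul[where a = "\<lambda>_. axis _ 1"])
    finally show ?thesis .
  qed
  have zero: "(\<Sum>i\<in>UNIV. \<Sum>l\<in>UNIV. H b l i * D b i l) = 0" if "b \<noteq> a" for b
  proof -
    have "(\<Sum>i\<in>UNIV. \<Sum>l\<in>UNIV. H b l i * D b i l) = (\<Sum>l\<in>UNIV. \<Sum>i\<in>UNIV. H b l i * D b i l)"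
      by (rule sum.swap)
    also have "\<dots> = (\<Sum>l\<in>UNIV. \<Sum>i\<in>UNIV. - (H b i l * D b l i))"
      proof (intro sum.cong refl)
      fix l i
      show "H b l i * D b i l = - (H b i l * D b l i)"
        using sym[of b l i] anti[OF that, of l i] by simp
    qed
    also have "\<dots> = - (\<Sum>l\<in>UNIV. \<Sum>i\<in>UNIV. H b i l * D b l i)"
      by (simp add: sum_negf)
    finally show ?thesis by simp
  qed
  have "(\<Sum>i\<in>UNIV. gradient (cofactor_comp \<pi> a i) x $ i) =
     (\<Sum>i\<in>UNIV. \<Sum>b\<in>UNIV - {a}. \<Sum>l\<in>UNIV. H b l i * D b i l)"
    unfolding gradient_cofactor_comp[OF assms] H_def[symmetric] expand ..
  also have "\<dots> = (\<Sum>b\<in>UNIV - {a}. \<Sum>i\<in>UNIV. \<Sum>l\<in>UNIV. H b l i * D b i l)"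
    by (rule sum.swap)
  also have "\<dots> = 0" by (rule sum.neutral) (use zero in auto)
  finally show ?thesis .
qed

lemma continuous_gradient_cofactor_comp:
  assumes "\<And>b. C2 (\<pi> b)"
  shows "continuous_on UNIV (gradient (cofactor_comp \<pi> a i))"
proof -
  have c1: "continuous_on UNIV (\<lambda>x. gradient (\<pi> b) x $ l)" for b l
    by (rule continuous_on_component[OF C2_continuous_gradient[OF assms]])
  have c2: "continuous_on UNIV (\<lambda>x. gradient (\<lambda>x. gradient (\<pi> b) x $ l) x $ k)" for b l k
    by (rule continuous_on_component[OF C2D(3)[OF assms]])
  have "continuous_on UNIV (\<lambda>x. gradient (cofactor_comp \<pi> a i) x $ k)" for k
    unfolding gradient_cofactor_comp[OF assms]
    apply (intro continuous_on_sum continuous_on_det)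
    subgoal for b c l
      by (cases "c = b"; cases "c = a") (simp_all add: c1 c2)
    done
  then have "continuous_on UNIV (\<lambda>x. \<chi> k. gradient (cofactor_comp \<pi> a i) x $ k)"
    by (intro continuous_on_vec_lambda)
  then show ?thesis by simp
qed

lemma det_row_inner_cofactor_comp:
  "det (\<chi> b. if b = a then v else gradient (\<pi> b) x) = (\<Sum>i\<in>UNIV. v $ i * cofactor_comp \<pi> a i x)"
proof -
  have "det (\<chi> b. if b = a then v else gradient (\<pi> b) x) =
    det (\<chi> b. if b = a then (\<Sum>i\<in>UNIV. v $ i *s axis i 1) else gradient (\<pi> b) x)"
    by (rule arg_cong[where f = "\<lambda>v. det (\<chi> b. if b = a then v else gradient (\<pi> b) x)"])
       (simp add: basis_expansion)
  also have "\<dots> = (\<Sum>i\<in>UNIV. det (\<chi> b. if b = a then v $ i *s axis i 1 else gradient (\<pi> b) x))"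
    by (rule det_linear_row_sum[where a = "\<lambda>_ i. v $ i *s axis i 1"]) simp
  also have "\<dots> = (\<Sum>i\<in>UNIV. v $ i * cofactor_comp \<pi> a i x)"
    unfolding cofactor_comp_def by (rule sum.cong[OF refl], rule det_row_mul[where a = "\<lambda>_. axis _ 1"])
  finally show ?thesis .
qed

text \<open>Since the cofactors are divergence free, the integrand is the divergence of
  \<open>h\<close> times the \<open>a\<close>-th row of the cofactor matrix, which has compact
  support.\<close>

theorem integral_det_compact_row_eq_0:
  fixes h :: "real ^ 'n::finite \<Rightarrow> real"
  assumes diff: "\<And>x. h differentiable (at x)"
    and cont: "continuous_on UNIV (gradient h)"
    and supp: "\<And>x. norm x > R \<Longrightarrow> h x = 0"
    and \<pi>: "\<And>b. C2 (\<pi> b)"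
  shows "(LINT x|lborel. det (\<chi> b. if b = a then gradient h x else gradient (\<pi> b) x)) = 0"
proof -
  define F where "F i x = h x * cofactor_comp \<pi> a i x" for i x
  have hc: "continuous_on UNIV h" and vc: "continuous_on UNIV (cofactor_comp \<pi> a i)" for i
    by (rule differentiable_imp_continuous_UNIV, intro diff cofactor_comp_differentiable \<pi>)+
  have gF: "gradient (F i) x = h x *\<^sub>R gradient (cofactor_comp \<pi> a i) x + cofactor_comp \<pi> a i x *\<^sub>R gradient h x" for i x
    unfolding F_def[abs_def]
    by (rule gradient_mult) (intro diff cofactor_comp_differentiable \<pi>)+
  have Fd: "F i differentiable (at x)" for i x
    unfolding F_def[abs_def] by (intro differentiable_mult diff cofactor_comp_differentiable \<pi>)
  have "gradient (F i) = (\<lambda>x. h x *\<^sub>R gradient (cofactor_comp \<pi> a i) x + cofactor_comp \<pi> a i x *\<^sub>R gradient h x)" for i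
    using gF by auto
  then have Fc: "continuous_on UNIV (gradient (F i))" for i
    by (auto intro!: continuous_intros hc vc cont continuous_gradient_cofactor_comp \<pi>)
  have F0: "F i x = 0" if "norm x > R" for i x using supp[OF that] by (simp add: F_def)
  have int: "integrable lborel (\<lambda>x. gradient (F i) x $ i)" for i
    by (rule integrable_lborel_continuous_bounded_support[where R = R])
       (use gradient_zero_outside[of R "F i"] F0 in \<open>auto intro!: continuous_on_component Fc\<close>)
  have "det (\<chi> b. if b = a then gradient h x else gradient (\<pi> b) x) = (\<Sum>i\<in>UNIV. gradient (F i) x $ i)" for x
  proof -
    have "(\<Sum>i\<in>UNIV. gradient (F i) x $ i) =
      h x * (\<Sum>i\<in>UNIV. gradient (cofactor_comp \<pi> a i) x $ i) + (\<Sum>i\<in>UNIV. gradient h x $ i * cofactor_comp \<pi> a i x)"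
      unfolding gF by (simp add: sum.distrib sum_distrib_left mult.commute)
    then show ?thesis
      using cofactor_comp_divergence_free[of \<pi>, OF \<pi>] by (simp add: det_row_inner_cofactor_comp)
  qed
  then have "(LINT x|lborel. det (\<chi> b. if b = a then gradient h x else gradient (\<pi> b) x)) =
    (\<Sum>i\<in>UNIV. LINT x|lborel. gradient (F i) x $ i)"
    using int by (simp add: integral_sum)
  also have "\<dots> = 0"
    by (rule sum.neutral) (use integral_gradient_component_eq_0[OF Fd Fc F0] in auto)
  finally show ?thesis .
qed

section \<open>Jacobian determinants of uniformly close maps\<close>

definition Jac :: "('n::finite \<Rightarrow> real ^ 'n \<Rightarrow> real) \<Rightarrow> real ^ 'n \<Rightarrow> real"
  where "Jac \<pi> x = det (\<chi> b. gradient (\<pi> b) x)"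

lemma continuous_Jac:
  assumes "\<And>b. C2 (\<pi> b)"
  shows "continuous_on UNIV (Jac \<pi>)"
  unfolding Jac_def[abs_def]
  by (intro continuous_on_det) (simp add: continuous_on_component C2_continuous_gradient assms)

lemma abs_Jac_le:
  fixes \<pi> :: "'n::finite \<Rightarrow> real ^ 'n \<Rightarrow> real"
  assumes "\<And>b. C2 (\<pi> b)" "\<And>b. L-lipschitz_on UNIV (\<pi> b)"
  shows "\<bar>Jac \<pi> x\<bar> \<le> fact CARD('n) * L ^ CARD('n)"
proof -
  have "\<bar>Jac \<pi> x\<bar> \<le> fact CARD('n) * (\<Prod>b\<in>(UNIV::'n set). L)"
    unfolding Jac_def
    by (rule abs_det_le) (simp add: gradient_component_le[OF assms(2) C2D(1)[OF assms(1)]])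
  then show ?thesis by simp
qed

lemma C2_diff:
  assumes "C2 f" "C2 g"
  shows "C2 (\<lambda>x. f x - g x)"
proof -
  note d = C2D(1)[OF assms(1)] C2D(1)[OF assms(2)]
  note d2 = C2D(2)[OF assms(1)] C2D(2)[OF assms(2)]
  have g1: "gradient (\<lambda>x. f x - g x) x = gradient f x - gradient g x" for x
    using gradient_lincomb[OF d, where a = 1 and b = "-1"] by simp
  have g2: "gradient (\<lambda>x. gradient f x $ i - gradient g x $ i) x =
      gradient (\<lambda>x. gradient f x $ i) x - gradient (\<lambda>x. gradient g x $ i) x" for x i
    using gradient_lincomb[OF d2, where a = 1 and b = "-1"] by simp
  have g2': "gradient (\<lambda>x. gradient f x $ i - gradient g x $ i) =
      (\<lambda>x. gradient (\<lambda>x. gradient f x $ i) x - gradient (\<lambda>x. gradient g x $ i) x)" for i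
    using g2 by auto
  show ?thesis
    unfolding C2_def g1 vector_minus_component
    unfolding g2 g2' vector_minus_component
    using assms by (auto intro!: differentiable_diff continuous_on_diff simp: C2D)
qed

text \<open>Integration by parts: \<open>integral_det_compact_row_eq_0\<close> for the product
  \<open>h * \<delta>\<close> in row \<open>a\<close> moves the derivative from
  \<open>\<delta>\<close> to \<open>h\<close>, so that only the size of \<open>\<delta>\<close>
  enters.\<close>

lemma component_estimate:
  fixes h :: "real ^ 'n::finite \<Rightarrow> real"
  assumes diff: "\<And>x. h differentiable (at x)"
    and cont: "continuous_on UNIV (gradient h)"
    and supp: "\<And>x. norm x > R \<Longrightarrow> h x = 0"
    and \<pi>: "\<And>b. C2 (\<pi> b)" and \<delta>: "C2 \<delta>"
    and K: "K-lipschitz_on UNIV h" "\<And>b. K-lipschitz_on UNIV (\<pi> b)"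
    and \<epsilon>: "\<And>x. norm x \<le> R \<Longrightarrow> \<bar>\<delta> x\<bar> \<le> \<epsilon>" "\<epsilon> \<ge> 0"
  shows "\<bar>LINT x|lborel. h x * det (\<chi> b. if b = a then gradient \<delta> x else gradient (\<pi> b) x)\<bar>
    \<le> \<epsilon> * (fact CARD('n) * K ^ CARD('n) * measure lborel (cball (0 :: real ^ 'n) R))"
proof -
  define D where "D v x = det (\<chi> b. if b = a then v else gradient (\<pi> b) x)" for v x
  let ?C = "fact CARD('n) * K ^ CARD('n)"
  have K0: "K \<ge> 0" using K(1) by (rule lipschitz_on_nonneg)
  have hc: "continuous_on UNIV h" and dc: "continuous_on UNIV \<delta>"
    by (rule differentiable_imp_continuous_UNIV, intro diff C2D[OF \<delta>])+
  have grad: "gradient (\<lambda>x. h x * \<delta> x) x = h x *\<^sub>R gradient \<delta> x + \<delta> x *\<^sub>R gradient h x" for x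
    by (rule gradient_mult) (intro diff C2D[OF \<delta>])+
  have grad': "gradient (\<lambda>x. h x * \<delta> x) = (\<lambda>x. h x *\<^sub>R gradient \<delta> x + \<delta> x *\<^sub>R gradient h x)"
    using grad by auto
  have D_lin: "D (s *\<^sub>R v + t *\<^sub>R w) x = s * D v x + t * D w x" for s t v w x
    unfolding D_def det_row_add[of a "\<lambda>_. s *\<^sub>R v" "\<lambda>_. t *\<^sub>R w" "\<lambda>b. gradient (\<pi> b) x"]
    using det_row_mul[of a s "\<lambda>_. v" "\<lambda>b. gradient (\<pi> b) x"] det_row_mul[of a t "\<lambda>_. w" "\<lambda>b. gradient (\<pi> b) x"]
    unfolding scalar_mult_eq_scaleR by simp
  have D_cont: "continuous_on UNIV (\<lambda>x. D (v x) x)" if "continuous_on UNIV v" for v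
  proof -
    have "continuous_on UNIV (\<lambda>x. (\<chi> b. if b = a then v x else gradient (\<pi> b) x) $ i $ j)" for i j
      using continuous_on_component[OF that] continuous_on_component[OF C2_continuous_gradient[OF \<pi>]]
      by (cases "i = a") simp_all
    then show ?thesis unfolding D_def by (rule continuous_on_det)
  qed
  have i1: "integrable lborel (\<lambda>x. h x * D (gradient \<delta> x) x)"
    by (rule integrable_lborel_continuous_bounded_support[where R = R])
       (use supp in \<open>auto intro!: continuous_intros hc D_cont C2_continuous_gradient[OF \<delta>]\<close>)
  have D0: "D (gradient h x) x = 0" if "norm x > R" for x
    using gradient_zero_outside[OF supp that] det_row_0[of a "\<lambda>b. gradient (\<pi> b) x"] by (simp add: D_def cong: if_cong)
  have i2: "integrable lborel (\<lambda>x. \<delta> x * D (gradient h x) x)"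
    by (rule integrable_lborel_continuous_bounded_support[where R = R])
       (use D0 in \<open>auto intro!: continuous_intros dc D_cont cont\<close>)
  have "0 = (LINT x|lborel. D (gradient (\<lambda>x. h x * \<delta> x) x) x)"
    unfolding D_def
    by (rule integral_det_compact_row_eq_0[where R = R, symmetric])
       (use supp in \<open>auto simp: grad' intro!: \<pi> diff C2D[OF \<delta>] differentiable_mult continuous_intros hc dc cont C2_continuous_gradient[OF \<delta>]\<close>)
  also have "\<dots> = (LINT x|lborel. h x * D (gradient \<delta> x) x + \<delta> x * D (gradient h x) x)"
    by (simp add: grad D_lin)
  also have "\<dots> = (LINT x|lborel. h x * D (gradient \<delta> x) x) + (LINT x|lborel. \<delta> x * D (gradient h x) x)"
    using i1 i2 by (rule Bochner_Integration.integral_add)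
  finally have eq: "(LINT x|lborel. h x * D (gradient \<delta> x) x) = - (LINT x|lborel. \<delta> x * D (gradient h x) x)"
    by simp
  have Db: "\<bar>D (gradient h x) x\<bar> \<le> ?C" for x
  proof -
    have "\<bar>D (gradient h x) x\<bar> \<le> fact CARD('n) * (\<Prod>b\<in>(UNIV::'n set). K)"
      unfolding D_def
      by (rule abs_det_le)
         (simp add: gradient_component_le[OF K(1) diff] gradient_component_le[OF K(2) C2D(1)[OF \<pi>]])
    then show ?thesis by simp
  qed
  have "\<bar>LINT x|lborel. \<delta> x * D (gradient h x) x\<bar> \<le> (LINT x|lborel. (\<epsilon> * ?C) * indicator (cball 0 R) (x :: real ^ 'n))"
  proof (rule integral_abs_bound_integral)
    show "integrable lborel (\<lambda>x. \<delta> x * D (gradient h x) x)" by (rule i2)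
    show "integrable lborel (\<lambda>x :: real ^ 'n. (\<epsilon> * ?C) * indicator (cball 0 R) x :: real)"
      by (intro integrable_mult_right integrable_real_indicator emeasure_bounded_finite[of "cball 0 R"]) auto
    show "\<bar>\<delta> x * D (gradient h x) x\<bar> \<le> (\<epsilon> * ?C) * indicator (cball 0 R) x" for x
    proof (cases "norm x \<le> R")
      case True
      then show ?thesis using mult_mono[OF \<epsilon>(1)[OF True] Db[of x] \<epsilon>(2)] by (simp add: abs_mult)
    qed (use D0[of x] in auto)
  qed
  also have "\<dots> = \<epsilon> * (?C * measure lborel (cball (0 :: real ^ 'n) R))"
    by simp
  finally show ?thesis using eq by (simp add: D_def)
qed

text \<open>The components of \<open>\<zeta>\<close> are replaced by those of \<open>\<eta>\<close>
  one at a time; each replacement changes a single row of the Jacobian matrix and is covered by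
  \<open>component_estimate\<close>.\<close>

lemma Jac_diff_estimate:
  fixes h :: "real ^ 'n::finite \<Rightarrow> real"
  assumes diff: "\<And>x. h differentiable (at x)"
    and cont: "continuous_on UNIV (gradient h)"
    and supp: "\<And>x. norm x > R \<Longrightarrow> h x = 0"
    and C2: "\<And>b. C2 (\<eta> b)" "\<And>b. C2 (\<zeta> b)"
    and K: "K-lipschitz_on UNIV h" "\<And>b. K-lipschitz_on UNIV (\<eta> b)" "\<And>b. K-lipschitz_on UNIV (\<zeta> b)"
    and \<epsilon>: "\<And>b x. norm x \<le> R \<Longrightarrow> \<bar>\<eta> b x - \<zeta> b x\<bar> \<le> \<epsilon>" "\<epsilon> \<ge> 0"
  shows "\<bar>LINT x|lborel. h x * (Jac \<eta> x - Jac \<zeta> x)\<bar>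
    \<le> \<epsilon> * (CARD('n) * (fact CARD('n) * K ^ CARD('n) * measure lborel (cball (0 :: real ^ 'n) R)))"
proof -
  let ?C = "fact CARD('n) * K ^ CARD('n) * measure lborel (cball (0 :: real ^ 'n) R)"
  define mix where "mix A b = (if b \<in> A then \<eta> b else \<zeta> b)" for A b
  have mixC2: "C2 (mix A b)" and mixL: "K-lipschitz_on UNIV (mix A b)" for A b
    using C2 K by (auto simp: mix_def)
  have hc: "continuous_on UNIV h" by (rule differentiable_imp_continuous_UNIV[OF diff])
  have int: "integrable lborel (\<lambda>x. h x * (Jac (mix A) x - Jac (mix B) x))" for A B
    by (rule integrable_lborel_continuous_bounded_support[where R = R])
       (use supp in \<open>auto intro!: continuous_intros hc continuous_Jac mixC2\<close>)
  have "\<bar>LINT x|lborel. h x * (Jac (mix A) x - Jac (mix {}) x)\<bar> \<le> \<epsilon> * (card A * ?C)" for A :: "'n set"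
  proof (induction A rule: finite_induct[OF finite])
    case (2 a A)
    have step: "Jac (mix (insert a A)) x - Jac (mix A) x =
      det (\<chi> b. if b = a then gradient (\<lambda>x. \<eta> a x - \<zeta> a x) x else gradient (mix A b) x)" for x
    proof -
      have g: "gradient (\<lambda>x. \<eta> a x - \<zeta> a x) x = gradient (\<eta> a) x - gradient (\<zeta> a) x"
        using gradient_lincomb[OF C2D(1)[OF C2(1)] C2D(1)[OF C2(2)], where a = 1 and b = "-1"] by simp
      have 1: "(\<chi> b. gradient (mix (insert a A) b) x) = (\<chi> b. if b = a then gradient (\<eta> a) x else gradient (mix A b) x)"
        by (auto simp: vec_eq_iff mix_def)
      have 2: "(\<chi> b. gradient (mix A b) x) = (\<chi> b. if b = a then gradient (\<zeta> a) x else gradient (mix A b) x)"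
        using 2(2) by (auto simp: vec_eq_iff mix_def)
      have "det (\<chi> b. if b = a then gradient (\<eta> a) x else gradient (mix A b) x) =
        det (\<chi> b. if b = a then (gradient (\<eta> a) x - gradient (\<zeta> a) x) + gradient (\<zeta> a) x else gradient (mix A b) x)"
        unfolding diff_add_cancel ..
      also have "\<dots> = det (\<chi> b. if b = a then gradient (\<eta> a) x - gradient (\<zeta> a) x else gradient (mix A b) x)
        + det (\<chi> b. if b = a then gradient (\<zeta> a) x else gradient (mix A b) x)"
        by (rule det_row_add[of a "\<lambda>_. gradient (\<eta> a) x - gradient (\<zeta> a) x" "\<lambda>_. gradient (\<zeta> a) x"])
      finally show ?thesis unfolding Jac_def g 1 unfolding 2 by linarith
    qed
    have "(LINT x|lborel. h x * (Jac (mix (insert a A)) x - Jac (mix {}) x)) =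
      (LINT x|lborel. h x * (Jac (mix (insert a A)) x - Jac (mix A) x) + h x * (Jac (mix A) x - Jac (mix {}) x))"
      by (simp add: algebra_simps)
    also have "\<dots> = (LINT x|lborel. h x * (Jac (mix (insert a A)) x - Jac (mix A) x)) +
      (LINT x|lborel. h x * (Jac (mix A) x - Jac (mix {}) x))"
      by (rule Bochner_Integration.integral_add) (rule int)+
    finally have "\<bar>LINT x|lborel. h x * (Jac (mix (insert a A)) x - Jac (mix {}) x)\<bar> \<le>
      \<bar>LINT x|lborel. h x * (Jac (mix (insert a A)) x - Jac (mix A) x)\<bar> + \<epsilon> * (card A * ?C)"
      using 2(3) by linarith
    also have "\<bar>LINT x|lborel. h x * (Jac (mix (insert a A)) x - Jac (mix A) x)\<bar> \<le> \<epsilon> * ?C"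
      unfolding step
      by (rule component_estimate) (intro diff cont supp mixC2 C2_diff C2 K mixL \<epsilon>; assumption)+
    finally show ?case using 2 by (simp add: algebra_simps)
  qed simp
  from this[of UNIV] show ?thesis by (simp add: mix_def[abs_def])
qed

section \<open>Smooth test functions\<close>

text \<open>The functions that arise from the flat function \<open>exp (- 1 / t)\<close> by
  differentiation: their span is closed under derivatives, and all of them vanish to infinite order
  at \<open>0\<close>.\<close>

definition flat_exp :: "nat \<Rightarrow> real \<Rightarrow> real"
  where "flat_exp m t = (if t > 0 then exp (- 1 / t) / t ^ m else 0)"

lemma flat_exp_tendsto_0: "(flat_exp m \<longlongrightarrow> 0) (at 0)"
proof -
  have "((\<lambda>t. inverse t ^ m / exp (inverse t)) \<longlongrightarrow> 0) (at_right (0::real))"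
    by (rule filterlim_compose[OF tendsto_power_div_exp_0 filterlim_inverse_at_top_right])
  then have "(flat_exp m \<longlongrightarrow> 0) (at_right 0)"
    by (rule Lim_transform_eventually)
       (auto simp: eventually_at_filter flat_exp_def exp_minus field_simps intro!: always_eventually)
  moreover have "(flat_exp m \<longlongrightarrow> 0) (at_left 0)"
    by (rule Lim_transform_eventually[OF tendsto_const])
       (auto simp: eventually_at_filter flat_exp_def intro!: always_eventually)
  ultimately show ?thesis by (simp add: filterlim_at_split)
qed

lemma flat_exp_has_derivative:
  "(flat_exp m has_real_derivative flat_exp (m + 2) t - real m * flat_exp (m + 1) t) (at t)"
proof -
  consider "t > 0" | "t < 0" | "t = 0" by linarith
  then show ?thesis
  proof cases
    case 1
    have "((\<lambda>t. exp (- 1 / t) / t ^ m) has_real_derivative flat_exp (m + 2) t - real m * flat_exp (m + 1) t) (at t)"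
    proof (cases m)
      case 0
      show ?thesis using 1 unfolding 0
        by (auto intro!: derivative_eq_intros simp: flat_exp_def field_simps power2_eq_square)
    next
      case (Suc k)
      have "((\<lambda>t. exp (- 1 / t)) has_real_derivative exp (- 1 / t) / t\<^sup>2) (at t)"
        using 1 by (auto intro!: derivative_eq_intros simp: power2_eq_square)
      from DERIV_divide[OF this DERIV_pow[of m]] have
        "((\<lambda>t. exp (- 1 / t) / t ^ m) has_real_derivative
          (exp (- 1 / t) / t\<^sup>2 * t ^ m - exp (- 1 / t) * (real m * t ^ (m - Suc 0))) / (t ^ m * t ^ m)) (at t)"
        using 1 by simp
      also have "(exp (- 1 / t) / t\<^sup>2 * t ^ m - exp (- 1 / t) * (real m * t ^ (m - Suc 0))) / (t ^ m * t ^ m) =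
          flat_exp (m + 2) t - real m * flat_exp (m + 1) t"
        using 1 by (simp add: Suc flat_exp_def field_simps power2_eq_square)
      finally show ?thesis .
    qed
    then show ?thesis
      by (rule has_field_derivative_transform_within_open[of _ _ _ "{0<..}"])
         (use 1 in \<open>auto simp: flat_exp_def\<close>)
  next
    case 2
    have "((\<lambda>t. 0) has_real_derivative flat_exp (m + 2) t - real m * flat_exp (m + 1) t) (at t)"
      using 2 by (simp add: flat_exp_def)
    then show ?thesis
      by (rule has_field_derivative_transform_within_open[of _ _ _ "{..<0}"])
         (use 2 in \<open>auto simp: flat_exp_def\<close>)
  next
    case 3
    have "((\<lambda>h. (flat_exp m (0 + h) - flat_exp m 0) / h) \<longlongrightarrow> 0) (at 0)"
      by (rule Lim_transform_eventually[OF flat_exp_tendsto_0[of "m + 1"]])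
         (auto simp: eventually_at_filter flat_exp_def field_simps intro!: always_eventually)
    then have "(flat_exp m has_real_derivative 0) (at 0)" by (simp add: DERIV_def)
    then show ?thesis using 3 by (simp add: flat_exp_def)
  qed
qed

lemma flat_exp_nonneg: "flat_exp m t \<ge> 0" and flat_exp_pos: "t > 0 \<Longrightarrow> flat_exp m t > 0"
  by (auto simp: flat_exp_def)

lemma flat_exp_0_le_1: "flat_exp 0 t \<le> 1"
  by (simp add: flat_exp_def)

lemma flat_exp_0_mono: "s \<le> t \<Longrightarrow> flat_exp 0 s \<le> flat_exp 0 t"
  by (auto simp: flat_exp_def frac_le)

text \<open>An algebra that contains the polynomials and radial bumps and is closed under
  directional derivatives. The last property is what yields \<open>C_k\<close> for every
  \<open>k\<close> by a plain induction.\<close>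

inductive smooth_alg :: "('a::real_inner \<Rightarrow> real) \<Rightarrow> bool" where
  const: "smooth_alg (\<lambda>x. c)"
| linear: "bounded_linear f \<Longrightarrow> smooth_alg f"
| add: "smooth_alg f \<Longrightarrow> smooth_alg g \<Longrightarrow> smooth_alg (\<lambda>x. f x + g x)"
| mult: "smooth_alg f \<Longrightarrow> smooth_alg g \<Longrightarrow> smooth_alg (\<lambda>x. f x * g x)"
| bump: "smooth_alg (\<lambda>x. flat_exp m (c - x \<bullet> x))"

lemma flat_exp_bump_has_derivative:
  fixes x :: "'a::real_inner"
  shows "((\<lambda>x. flat_exp m (c - x \<bullet> x)) has_derivative
    (\<lambda>v. (flat_exp (m + 2) (c - x \<bullet> x) + (- real m) * flat_exp (m + 1) (c - x \<bullet> x)) * (- 2 * (x \<bullet> v)))) (at x)"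
proof -
  have "((\<lambda>x. c - x \<bullet> x) has_derivative (\<lambda>v. - 2 * (x \<bullet> v))) (at x)"
    by (auto intro!: derivative_eq_intros simp: inner_commute)
  from has_derivative_compose[OF this flat_exp_has_derivative[unfolded has_field_derivative_def]]
  show ?thesis by simp
qed

lemma smooth_alg_derivative:
  assumes "smooth_alg f"
  shows "\<exists>f'. (\<forall>x. (f has_derivative f' x) (at x)) \<and> (\<forall>v. smooth_alg (\<lambda>x. f' x v))"
  using assms
proof induction
  case (const c)
  show ?case by (intro exI[of _ "\<lambda>_ _. 0"]) (auto intro: smooth_alg.const)
next
  case (linear f)
  then show ?case
    by (intro exI[of _ "\<lambda>_. f"]) (auto intro: smooth_alg.const bounded_linear_imp_has_derivative)
next
  case (add f g)
  then obtain f' g' where "\<forall>x. (f has_derivative f' x) (at x)" "\<forall>v. smooth_alg (\<lambda>x. f' x v)"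
    "\<forall>x. (g has_derivative g' x) (at x)" "\<forall>v. smooth_alg (\<lambda>x. g' x v)" by blast
  then show ?case
    by (intro exI[of _ "\<lambda>x v. f' x v + g' x v"]) (auto intro: smooth_alg.add has_derivative_add)
next
  case (mult f g)
  then obtain f' g' where "\<forall>x. (f has_derivative f' x) (at x)" "\<forall>v. smooth_alg (\<lambda>x. f' x v)"
    "\<forall>x. (g has_derivative g' x) (at x)" "\<forall>v. smooth_alg (\<lambda>x. g' x v)" by blast
  with mult show ?case
    by (intro exI[of _ "\<lambda>x v. f x * g' x v + f' x v * g x"])
       (auto intro!: smooth_alg.add smooth_alg.mult has_derivative_mult)
next
  case (bump m c)
  have lin: "smooth_alg (\<lambda>x. x \<bullet> v)" for v :: 'a
    by (rule smooth_alg.linear) (rule bounded_linear_inner_left)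
  have "smooth_alg (\<lambda>x. (flat_exp (m + 2) (c - x \<bullet> x) + (- real m) * flat_exp (m + 1) (c - x \<bullet> x)) * (- 2 * (x \<bullet> v)))" for v :: 'a
    by (intro smooth_alg.mult smooth_alg.add smooth_alg.const smooth_alg.bump lin)
  with flat_exp_bump_has_derivative show ?case
    by (intro exI conjI allI)
qed

lemma smooth_alg_differentiable:
  assumes "smooth_alg f"
  shows "f differentiable (at x)" "smooth_alg (\<lambda>x. frechet_derivative f (at x) v)"
proof -
  obtain f' where f': "\<And>x. (f has_derivative f' x) (at x)" "\<And>v. smooth_alg (\<lambda>x. f' x v)"
    using smooth_alg_derivative[OF assms] by blast
  show "f differentiable (at x)" using f'(1) by (rule differentiableI)
  have "frechet_derivative f (at x) = f' x" for x using frechet_derivative_at[OF f'(1)] by simp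
  then show "smooth_alg (\<lambda>x. frechet_derivative f (at x) v)" using f'(2) by simp
qed

lemma smooth_alg_continuous: "smooth_alg f \<Longrightarrow> continuous_on UNIV f"
  by (intro differentiable_imp_continuous_on) (simp add: differentiable_on_def smooth_alg_differentiable)

lemma smooth_alg_C_k: "smooth_alg f \<Longrightarrow> C_k k f"
  by (induction k arbitrary: f) (auto intro: smooth_alg_differentiable smooth_alg_continuous)

lemma real_polynomial_function_smooth_alg:
  "real_polynomial_function f \<Longrightarrow> smooth_alg f"
  by (induction rule: real_polynomial_function.induct) (auto intro: smooth_alg.intros)

lemma smooth_alg_continuous_gradient:
  fixes f :: "real ^ 'n::finite \<Rightarrow> real"
  assumes "smooth_alg f"
  shows "continuous_on UNIV (gradient f)"
  unfolding gradient_def[abs_def]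
  by (intro continuous_on_vec_lambda smooth_alg_continuous smooth_alg_differentiable(2) assms)

lemma compact_spt:
  fixes f :: "'a::euclidean_space \<Rightarrow> real"
  assumes "\<And>x. norm x > R \<Longrightarrow> f x = 0"
  shows "compact (spt f)"
proof -
  have "{x. f x \<noteq> 0} \<subseteq> cball 0 R" using assms by (force simp: not_le)
  then have "bounded {x. f x \<noteq> 0}" using bounded_cball bounded_subset by blast
  then show ?thesis unfolding spt_def by simp
qed

text \<open>A measurable function is almost everywhere a limit of continuous ones, which may be
  clamped to the bounds of \<open>g\<close> and cut off away from its support. Divided by a smooth
  bump \<open>cut\<close>, they are approximated uniformly by polynomials, and multiplying by
  \<open>cut\<close> again gives smooth functions of bounded support.\<close>

lemma test_function_approx:
  fixes g :: "real ^ 'n::finite \<Rightarrow> real"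
  assumes meas: "g \<in> borel_measurable lebesgue" and M: "\<And>x. \<bar>g x\<bar> \<le> M"
    and supp: "\<And>x. norm x > R \<Longrightarrow> g x = 0" and e: "e > 0" and R: "R > 0"
  obtains h where "\<And>n. smooth_alg (h n)" "\<And>n x. norm x > R + 1 \<Longrightarrow> h n x = 0"
    "\<And>n x. \<bar>h n x\<bar> \<le> M + e" "AE x in lebesgue. (\<lambda>n. h n x) \<longlonglongrightarrow> g x"
proof -
  have M0: "M \<ge> 0" using M[of 0] by linarith
  have "g measurable_on UNIV"
    using meas lebesgue_measurable_imp_measurable_on_real[of g UNIV] by simp
  then obtain N G where N: "negligible N" and G: "\<And>n. continuous_on UNIV (G n)"
    "\<And>x. x \<notin> N \<Longrightarrow> (\<lambda>n. G n x) \<longlonglongrightarrow> g x"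
    unfolding measurable_on_def by auto
  define cut where "cut x = flat_exp 0 ((R + 1)\<^sup>2 - x \<bullet> x)" for x :: "real ^ 'n"
  define c0 where "c0 = flat_exp 0 ((R + 1)\<^sup>2 - (R + 1/2)\<^sup>2)"
  define \<kappa> where "\<kappa> x = max 0 (min 1 (1 + 2 * (R - norm x)))" for x :: "real ^ 'n"
  define k where "k n x = \<kappa> x * max (- M) (min M (G n x))" for n x
  \<comment> \<open>On the support of \<open>k n\<close> the bump \<open>cut\<close> is at least
    \<open>c0 > 0\<close>, so the maximum only ensures that the quotient is continuous
    everywhere.\<close>
  define q where "q n x = k n x / max (cut x) c0" for n x
  have c0: "c0 > 0" unfolding c0_def
    by (rule flat_exp_pos) (use R in \<open>simp add: power2_eq_square algebra_simps\<close>)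
  have cut_smooth: "smooth_alg cut" unfolding cut_def[abs_def] by (rule smooth_alg.bump)
  have kc: "continuous_on UNIV (k n)" for n
    unfolding k_def[abs_def] \<kappa>_def by (intro continuous_intros G)
  have qc: "continuous_on UNIV (q n)" for n
    unfolding q_def[abs_def]
    by (intro continuous_intros kc smooth_alg_continuous cut_smooth) (use c0 in auto)
  have kb: "\<bar>k n x\<bar> \<le> M" for n x
  proof -
    have "\<bar>\<kappa> x\<bar> \<le> 1" "\<bar>max (- M) (min M (G n x))\<bar> \<le> M" using M0 by (auto simp: \<kappa>_def)
    then have "\<bar>\<kappa> x\<bar> * \<bar>max (- M) (min M (G n x))\<bar> \<le> 1 * M" by (intro mult_mono) auto
    then show ?thesis by (simp add: k_def abs_mult)
  qed
  have cut_q: "cut x * q n x = k n x" for n x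
  proof (cases "\<kappa> x = 0")
    case False
    then have "norm x \<le> R + 1/2" by (auto simp: \<kappa>_def max_def split: if_splits)
    then have "x \<bullet> x \<le> (R + 1/2)\<^sup>2" using power_mono[of "norm x" "R + 1/2" 2] by (simp add: dot_square_norm)
    then have "cut x \<ge> c0" unfolding cut_def c0_def by (intro flat_exp_0_mono) simp
    then show ?thesis using c0 by (simp add: q_def max_def)
  qed (simp add: q_def k_def)
  define d where "d n = e / real (Suc n)" for n
  have d: "d n > 0" "d n \<le> e" for n using e by (auto simp: d_def field_simps)
  have "\<exists>p. real_polynomial_function p \<and> (\<forall>x\<in>cball 0 (R + 1). \<bar>q n x - p x\<bar> < d n)" for n
    using Stone_Weierstrass_real_polynomial_function[of "cball 0 (R + 1)" "q n" "d n"]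
      continuous_on_subset[OF qc] d by (metis compact_cball subset_UNIV)
  then obtain p where p: "\<And>n. real_polynomial_function (p n)"
    "\<And>n x. x \<in> cball 0 (R + 1) \<Longrightarrow> \<bar>q n x - p n x\<bar> < d n" by metis
  define h where "h n x = cut x * p n x" for n x
  have cut_range: "0 \<le> cut x" "cut x \<le> 1" for x by (auto simp: cut_def flat_exp_nonneg flat_exp_0_le_1)
  have cut_zero: "cut x = 0" if "norm x > R + 1" for x
  proof -
    have "x \<bullet> x > (R + 1)\<^sup>2" using power_strict_mono[OF that, of 2] R by (simp add: dot_square_norm)
    then show ?thesis by (simp add: cut_def flat_exp_def)
  qed
  have hk: "\<bar>h n x - k n x\<bar> \<le> d n" for n x
  proof (cases "norm x \<le> R + 1")
    case True
    have "\<bar>h n x - k n x\<bar> = cut x * \<bar>q n x - p n x\<bar>"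
      unfolding h_def cut_q[symmetric] using cut_range(1)[of x]
      by (metis abs_minus_commute abs_mult abs_of_nonneg right_diff_distrib)
    also have "\<dots> \<le> 1 * d n"
      using p(2)[of x n] True cut_range[of x] by (intro mult_mono) auto
    finally show ?thesis by simp
  next
    case False
    then show ?thesis using cut_zero[of x] cut_q[of x n] d[of n] by (simp add: h_def)
  qed
  show ?thesis
  proof
    show "smooth_alg (h n)" for n unfolding h_def[abs_def]
      by (intro smooth_alg.mult cut_smooth real_polynomial_function_smooth_alg p)
    show "h n x = 0" if "norm x > R + 1" for n x using cut_zero[OF that] by (simp add: h_def)
    show "\<bar>h n x\<bar> \<le> M + e" for n x using hk[of n x] kb[of n x] d[of n] by linarith
    have "(\<lambda>n. h n x) \<longlonglongrightarrow> g x" if x: "x \<notin> N" for x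
    proof -
      have "(\<lambda>n. k n x) \<longlonglongrightarrow> \<kappa> x * max (- M) (min M (g x))"
        unfolding k_def by (intro tendsto_intros G x)
      also have "\<kappa> x * max (- M) (min M (g x)) = g x"
        using M[of x] supp[of x] by (cases "norm x \<le> R") (auto simp: \<kappa>_def)
      finally have kl: "(\<lambda>n. k n x) \<longlonglongrightarrow> g x" .
      have "d \<longlonglongrightarrow> 0" using tendsto_mult_right_zero[OF LIMSEQ_Suc[OF lim_1_over_n], of e] by (simp add: d_def[abs_def])
      then have "(\<lambda>n. h n x - k n x) \<longlonglongrightarrow> 0"
        by (rule Lim_null_comparison[rotated]) (use hk in auto)
      from tendsto_add[OF this kl] show ?thesis by simp
    qed
    moreover have "AE x in lebesgue. x \<notin> N"
      using N by (simp add: negligible_iff_null_sets AE_not_in)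
    ultimately show "AE x in lebesgue. (\<lambda>n. h n x) \<longlonglongrightarrow> g x" by (auto elim: eventually_mono)
  qed
qed

section \<open>Weak continuity of Jacobian determinants\<close>

lemma continuous_on_UNIV_measurable_lebesgue:
  fixes f :: "'a::euclidean_space \<Rightarrow> real"
  assumes "continuous_on UNIV f"
  shows "f \<in> borel_measurable lebesgue" "f \<in> borel_measurable lborel"
proof -
  show *: "f \<in> borel_measurable lborel"
    using borel_measurable_continuous_onI[OF assms] by simp
  then show "f \<in> borel_measurable lebesgue" by (rule measurable_completion)
qed

lemma integrable_mult_bounded_continuous:
  fixes g J :: "'a::euclidean_space \<Rightarrow> real"
  assumes "integrable lebesgue g" "continuous_on UNIV J" "\<And>x. \<bar>J x\<bar> \<le> C"
  shows "integrable lebesgue (\<lambda>x. g x * J x)"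
proof (rule Bochner_Integration.integrable_bound[of _ "\<lambda>x. C * g x"])
  show "integrable lebesgue (\<lambda>x. C * g x)" using assms(1) by simp
  show "(\<lambda>x. g x * J x) \<in> borel_measurable lebesgue"
    using assms(1) continuous_on_UNIV_measurable_lebesgue(1)[OF assms(2)] by measurable
  have "\<bar>g x * J x\<bar> \<le> \<bar>C * g x\<bar>" for x
  proof -
    have "\<bar>J x\<bar> \<le> \<bar>C\<bar>" using assms(3)[of x] by linarith
    then show ?thesis by (simp add: abs_mult mult.commute[of "\<bar>g x\<bar>"] mult_right_mono)
  qed
  then show "AE x in lebesgue. norm (g x * J x) \<le> norm (C * g x)" by simp
qed

lemma abs_integral_mult_le:
  fixes g J :: "'a::euclidean_space \<Rightarrow> real"
  assumes "integrable lebesgue g" "continuous_on UNIV J" "\<And>x. \<bar>J x\<bar> \<le> C"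
  shows "\<bar>LINT x|lebesgue. g x * J x\<bar> \<le> C * (LINT x|lebesgue. \<bar>g x\<bar>)"
proof -
  have "\<bar>LINT x|lebesgue. g x * J x\<bar> \<le> (LINT x|lebesgue. C * \<bar>g x\<bar>)"
  proof (rule integral_abs_bound_integral)
    show "\<bar>g x * J x\<bar> \<le> C * \<bar>g x\<bar>" for x
      using mult_right_mono[OF assms(3)[of x], of "\<bar>g x\<bar>"] by (simp add: abs_mult mult.commute)
  qed (use integrable_mult_bounded_continuous[OF assms] assms(1) in auto)
  then show ?thesis by simp
qed

lemma smooth_alg_integrable_lebesgue:
  fixes h :: "real ^ 'n::finite \<Rightarrow> real"
  assumes "smooth_alg h" "\<And>x. norm x > R \<Longrightarrow> h x = 0"
  shows "integrable lebesgue h"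
proof -
  have c: "continuous_on UNIV h" by (rule smooth_alg_continuous[OF assms(1)])
  have "integrable lborel h"
    by (rule integrable_lborel_continuous_bounded_support[OF c assms(2)])
  then show ?thesis
    using integrable_completion[OF continuous_on_UNIV_measurable_lebesgue(2)[OF c]] by simp
qed

text \<open>Truncation reduces to bounded \<open>g\<close>, for which the approximants of
  \<open>test_function_approx\<close> are bounded and supported in a common ball, so dominated
  convergence applies.\<close>

lemma L1_test_function_approx:
  fixes g :: "real ^ 'n::finite \<Rightarrow> real"
  assumes g: "integrable lebesgue g" and supp: "\<And>x. norm x > R \<Longrightarrow> g x = 0"
    and R: "R > 0" and e: "e > 0"
  obtains h where "smooth_alg h" "\<And>x. norm x > R + 1 \<Longrightarrow> h x = 0"
    "(LINT x|lebesgue. \<bar>g x - h x\<bar>) < e"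
proof -
  have gm [measurable]: "g \<in> borel_measurable lebesgue" using g by simp
  define t where "t n x = (if \<bar>g x\<bar> \<le> real n then g x else 0)" for n x
  have tm [measurable]: "t n \<in> borel_measurable lebesgue" for n
    unfolding t_def[abs_def] by measurable
  have ti: "integrable lebesgue (t n)" for n
    by (rule Bochner_Integration.integrable_bound[OF g]) (auto simp: t_def)
  have "(\<lambda>n. LINT x|lebesgue. \<bar>g x - t n x\<bar>) \<longlonglongrightarrow> (LINT x|lebesgue. (\<lambda>x. 0) (x :: real ^ 'n))"
  proof (rule integral_dominated_convergence[where w = "\<lambda>x. \<bar>g x\<bar>"])
    show "AE x in lebesgue. (\<lambda>n. \<bar>g x - t n x\<bar>) \<longlonglongrightarrow> 0"
    proof (intro always_eventually allI)
      fix x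
      obtain N where N: "\<bar>g x\<bar> \<le> real N" using real_arch_simple by blast
      have "\<forall>\<^sub>F n in sequentially. 0 = \<bar>g x - t n x\<bar>"
        by (rule eventually_sequentiallyI[of N]) (use N in \<open>auto simp: t_def\<close>)
      then show "(\<lambda>n. \<bar>g x - t n x\<bar>) \<longlonglongrightarrow> 0"
        by (rule Lim_transform_eventually[OF tendsto_const])
    qed
  qed (use g in \<open>auto simp: t_def\<close>)
  then have "\<forall>\<^sub>F n in sequentially. (LINT x|lebesgue. \<bar>g x - t n x\<bar>) < e / 2"
    by (rule order_tendstoD) (use e in simp)
  then obtain N where N: "(LINT x|lebesgue. \<bar>g x - t N x\<bar>) < e / 2"
    by (auto simp: eventually_sequentially)
  obtain h where h: "\<And>n. smooth_alg (h n)" "\<And>n x. norm x > R + 1 \<Longrightarrow> h n x = 0"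
    "\<And>n x. \<bar>h n x\<bar> \<le> real N + 1" "AE x in lebesgue. (\<lambda>n. h n x) \<longlonglongrightarrow> t N x"
    by (rule test_function_approx[of "t N" "real N" R 1]) (use supp R in \<open>auto simp: t_def\<close>)
  have hi: "integrable lebesgue (h n)" for n
    by (rule smooth_alg_integrable_lebesgue[OF h(1,2)])
  have [measurable]: "h n \<in> borel_measurable lebesgue" for n using hi by simp
  have "(\<lambda>n. LINT x|lebesgue. \<bar>t N x - h n x\<bar>) \<longlonglongrightarrow> (LINT x|lebesgue. (\<lambda>x. 0) (x :: real ^ 'n))"
  proof (rule integral_dominated_convergence[where w = "\<lambda>x. (2 * real N + 1) * indicator (cball 0 (R + 1)) x"])
    have "integrable lborel (\<lambda>x :: real ^ 'n. (2 * real N + 1) * indicator (cball 0 (R + 1)) x :: real)"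
      by (intro integrable_mult_right integrable_real_indicator emeasure_bounded_finite[of "cball 0 (R + 1)"]) auto
    then show "integrable lebesgue (\<lambda>x :: real ^ 'n. (2 * real N + 1) * indicator (cball 0 (R + 1)) x :: real)"
      by (subst integrable_completion) (auto dest: borel_measurable_integrable)
    show "AE x in lebesgue. (\<lambda>n. \<bar>t N x - h n x\<bar>) \<longlonglongrightarrow> 0"
      using h(4)
    proof eventually_elim
      case (elim x)
      have "(\<lambda>n. \<bar>t N x - h n x\<bar>) \<longlonglongrightarrow> \<bar>t N x - t N x\<bar>"
        by (intro tendsto_intros elim)
      then show ?case by simp
    qed
    show "AE x in lebesgue. norm \<bar>t N x - h n x\<bar> \<le> (2 * real N + 1) * indicator (cball 0 (R + 1)) x" for n
    proof (intro always_eventually allI)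
      fix x :: "real ^ 'n"
      have "\<bar>t N x\<bar> \<le> N" by (simp add: t_def)
      then have *: "\<bar>t N x - h n x\<bar> \<le> 2 * real N + 1" using h(3)[of n x] by linarith
      show "norm \<bar>t N x - h n x\<bar> \<le> (2 * real N + 1) * indicator (cball 0 (R + 1)) x"
      proof (cases "norm x \<le> R + 1")
        case False
        then show ?thesis using h(2)[of x n] supp[of x] by (simp add: t_def)
      qed (use * in auto)
    qed
  qed auto
  then have "\<forall>\<^sub>F n in sequentially. (LINT x|lebesgue. \<bar>t N x - h n x\<bar>) < e / 2"
    by (rule order_tendstoD) (use e in simp)
  then obtain n where n: "(LINT x|lebesgue. \<bar>t N x - h n x\<bar>) < e / 2"
    by (auto simp: eventually_sequentially)
  have "(LINT x|lebesgue. \<bar>g x - h n x\<bar>) \<le> (LINT x|lebesgue. \<bar>g x - t N x\<bar> + \<bar>t N x - h n x\<bar>)"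
    by (rule integral_mono) (use g ti hi in auto)
  also have "\<dots> = (LINT x|lebesgue. \<bar>g x - t N x\<bar>) + (LINT x|lebesgue. \<bar>t N x - h n x\<bar>)"
    by (rule Bochner_Integration.integral_add) (use g ti hi in auto)
  also have "\<dots> < e" using N n by simp
  finally show ?thesis using that h(1,2) by blast
qed

text \<open>For a smooth weight \<open>h\<close> of bounded support the difference is at most a
  constant times the distance of the maps. Replacing \<open>g\<close> by such an \<open>h\<close>
  close to it in \<open>L\<^sup>1\<close> costs little, uniformly in the maps, because the
  determinants are bounded in terms of \<open>L\<close>.\<close>

theorem Jac_weak_continuity:
  fixes g :: "real ^ 'n::finite \<Rightarrow> real"
  assumes g: "integrable lebesgue g" and supp: "\<And>x. norm x > R \<Longrightarrow> g x = 0"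
    and R: "R > 0" and e: "e > 0"
  obtains d where "d > 0"
    "\<And>\<eta> \<zeta>. \<lbrakk>\<And>b. C2 (\<eta> b); \<And>b. C2 (\<zeta> b);
        \<And>b. L-lipschitz_on UNIV (\<eta> b); \<And>b. L-lipschitz_on UNIV (\<zeta> b);
        \<And>b x. norm x \<le> R + 1 \<Longrightarrow> \<bar>\<eta> b x - \<zeta> b x\<bar> \<le> d\<rbrakk>
      \<Longrightarrow> \<bar>LINT x|lebesgue. g x * (Jac \<eta> x - Jac \<zeta> x)\<bar> \<le> e"
proof -
  define C where "C = 2 * (fact CARD('n) * \<bar>L\<bar> ^ CARD('n))"
  have C: "C \<ge> 0" by (simp add: C_def)
  obtain h where h: "smooth_alg h" "\<And>x. norm x > R + 1 \<Longrightarrow> h x = 0"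
    "(LINT x|lebesgue. \<bar>g x - h x\<bar>) < e / (2 * (C + 1))"
    using L1_test_function_approx[OF g supp R, of "e / (2 * (C + 1))"] e C by auto
  have hd: "\<And>x. h differentiable (at x)" and hc: "continuous_on UNIV (gradient h)"
    by (intro smooth_alg_differentiable smooth_alg_continuous_gradient h)+
  obtain K0 where K0: "K0-lipschitz_on UNIV h"
    using C1_zero_outside_lipschitz[OF hd hc h(2)] by blast
  define K where "K = max K0 \<bar>L\<bar>"
  define D where "D = real CARD('n) * (fact CARD('n) * K ^ CARD('n) * measure lborel (cball (0 :: real ^ 'n) (R + 1)))"
  have "K \<ge> 0" by (auto simp: K_def)
  then have D: "D \<ge> 0" by (simp add: D_def)
  define d where "d = e / (2 * (D + 1))"
  have d: "d > 0" using e D by (simp add: d_def)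
  show ?thesis
  proof (rule that[OF d])
    fix \<eta> \<zeta> :: "'n \<Rightarrow> real ^ 'n \<Rightarrow> real"
    assume C2: "\<And>b. C2 (\<eta> b)" "\<And>b. C2 (\<zeta> b)"
      and L: "\<And>b. L-lipschitz_on UNIV (\<eta> b)" "\<And>b. L-lipschitz_on UNIV (\<zeta> b)"
      and close: "\<And>b x. norm x \<le> R + 1 \<Longrightarrow> \<bar>\<eta> b x - \<zeta> b x\<bar> \<le> d"
    have L0: "L \<ge> 0" using L(1) lipschitz_on_nonneg by blast
    define J where "J x = Jac \<eta> x - Jac \<zeta> x" for x
    have Jc: "continuous_on UNIV J" unfolding J_def[abs_def] by (intro continuous_intros continuous_Jac C2)
    have Jb: "\<bar>J x\<bar> \<le> C" for x
      using abs_Jac_le[of \<eta>, OF C2(1) L(1), of x] abs_Jac_le[of \<zeta>, OF C2(2) L(2), of x] L0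
      by (simp add: J_def C_def)
    have hi: "integrable lebesgue h" by (rule smooth_alg_integrable_lebesgue[OF h(1,2)])
    have KL: "K-lipschitz_on UNIV h" "K-lipschitz_on UNIV (\<eta> b)" "K-lipschitz_on UNIV (\<zeta> b)" for b
      using lipschitz_on_le[OF K0, of K] lipschitz_on_le[OF L(1), of K] lipschitz_on_le[OF L(2), of K]
      by (auto simp: K_def)
    have "\<bar>LINT x|lborel. h x * J x\<bar> \<le> d * D"
      unfolding J_def D_def
      by (rule Jac_diff_estimate[OF hd hc h(2) C2 KL close]) (use d in auto)
    also have "d * D \<le> e / 2" using D e by (simp add: d_def field_simps)
    finally have 1: "\<bar>LINT x|lebesgue. h x * J x\<bar> \<le> e / 2"
      using integral_completion[OF continuous_on_UNIV_measurable_lebesgue(2), of "\<lambda>x. h x * J x"]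
        continuous_on_mult[OF smooth_alg_continuous[OF h(1)] Jc] by simp
    have "\<bar>LINT x|lebesgue. (g x - h x) * J x\<bar> \<le> C * (LINT x|lebesgue. \<bar>g x - h x\<bar>)"
      by (rule abs_integral_mult_le) (use g hi Jc Jb in auto)
    also have "\<dots> \<le> C * (e / (2 * (C + 1)))" using h(3) C by (intro mult_left_mono) auto
    also have "\<dots> \<le> e / 2" using C e by (simp add: field_simps)
    finally have 2: "\<bar>LINT x|lebesgue. (g x - h x) * J x\<bar> \<le> e / 2" .
    have "(LINT x|lebesgue. g x * J x) = (LINT x|lebesgue. h x * J x + (g x - h x) * J x)"
      by (simp add: algebra_simps)
    also have "\<dots> = (LINT x|lebesgue. h x * J x) + (LINT x|lebesgue. (g x - h x) * J x)"
      by (rule Bochner_Integration.integral_add)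
         (use g hi Jc Jb in \<open>auto intro!: integrable_mult_bounded_continuous\<close>)
    finally show "\<bar>LINT x|lebesgue. g x * (Jac \<eta> x - Jac \<zeta> x)\<bar> \<le> e"
      using 1 2 by (simp add: J_def)
  qed
qed

section \<open>Mollification\<close>

lemma integral_lborel_reflect:
  fixes f :: "'a::euclidean_space \<Rightarrow> real"
  assumes "f \<in> borel_measurable borel"
  shows "(LINT x|lborel. f (c - x)) = (LINT x|lborel. f x)"
proof -
  have "(lborel :: 'a measure) = distr lborel borel (\<lambda>x. c + (- 1) *\<^sub>R x)"
    using lborel_affine[of "-1" c] by (simp add: density_1 one_ennreal_def[symmetric])
  then have "(LINT x|lborel. f x) = (LINT x|distr lborel borel (\<lambda>x. c + (- 1) *\<^sub>R x). f x)"
    by simp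
  also have "\<dots> = (LINT x|lborel. f (c + (- 1) *\<^sub>R x))"
    by (rule integral_distr) (use assms in auto)
  finally show ?thesis by simp
qed

text \<open>The first argument only fixes the space over which is integrated; it cannot be inferred
  from the radius.\<close>

definition kernel_mass :: "'a::euclidean_space itself \<Rightarrow> real \<Rightarrow> real"
  where "kernel_mass _ r = (LINT y|lborel. flat_exp 0 (r\<^sup>2 - (y :: 'a) \<bullet> y))"

definition bump_kernel :: "real \<Rightarrow> 'a::euclidean_space \<Rightarrow> real"
  where "bump_kernel r y = inverse (kernel_mass TYPE('a) r) * flat_exp 0 (r\<^sup>2 - y \<bullet> y)"

lemma smooth_alg_kernel: "smooth_alg (bump_kernel r)"
  unfolding bump_kernel_def[abs_def] by (intro smooth_alg.mult smooth_alg.const smooth_alg.bump)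

lemma flat_exp_bump_zero:
  assumes "norm y > r" "r \<ge> 0"
  shows "flat_exp m (r\<^sup>2 - y \<bullet> y) = 0"
  using power_strict_mono[OF assms, of 2] by (simp add: flat_exp_def dot_square_norm)

lemma kernel_zero: "norm y > r \<Longrightarrow> r \<ge> 0 \<Longrightarrow> bump_kernel r y = 0"
  by (simp add: bump_kernel_def flat_exp_bump_zero)

lemma flat_exp_bump_integrable:
  assumes "r \<ge> 0"
  shows "integrable lborel (\<lambda>y :: 'a::euclidean_space. flat_exp 0 (r\<^sup>2 - y \<bullet> y))"
  by (rule integrable_lborel_continuous_bounded_support[of _ r])
     (auto intro: smooth_alg_continuous smooth_alg.bump flat_exp_bump_zero assms)

lemma kernel_mass_pos:
  assumes "r > 0"
  shows "kernel_mass TYPE('a::euclidean_space) r > 0"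
proof -
  let ?B = "ball (0 :: 'a) (r / 2)"
  define c where "c = flat_exp 0 (r\<^sup>2 - (r / 2)\<^sup>2)"
  have c: "c > 0" unfolding c_def
    by (rule flat_exp_pos) (use assms in \<open>simp add: power2_eq_square\<close>)
  have "0 < c * measure lborel ?B"
    using c content_ball_pos[of "r / 2" "0 :: 'a"] assms by simp
  also have "\<dots> = (LINT y|lborel. c * indicator ?B y)" by simp
  also have "\<dots> \<le> kernel_mass TYPE('a) r"
    unfolding kernel_mass_def
  proof (rule integral_mono)
    show "integrable lborel (\<lambda>y. c * indicator ?B y :: real)"
      by (intro integrable_mult_right integrable_real_indicator emeasure_bounded_finite) auto
    show "integrable lborel (\<lambda>y :: 'a. flat_exp 0 (r\<^sup>2 - y \<bullet> y))"
      using assms by (intro flat_exp_bump_integrable) simp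
    show "c * indicator ?B y \<le> flat_exp 0 (r\<^sup>2 - y \<bullet> y)" for y
    proof (cases "y \<in> ?B")
      case True
      then have "y \<bullet> y \<le> (r / 2)\<^sup>2"
        using power_mono[of "norm y" "r / 2" 2] by (simp add: dot_square_norm)
      then have "c \<le> flat_exp 0 (r\<^sup>2 - y \<bullet> y)" unfolding c_def by (intro flat_exp_0_mono) simp
      with True show ?thesis by simp
    qed (simp add: flat_exp_nonneg)
  qed
  finally show ?thesis .
qed

lemma kernel_nonneg: "r > 0 \<Longrightarrow> bump_kernel r (y :: 'a::euclidean_space) \<ge> 0"
  using kernel_mass_pos[where 'a = 'a, of r] by (simp add: bump_kernel_def flat_exp_nonneg)

lemma kernel_integral: "r > 0 \<Longrightarrow> (LINT y|lborel. bump_kernel r (y :: 'a::euclidean_space)) = 1"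
  using kernel_mass_pos[where 'a = 'a, of r] by (simp add: bump_kernel_def kernel_mass_def)

lemma kernel_continuous: "continuous_on UNIV (bump_kernel r)"
  by (rule smooth_alg_continuous[OF smooth_alg_kernel])

definition mollify :: "real \<Rightarrow> ('a::euclidean_space \<Rightarrow> real) \<Rightarrow> 'a \<Rightarrow> real"
  where "mollify r \<sigma> x = (LINT y|lborel. \<sigma> (x - y) * bump_kernel r y)"

lemma mollify_integrable:
  assumes "continuous_on UNIV \<sigma>" "r > 0"
  shows "integrable lborel (\<lambda>y. \<sigma> (x - y) * bump_kernel r y)"
proof (rule integrable_lborel_continuous_bounded_support[of _ r])
  show "continuous_on UNIV (\<lambda>y. \<sigma> (x - y) * bump_kernel r y)"
    by (intro continuous_intros kernel_continuous continuous_on_compose2[OF assms(1)]) auto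
qed (use assms in \<open>auto simp: kernel_zero\<close>)

text \<open>Lipschitz bounds, closeness to the original function and locality of mollification are
  all instances of this comparison of two shifted functions against a kernel of mass one.\<close>

lemma mollify_diff_le:
  fixes x x' :: "'a::euclidean_space"
  assumes "continuous_on UNIV \<sigma>" "continuous_on UNIV \<tau>" "r > 0"
    and "\<And>y. norm y \<le> r \<Longrightarrow> \<bar>\<sigma> (x - y) - \<tau> (x' - y)\<bar> \<le> c"
  shows "\<bar>mollify r \<sigma> x - mollify r \<tau> x'\<bar> \<le> c"
proof -
  have "\<bar>LINT y|lborel. \<sigma> (x - y) * bump_kernel r y - \<tau> (x' - y) * bump_kernel r y\<bar> \<le> (LINT y|lborel. c * bump_kernel r (y :: 'a))"
  proof (rule integral_abs_bound_integral)
    show "integrable lborel (\<lambda>y. \<sigma> (x - y) * bump_kernel r y - \<tau> (x' - y) * bump_kernel r y)"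
      by (intro Bochner_Integration.integrable_diff mollify_integrable assms)
    show "integrable lborel (\<lambda>y. c * bump_kernel r (y :: 'a))"
      by (intro integrable_mult_right integrable_lborel_continuous_bounded_support[of _ r] kernel_continuous kernel_zero)
         (use assms in auto)
    show "\<bar>\<sigma> (x - y) * bump_kernel r y - \<tau> (x' - y) * bump_kernel r y\<bar> \<le> c * bump_kernel r y" for y
    proof (cases "norm y \<le> r")
      case True
      have "\<bar>\<sigma> (x - y) * bump_kernel r y - \<tau> (x' - y) * bump_kernel r y\<bar> = \<bar>\<sigma> (x - y) - \<tau> (x' - y)\<bar> * bump_kernel r y"
        using kernel_nonneg[OF assms(3), of y] by (simp add: abs_mult flip: left_diff_distrib)
      then show ?thesis
        using assms(4)[OF True] kernel_nonneg[OF assms(3), of y] by (simp add: mult_right_mono)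
    qed (use kernel_zero[of r y] assms in auto)
  qed
  also have "(LINT y|lborel. c * bump_kernel r (y :: 'a)) = c" by (simp add: kernel_integral[OF assms(3)])
  finally show ?thesis
    unfolding mollify_def using mollify_integrable[OF assms(1,3)] mollify_integrable[OF assms(2,3)] by simp
qed

lemma mollify_const: "r > 0 \<Longrightarrow> mollify r (\<lambda>_. c) x = c"
  by (simp add: mollify_def kernel_integral)

lemma mollify_locally_const:
  assumes "continuous_on UNIV \<sigma>" "r > 0" "\<And>y. norm y \<le> r \<Longrightarrow> \<sigma> (x - y) = c"
  shows "mollify r \<sigma> x = c"
proof -
  have "\<bar>mollify r \<sigma> x - mollify r (\<lambda>_. c) x\<bar> \<le> 0"
    by (rule mollify_diff_le[OF assms(1) continuous_on_const assms(2)]) (simp add: assms(3))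
  then show ?thesis by (simp add: mollify_const assms(2))
qed

lemma mollify_lipschitz:
  fixes \<sigma> :: "'a::euclidean_space \<Rightarrow> real"
  assumes "L-lipschitz_on UNIV \<sigma>" "r > 0"
  shows "L-lipschitz_on UNIV (mollify r \<sigma>)"
proof (rule lipschitz_onI)
  fix x y :: 'a
  note c = lipschitz_on_continuous_on[OF assms(1)]
  have "\<bar>mollify r \<sigma> x - mollify r \<sigma> y\<bar> \<le> L * dist x y"
  proof (rule mollify_diff_le[OF c c assms(2)])
    show "\<bar>\<sigma> (x - z) - \<sigma> (y - z)\<bar> \<le> L * dist x y" for z
      using lipschitz_onD[OF assms(1), of "x - z" "y - z"] by (simp add: dist_norm)
  qed
  then show "dist (mollify r \<sigma> x) (mollify r \<sigma> y) \<le> L * dist x y" by (simp add: dist_real_def)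
qed (rule lipschitz_on_nonneg[OF assms(1)])

lemma mollify_close:
  assumes L: "L-lipschitz_on UNIV \<sigma>" and r: "r > 0"
  shows "\<bar>mollify r \<sigma> x - \<sigma> x\<bar> \<le> L * r"
proof -
  have "\<bar>mollify r \<sigma> x - mollify r (\<lambda>_. \<sigma> x) x\<bar> \<le> L * r"
  proof (rule mollify_diff_le[OF lipschitz_on_continuous_on[OF L] continuous_on_const r])
    fix y :: 'a assume "norm y \<le> r"
    then have "L * norm y \<le> L * r" using lipschitz_on_nonneg[OF L] by (rule mult_left_mono)
    then show "\<bar>\<sigma> (x - y) - \<sigma> x\<bar> \<le> L * r"
      using lipschitz_onD[OF L, of "x - y" x] by (simp add: dist_norm)
  qed
  then show ?thesis using r by (simp add: mollify_const)
qed

lemma mollify_lincomb: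
  assumes "continuous_on UNIV \<sigma>" "continuous_on UNIV \<tau>" "r > 0"
  shows "mollify r (\<lambda>x. a * \<sigma> x + b * \<tau> x) x = a * mollify r \<sigma> x + b * mollify r \<tau> x"
proof -
  have "mollify r (\<lambda>x. a * \<sigma> x + b * \<tau> x) x =
    (LINT y|lborel. a * (\<sigma> (x - y) * bump_kernel r y) + b * (\<tau> (x - y) * bump_kernel r y))"
    unfolding mollify_def by (simp add: algebra_simps)
  also have "\<dots> = a * mollify r \<sigma> x + b * mollify r \<tau> x"
    using mollify_integrable[OF assms(1,3)] mollify_integrable[OF assms(2,3)]
    by (simp add: mollify_def)
  finally show ?thesis .
qed

text \<open>The kernel is even, so its first moments vanish.\<close>

lemma mollify_component:
  fixes x :: "real ^ 'n::finite"
  assumes r: "r > 0"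
  shows "mollify r (\<lambda>x. x $ j) x = x $ j"
proof -
  have c: "continuous_on UNIV (\<lambda>x :: real ^ 'n. x $ j)" by (intro continuous_intros)
  define I where "I = (LINT y|lborel. (y :: real ^ 'n) $ j * bump_kernel r y)"
  have int: "integrable lborel (\<lambda>y :: real ^ 'n. y $ j * bump_kernel r y)"
    by (rule integrable_lborel_continuous_bounded_support[of _ r])
       (auto intro!: continuous_intros kernel_continuous simp: kernel_zero less_imp_le[OF r])
  have intk: "integrable lborel (\<lambda>y :: real ^ 'n. bump_kernel r y)"
    by (rule integrable_lborel_continuous_bounded_support[of _ r])
       (auto intro!: kernel_continuous simp: kernel_zero less_imp_le[OF r])
  have sym: "bump_kernel r (- y) = bump_kernel r y" for y :: "real ^ 'n" by (simp add: bump_kernel_def)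
  have "(LINT y|lborel. (0 - y) $ j * bump_kernel r (0 - y)) = I"
    unfolding I_def
    by (rule integral_lborel_reflect[of "\<lambda>y. y $ j * bump_kernel r y" 0])
       (intro borel_measurable_continuous_onI continuous_intros kernel_continuous)
  then have "I = 0" using int by (simp add: sym I_def)
  have "mollify r (\<lambda>x. x $ j) x = (LINT y|lborel. x $ j * bump_kernel r y - y $ j * bump_kernel r y)"
    by (simp add: mollify_def left_diff_distrib)
  also have "\<dots> = x $ j * 1 - I"
    using int intk kernel_integral[OF r, where 'a = "real ^ 'n"] by (simp add: I_def)
  finally show ?thesis using \<open>I = 0\<close> by simp
qed

text \<open>The same integral as \<open>mollify\<close>, for a general kernel and with the
  derivatives falling on the kernel.\<close>

definition convolve :: "('a::euclidean_space \<Rightarrow> real) \<Rightarrow> ('a \<Rightarrow> real) \<Rightarrow> 'a \<Rightarrow> real"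
  where "convolve \<sigma> k x = (LINT y|lborel. \<sigma> y * k (x - y))"

lemma mollify_eq_convolve:
  assumes "continuous_on UNIV \<sigma>"
  shows "mollify r \<sigma> x = convolve \<sigma> (bump_kernel r) x"
proof -
  have "continuous_on UNIV (\<lambda>y. \<sigma> y * bump_kernel r (x - y))"
    by (intro continuous_intros assms continuous_on_compose2[OF kernel_continuous]) auto
  then have "(LINT y|lborel. \<sigma> (x - y) * bump_kernel r (x - (x - y))) = (LINT y|lborel. \<sigma> y * bump_kernel r (x - y))"
    by (intro integral_lborel_reflect[of "\<lambda>y. \<sigma> y * bump_kernel r (x - y)"] borel_measurable_continuous_onI)
  then show ?thesis by (simp add: mollify_def convolve_def)
qed

lemma integral_cbox_eq_lborel:
  fixes f :: "'a::euclidean_space \<Rightarrow> real"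
  assumes "continuous_on UNIV f" "\<And>x. norm x > R \<Longrightarrow> f x = 0" "cball 0 R \<subseteq> cbox a b"
  shows "integral (cbox a b) f = (LINT x|lborel. f x)"
proof -
  have "(f has_integral (LINT x|lborel. f x)) UNIV"
    by (rule has_integral_integral_lborel, rule integrable_lborel_continuous_bounded_support[OF assms(1,2)])
  moreover have "(\<lambda>x. if x \<in> cbox a b then f x else 0) = f"
    using assms(2,3) by (force simp: fun_eq_iff not_le)
  ultimately have "(f has_integral (LINT x|lborel. f x)) (cbox a b)"
    using has_integral_restrict_UNIV[of "cbox a b" f] by simp
  then show ?thesis by (rule integral_unique)
qed

text \<open>Differentiation under the integral sign. Near \<open>x\<close> all the integrands live
  in one box, so the rule for integrals over a fixed box applies.\<close>

lemma convolve_has_derivative: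
  fixes \<sigma> k :: "real ^ 'n::finite \<Rightarrow> real"
  assumes \<sigma>: "continuous_on UNIV \<sigma>" and k: "smooth_alg k" and supp: "\<And>z. norm z > r \<Longrightarrow> k z = 0"
  shows "(convolve \<sigma> k has_derivative (\<lambda>v. (\<chi> j. convolve \<sigma> (\<lambda>z. gradient k z $ j) x) \<bullet> v)) (at x)"
proof -
  let ?U = "ball x 1"
  obtain a where a: "cball 0 (norm x + 1 + r) \<subseteq> cbox (- a) (a :: real ^ 'n)"
    using bounded_subset_cbox_symmetric[OF bounded_cball] by blast
  have kc: "continuous_on UNIV k" and gc: "continuous_on UNIV (gradient k)"
    by (intro smooth_alg_continuous smooth_alg_continuous_gradient k)+
  have far: "norm (x' - y) > r" if "x' \<in> ?U" "norm y > norm x + 1 + r" for x' y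
  proof -
    have "norm x' < norm x + 1" using that(1) norm_triangle_sub[of x' x] by (simp add: dist_norm norm_minus_commute)
    then show ?thesis using that(2) norm_triangle_sub[of y x'] by (simp add: norm_minus_commute)
  qed
  define fx where "fx x' t = \<sigma> t *\<^sub>R blinfun_inner_right (gradient k (x' - t))" for x' t
  have D: "((\<lambda>x'. integral (cbox (- a) a) (\<lambda>y. \<sigma> y * k (x' - y))) has_derivative
      blinfun_apply (integral (cbox (- a) a) (fx x))) (at x within ?U)"
  proof (rule leibniz_rule)
    fix x' t
    have "((\<lambda>x'. k (x' - t)) has_derivative (\<lambda>v. gradient k (x' - t) \<bullet> v)) (at x' within ?U)"
    proof -
      have "((\<lambda>x'. x' - t) has_derivative (\<lambda>v. v)) (at x' within ?U)"
        by (auto intro!: derivative_eq_intros)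
      from has_derivative_compose[OF this has_derivative_gradient[OF smooth_alg_differentiable(1)[OF k]]]
      show ?thesis .
    qed
    then show "((\<lambda>x. \<sigma> t * k (x - t)) has_derivative blinfun_apply (fx x' t)) (at x' within ?U)"
      by (auto intro!: derivative_eq_intros simp: fx_def blinfun.scaleR_left)
  next
    fix x'
    show "(\<lambda>y. \<sigma> y * k (x' - y)) integrable_on cbox (- a) a"
      by (intro integrable_continuous continuous_intros continuous_on_subset[OF \<sigma>] continuous_on_compose2[OF kc]) auto
  next
    show "continuous_on (?U \<times> cbox (- a) a) (\<lambda>(x, t). fx x t)"
      unfolding fx_def split_beta
      by (intro continuous_intros continuous_on_compose2[OF \<sigma>] continuous_on_compose2[OF gc]
          bounded_linear.continuous_on[OF bounded_linear_blinfun_inner_right]) auto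
  qed auto
  have eq1: "integral (cbox (- a) a) (\<lambda>y. \<sigma> y * k (x' - y)) = convolve \<sigma> k x'" if "x' \<in> ?U" for x'
    unfolding convolve_def
    by (rule integral_cbox_eq_lborel[of _ "norm x + 1 + r"])
       (use far[OF that] supp a in \<open>auto intro!: continuous_intros \<sigma> continuous_on_compose2[OF kc]\<close>)
  have eq2: "blinfun_apply (integral (cbox (- a) a) (fx x)) v = (\<chi> j. convolve \<sigma> (\<lambda>z. gradient k z $ j) x) \<bullet> v" for v
  proof -
    have "fx x integrable_on cbox (- a) a"
      unfolding fx_def
      by (intro integrable_continuous continuous_intros continuous_on_subset[OF \<sigma>] continuous_on_compose2[OF gc]
          bounded_linear.continuous_on[OF bounded_linear_blinfun_inner_right]) auto
    then have "blinfun_apply (integral (cbox (- a) a) (fx x)) v = integral (cbox (- a) a) (\<lambda>y. fx x y v)"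
      by (rule blinfun_apply_integral)
    also have "\<dots> = integral (cbox (- a) a) (\<lambda>y. \<sigma> y * (gradient k (x - y) \<bullet> v))"
      by (simp add: fx_def blinfun.scaleR_left)
    also have "\<dots> = (LINT y|lborel. \<sigma> y * (gradient k (x - y) \<bullet> v))"
      by (rule integral_cbox_eq_lborel[of _ "norm x + 1 + r"])
         (use far[of x] gradient_zero_outside[of r k] supp a in
           \<open>auto intro!: continuous_intros \<sigma> continuous_on_compose2[OF gc]\<close>)
    also have "\<dots> = (LINT y|lborel. (\<Sum>j\<in>UNIV. v $ j * (\<sigma> y * gradient k (x - y) $ j)))"
      by (simp add: inner_vec_def sum_distrib_left mult_ac)
    also have "\<dots> = (\<Sum>j\<in>UNIV. (LINT y|lborel. v $ j * (\<sigma> y * gradient k (x - y) $ j)))"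
    proof (rule Bochner_Integration.integral_sum)
      fix j
      have "integrable lborel (\<lambda>y. \<sigma> y * gradient k (x - y) $ j)"
        by (rule integrable_lborel_continuous_bounded_support[of _ "norm x + 1 + r"])
           (use far[of x] gradient_zero_outside[of r k] supp in
             \<open>auto intro!: continuous_intros \<sigma> continuous_on_component continuous_on_compose2[OF gc]\<close>)
      then show "integrable lborel (\<lambda>y. v $ j * (\<sigma> y * gradient k (x - y) $ j))"
        by (rule integrable_mult_right)
    qed
    also have "\<dots> = (\<chi> j. convolve \<sigma> (\<lambda>z. gradient k z $ j) x) \<bullet> v"
      by (simp add: inner_vec_def convolve_def mult.commute)
    finally show ?thesis .
  qed
  have "(convolve \<sigma> k has_derivative blinfun_apply (integral (cbox (- a) a) (fx x))) (at x within ?U)"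
    by (rule has_derivative_transform[OF _ _ D]) (auto simp: eq1)
  then have "(convolve \<sigma> k has_derivative blinfun_apply (integral (cbox (- a) a) (fx x))) (at x)"
    by (subst (asm) at_within_open) auto
  moreover have "blinfun_apply (integral (cbox (- a) a) (fx x)) = (\<lambda>v. (\<chi> j. convolve \<sigma> (\<lambda>z. gradient k z $ j) x) \<bullet> v)"
    using eq2 by auto
  ultimately show ?thesis by simp
qed

lemma smooth_alg_gradient_component:
  assumes "smooth_alg k"
  shows "smooth_alg (\<lambda>z. gradient k z $ j)"
  unfolding gradient_def by (simp add: smooth_alg_differentiable(2)[OF assms])

lemma gradient_flat_exp_bump:
  fixes z :: "real ^ 'n::finite"
  shows "gradient (\<lambda>z. a * flat_exp m (r\<^sup>2 - z \<bullet> z)) z =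
    (- 2 * a * (flat_exp (m + 2) (r\<^sup>2 - z \<bullet> z) - real m * flat_exp (m + 1) (r\<^sup>2 - z \<bullet> z))) *\<^sub>R z"
proof (rule gradient_eqI)
  have "((\<lambda>z. a * flat_exp m (r\<^sup>2 - z \<bullet> z)) has_derivative (\<lambda>v. a *
    ((flat_exp (m + 2) (r\<^sup>2 - z \<bullet> z) + (- real m) * flat_exp (m + 1) (r\<^sup>2 - z \<bullet> z)) * (- 2 * (z \<bullet> v))))) (at z)"
    by (rule has_derivative_mult_right[OF flat_exp_bump_has_derivative])
  then show "((\<lambda>z. a * flat_exp m (r\<^sup>2 - z \<bullet> z)) has_derivative (\<lambda>v. ((- 2 * a *
    (flat_exp (m + 2) (r\<^sup>2 - z \<bullet> z) - real m * flat_exp (m + 1) (r\<^sup>2 - z \<bullet> z))) *\<^sub>R z) \<bullet> v)) (at z)"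
    by (rule has_derivative_eq_rhs) (auto simp: fun_eq_iff algebra_simps)
qed

text \<open>The gradient of a radial function at \<open>z\<close> is a multiple \<open>F z\<close>
  of \<open>z\<close> with \<open>F\<close> again radial; the Hessian is therefore a multiple of the
  identity plus a multiple of \<open>z\<close> times its transpose.\<close>

lemma kernel_hessian_symmetric:
  fixes z :: "real ^ 'n::finite"
  shows "gradient (\<lambda>z. gradient (bump_kernel r) z $ i) z $ j = gradient (\<lambda>z. gradient (bump_kernel r) z $ j) z $ i"
proof -
  define c where "c = inverse (kernel_mass TYPE(real ^ 'n) r)"
  define F where "F z = (- 2 * c) * flat_exp 2 (r\<^sup>2 - z \<bullet> z)" for z :: "real ^ 'n"
  have g: "gradient (bump_kernel r) z = F z *\<^sub>R z" for z :: "real ^ 'n"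
    unfolding bump_kernel_def[abs_def] c_def[symmetric]
    using gradient_flat_exp_bump[of c 0 r z] by (simp add: F_def numeral_2_eq_2)
  obtain G where G: "gradient F z = G *\<^sub>R z"
    unfolding F_def[abs_def] using gradient_flat_exp_bump[of "- 2 * c" 2 r z] by blast
  have Fd: "F differentiable (at z)"
    unfolding F_def[abs_def]
    by (intro smooth_alg_differentiable smooth_alg.mult smooth_alg.const smooth_alg.bump)
  have "(\<lambda>z. z $ i) differentiable (at z)" for i
    by (rule bounded_linear_imp_differentiable[OF bounded_linear_vec_nth])
  then have "gradient (\<lambda>z. F z * z $ i) z = F z *\<^sub>R axis i 1 + z $ i *\<^sub>R (G *\<^sub>R z)" for i
    using gradient_mult[OF Fd, of "\<lambda>z. z $ i"] G by (simp add: gradient_component)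
  then show ?thesis unfolding g by (simp add: axis_def)
qed

lemma C2_mollify:
  fixes \<sigma> :: "real ^ 'n::finite \<Rightarrow> real"
  assumes \<sigma>: "continuous_on UNIV \<sigma>" and r: "r > 0"
  shows "C2 (mollify r \<sigma>)"
proof -
  define k where "k = (bump_kernel r :: real ^ 'n \<Rightarrow> real)"
  define k1 where "k1 i z = gradient k z $ i" for i z
  define k2 where "k2 i j z = gradient (k1 i) z $ j" for i j z
  have s: "smooth_alg k" "smooth_alg (k1 i)" "smooth_alg (k2 i j)" for i j
    unfolding k_def k1_def[abs_def] k2_def[abs_def]
    by (intro smooth_alg_kernel smooth_alg_gradient_component)+
  have z: "k z = 0" "k1 i z = 0" "k2 i j z = 0" if "norm z > r" for i j z
  proof -
    have 0: "k z = 0" if "norm z > r" for z using that r by (simp add: k_def kernel_zero)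
    have 1: "k1 i z = 0" if "norm z > r" for i z using gradient_zero_outside[OF 0 that] by (simp add: k1_def)
    have 2: "k2 i j z = 0" if "norm z > r" for i j z
      using gradient_zero_outside[where f = "k1 i", OF 1 that] by (simp add: k2_def)
    show "k z = 0" "k1 i z = 0" "k2 i j z = 0" using 0 1 2 that by auto
  qed
  have m: "mollify r \<sigma> = convolve \<sigma> k"
    using mollify_eq_convolve[OF \<sigma>] by (auto simp: k_def)
  note d0 = convolve_has_derivative[OF \<sigma> s(1), of r, OF z(1), folded k1_def]
  note d1 = convolve_has_derivative[OF \<sigma> s(2), of r, OF z(2), folded k2_def]
  note d2 = convolve_has_derivative[OF \<sigma> s(3), of r, OF z(3)]
  have g0: "gradient (convolve \<sigma> k) x $ i = convolve \<sigma> (k1 i) x" for x i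
    using gradient_eqI[OF d0] by simp
  have g1: "gradient (convolve \<sigma> (k1 i)) x = (\<chi> j. convolve \<sigma> (k2 i j) x)" for x i
    by (rule gradient_eqI[OF d1])
  have g1': "gradient (convolve \<sigma> (k1 i)) = (\<lambda>x. \<chi> j. convolve \<sigma> (k2 i j) x)" for i
    using g1 by auto
  have sym: "k2 i j = k2 j i" for i j
    unfolding k2_def k1_def k_def by (rule ext, rule kernel_hessian_symmetric)
  have c2: "continuous_on UNIV (convolve \<sigma> (k2 i j))" for i j
    by (rule differentiable_imp_continuous_UNIV, rule differentiableI, rule d2)
  show ?thesis
    unfolding C2_def m g0 g1'
    using d0 d1 sym by (auto intro: differentiableI continuous_on_vec_lambda c2)
qed

section \<open>The current with an integrable density\<close>

lemma Lip_c_Lip: "f \<in> Lip_c \<Longrightarrow> f \<in> Lip"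
  by (simp add: Lip_c_def)

lemma Lip_continuous: "f \<in> Lip \<Longrightarrow> continuous_on UNIV f"
  by (auto simp: Lip_def Lipschitz_fun_on_def intro: lipschitz_on_continuous_on)

lemma Lip_family_bound:
  fixes \<pi> :: "'k::finite \<Rightarrow> 'a::metric_space \<Rightarrow> real"
  assumes "\<And>b. \<pi> b \<in> Lip"
  obtains L where "L > 0" "\<And>b. L-lipschitz_on UNIV (\<pi> b)"
proof -
  obtain M where M: "\<And>b. (M b)-lipschitz_on UNIV (\<pi> b)"
    using assms unfolding Lip_def Lipschitz_fun_on_def mem_Collect_eq by metis
  have M0: "M b \<ge> 0" for b using M lipschitz_on_nonneg by blast
  have "M b \<le> 1 + (\<Sum>b\<in>UNIV. M b)" for b
    using member_le_sum[of b UNIV M] M0 by simp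
  then have "(1 + (\<Sum>b\<in>UNIV. M b))-lipschitz_on UNIV (\<pi> b)" for b
    using M lipschitz_on_le by blast
  moreover have "1 + (\<Sum>b\<in>UNIV. M b) > 0" using M0 by (simp add: add_pos_nonneg sum_nonneg)
  ultimately show ?thesis using that by blast
qed

text \<open>Pointwise convergence on a finite net controls the functions on all of \<open>K\<close>
  by equicontinuity.\<close>

lemma equi_lipschitz_uniform_on_compact:
  fixes F :: "nat \<Rightarrow> 'a::metric_space \<Rightarrow> real"
  assumes F: "\<And>i. L-lipschitz_on UNIV (F i)" and f: "L-lipschitz_on UNIV f"
    and lim: "\<And>x. (\<lambda>i. F i x) \<longlonglongrightarrow> f x" and K: "compact K" and e: "e > 0"
  shows "\<forall>\<^sub>F i in sequentially. \<forall>x\<in>K. \<bar>F i x - f x\<bar> \<le> e"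
proof -
  have L: "L \<ge> 0" using f by (rule lipschitz_on_nonneg)
  define d where "d = e / (3 * (L + 1))"
  have d: "d > 0" "L * d \<le> e / 3" using e L by (auto simp: d_def field_simps)
  obtain S where S: "finite S" "K \<subseteq> (\<Union>s\<in>S. ball s d)"
    by (rule compactE_image[OF K, of K "\<lambda>s. ball s d"]) (use d in force)+
  have "\<forall>\<^sub>F i in sequentially. \<bar>F i s - f s\<bar> < e / 3" for s
    using lim[of s, THEN tendstoD, of "e / 3"] e by (simp add: dist_real_def)
  then have "\<forall>\<^sub>F i in sequentially. \<forall>s\<in>S. \<bar>F i s - f s\<bar> < e / 3"
    using S(1) by (intro eventually_ball_finite) auto
  then show ?thesis
  proof eventually_elim
    case (elim i)
    show ?case
    proof
      fix x assume "x \<in> K"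
      then obtain s where s: "s \<in> S" "dist s x < d" using S(2) by auto
      have "L * dist s x \<le> L * d" using s(2) L by (intro mult_left_mono) auto
      then have "\<bar>F i s - F i x\<bar> \<le> e / 3" "\<bar>f s - f x\<bar> \<le> e / 3"
        using lipschitz_onD[OF F, of s x i] lipschitz_onD[OF f, of s x] d(2)
        by (auto simp: dist_real_def)
      moreover have "\<bar>F i s - f s\<bar> < e / 3" using elim s(1) by blast
      ultimately show "\<bar>F i x - f x\<bar> \<le> e" by linarith
    qed
  qed
qed

definition mollified_pairing ::
    "(real ^ 'n \<Rightarrow> real) \<Rightarrow> (real ^ 'n \<Rightarrow> real) \<Rightarrow> ('n::finite \<Rightarrow> real ^ 'n \<Rightarrow> real) \<Rightarrow> nat \<Rightarrow> real"
  where "mollified_pairing g f \<pi> m =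
    (LINT x|lebesgue. g x * f x * Jac (\<lambda>b. mollify (1 / real (Suc m)) (\<pi> b)) x)"

text \<open>For \<open>g\<close> integrable with bounded support, \<open>f\<close> in
  \<open>Lip_c\<close> and Lipschitz \<open>\<pi>\<close> the limit exists by
  \<open>mollified_pairing_tendsto\<close>; otherwise the value is arbitrary.\<close>

definition Jac_current ::
    "(real ^ 'n \<Rightarrow> real) \<Rightarrow> (real ^ 'n \<Rightarrow> real) \<Rightarrow> ('n::finite \<Rightarrow> real ^ 'n \<Rightarrow> real) \<Rightarrow> real"
  where "Jac_current g f \<pi> = lim (mollified_pairing g f \<pi>)"

lemma mollify_seq:
  assumes "L-lipschitz_on UNIV \<sigma>"
  shows "C2 (mollify (1 / real (Suc m)) \<sigma>)" "L-lipschitz_on UNIV (mollify (1 / real (Suc m)) \<sigma>)"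
    "\<bar>mollify (1 / real (Suc m)) \<sigma> x - \<sigma> x\<bar> \<le> L / real (Suc m)"
  using C2_mollify[OF lipschitz_on_continuous_on[OF assms], of "1 / real (Suc m)"]
    mollify_lipschitz[OF assms, of "1 / real (Suc m)"] mollify_close[OF assms, of "1 / real (Suc m)" x]
  by simp_all

lemma integrable_mult_Lip_c:
  fixes g :: "'a::euclidean_space \<Rightarrow> real"
  assumes "integrable lebesgue g" "f \<in> Lip_c"
  shows "integrable lebesgue (\<lambda>x. g x * f x)"
proof -
  obtain B where "\<And>x. \<bar>f x\<bar> \<le> B" using Lip_c_bounded[OF assms(2)] by blast
  then show ?thesis
    by (intro integrable_mult_bounded_continuous[OF assms(1)] Lip_continuous Lip_c_Lip assms(2))
qed

lemma integrable_mult_Jac_mollify: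
  fixes g :: "real ^ 'n::finite \<Rightarrow> real"
  assumes "integrable lebesgue g" "\<And>b. \<pi> b \<in> Lip"
  shows "integrable lebesgue (\<lambda>x. g x * Jac (\<lambda>b. mollify (1 / real (Suc m)) (\<pi> b)) x)"
proof -
  obtain L where L: "L > 0" "\<And>b. L-lipschitz_on UNIV (\<pi> b)" using Lip_family_bound[of \<pi>, OF assms(2)] by blast
  show ?thesis
    by (rule integrable_mult_bounded_continuous[OF assms(1) continuous_Jac abs_Jac_le]) (rule mollify_seq[OF L(2)])+
qed

context
  fixes g :: "real ^ 'n::finite \<Rightarrow> real" and R :: real
  assumes g: "integrable lebesgue g" and supp: "\<And>x. norm x > R \<Longrightarrow> g x = 0" and R: "R > 0"
begin

lemma pairing_integrable:
  assumes "f \<in> Lip_c" "\<And>b. \<pi> b \<in> Lip"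
  shows "integrable lebesgue (\<lambda>x. g x * f x * Jac (\<lambda>b. mollify (1 / real (Suc m)) (\<pi> b)) x)"
  by (rule integrable_mult_Jac_mollify[OF integrable_mult_Lip_c[OF g assms(1)] assms(2)])

text \<open>Weak continuity for the integrable function \<open>g * f\<close>, in the form that
  serves both the convergence of the mollified pairings and the continuity of their limit.\<close>

lemma mollified_pairing_close:
  assumes f: "f \<in> Lip_c" and e: "e > 0"
  shows "\<exists>d>0. \<forall>\<pi> \<sigma> m m'. (\<forall>b. L-lipschitz_on UNIV (\<pi> b)) \<and> (\<forall>b. L-lipschitz_on UNIV (\<sigma> b)) \<and>
      (\<forall>b x. norm x \<le> R + 1 \<longrightarrow>
        \<bar>mollify (1 / real (Suc m)) (\<pi> b) x - mollify (1 / real (Suc m')) (\<sigma> b) x\<bar> \<le> d)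
      \<longrightarrow> \<bar>mollified_pairing g f \<pi> m - mollified_pairing g f \<sigma> m'\<bar> \<le> e"
proof -
  obtain d where d: "d > 0" "\<And>\<eta> \<zeta>. \<lbrakk>\<And>b. C2 (\<eta> b); \<And>b. C2 (\<zeta> b);
        \<And>b. L-lipschitz_on UNIV (\<eta> b); \<And>b. L-lipschitz_on UNIV (\<zeta> b);
        \<And>b x. norm x \<le> R + 1 \<Longrightarrow> \<bar>\<eta> b x - \<zeta> b x\<bar> \<le> d\<rbrakk>
      \<Longrightarrow> \<bar>LINT x|lebesgue. g x * f x * (Jac \<eta> x - Jac \<zeta> x)\<bar> \<le> e"
    by (rule Jac_weak_continuity[OF integrable_mult_Lip_c[OF g f] _ R e, where L = L]) (use supp in auto)
  show ?thesis
  proof (intro exI[of _ d] conjI d(1) allI impI, elim conjE)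
    fix \<pi> \<sigma> :: "'n \<Rightarrow> real ^ 'n \<Rightarrow> real" and m m'
    assume "\<forall>b. L-lipschitz_on UNIV (\<pi> b)" "\<forall>b. L-lipschitz_on UNIV (\<sigma> b)"
      and "\<forall>b x. norm x \<le> R + 1 \<longrightarrow>
        \<bar>mollify (1 / real (Suc m)) (\<pi> b) x - mollify (1 / real (Suc m')) (\<sigma> b) x\<bar> \<le> d"
    then have L: "\<And>b. L-lipschitz_on UNIV (\<pi> b)" "\<And>b. L-lipschitz_on UNIV (\<sigma> b)"
      and close: "\<And>b x. norm x \<le> R + 1 \<Longrightarrow>
        \<bar>mollify (1 / real (Suc m)) (\<pi> b) x - mollify (1 / real (Suc m')) (\<sigma> b) x\<bar> \<le> d" by auto
    have Lip: "\<pi> b \<in> Lip" "\<sigma> b \<in> Lip" for b using L Lip_I by blast+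
    have "mollified_pairing g f \<pi> m - mollified_pairing g f \<sigma> m' =
      (LINT x|lebesgue. g x * f x * (Jac (\<lambda>b. mollify (1 / real (Suc m)) (\<pi> b)) x -
         Jac (\<lambda>b. mollify (1 / real (Suc m')) (\<sigma> b)) x))"
      using pairing_integrable[OF f, of \<pi> m, OF Lip(1)] pairing_integrable[OF f, of \<sigma> m', OF Lip(2)]
      by (simp add: mollified_pairing_def right_diff_distrib)
    then show "\<bar>mollified_pairing g f \<pi> m - mollified_pairing g f \<sigma> m'\<bar> \<le> e"
      using d(2)[of "\<lambda>b. mollify (1 / real (Suc m)) (\<pi> b)" "\<lambda>b. mollify (1 / real (Suc m')) (\<sigma> b)"]
        mollify_seq[OF L(1)] mollify_seq[OF L(2)] close by simp
  qed
qed

lemma mollified_pairing_tendsto: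
  assumes f: "f \<in> Lip_c" and \<pi>: "\<And>b. \<pi> b \<in> Lip"
  shows "mollified_pairing g f \<pi> \<longlonglongrightarrow> Jac_current g f \<pi>"
proof -
  obtain L where L: "L > 0" "\<And>b. L-lipschitz_on UNIV (\<pi> b)" using Lip_family_bound[of \<pi>, OF \<pi>] by blast
  have "Cauchy (mollified_pairing g f \<pi>)"
  proof (rule CauchyI)
    fix e :: real assume e: "e > 0"
    obtain d where d: "d > 0" "\<forall>\<pi> \<sigma> m m'. (\<forall>b. L-lipschitz_on UNIV (\<pi> b)) \<and> (\<forall>b. L-lipschitz_on UNIV (\<sigma> b)) \<and>
      (\<forall>b x. norm x \<le> R + 1 \<longrightarrow>
        \<bar>mollify (1 / real (Suc m)) (\<pi> b) x - mollify (1 / real (Suc m')) (\<sigma> b) x\<bar> \<le> d)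
      \<longrightarrow> \<bar>mollified_pairing g f \<pi> m - mollified_pairing g f \<sigma> m'\<bar> \<le> e / 2"
      using mollified_pairing_close[OF f half_gt_zero[OF e], of L] by blast
    obtain M where M: "2 * L / d < real M" using reals_Archimedean2 by blast
    have small: "L / real (Suc m) \<le> d / 2" if "m \<ge> M" for m
    proof -
      have "2 * L / d < real (Suc m)" using M that by linarith
      then show ?thesis using d(1) by (simp add: field_simps)
    qed
    show "\<exists>M. \<forall>m\<ge>M. \<forall>n\<ge>M. norm (mollified_pairing g f \<pi> m - mollified_pairing g f \<pi> n) < e"
    proof (intro exI[of _ M] allI impI)
      fix m n assume mn: "m \<ge> M" "n \<ge> M"
      have "\<bar>mollified_pairing g f \<pi> m - mollified_pairing g f \<pi> n\<bar> \<le> e / 2"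
      proof (rule d(2)[rule_format], intro conjI allI impI L(2))
        show "\<bar>mollify (1 / real (Suc m)) (\<pi> b) x - mollify (1 / real (Suc n)) (\<pi> b) x\<bar> \<le> d" for b x
          using mollify_seq(3)[OF L(2), of m b x] mollify_seq(3)[OF L(2), of n b x] small[OF mn(1)] small[OF mn(2)]
          by linarith
      qed
      then show "norm (mollified_pairing g f \<pi> m - mollified_pairing g f \<pi> n) < e" using e by simp
    qed
  qed
  then show ?thesis
    unfolding Jac_current_def using Cauchy_convergent convergent_LIMSEQ_iff by blast
qed

text \<open>A bound that holds for all \<open>C2\<close> maps survives in the limit, because
  mollification preserves Lipschitz constants.\<close>

lemma Jac_current_bound:
  assumes f: "f \<in> Lip_c" and \<pi>: "\<And>b. L-lipschitz_on UNIV (\<pi> b)"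
    and bound: "\<And>\<sigma>. (\<And>b. C2 (\<sigma> b)) \<Longrightarrow> (\<And>b. L-lipschitz_on UNIV (\<sigma> b)) \<Longrightarrow>
      \<bar>LINT x|lebesgue. g x * f x * Jac \<sigma> x\<bar> \<le> c"
  shows "\<bar>Jac_current g f \<pi>\<bar> \<le> c"
proof (rule LIMSEQ_le_const2)
  show "(\<lambda>m. \<bar>mollified_pairing g f \<pi> m\<bar>) \<longlonglongrightarrow> \<bar>Jac_current g f \<pi>\<bar>"
    by (intro tendsto_rabs mollified_pairing_tendsto f Lip_I[OF \<pi>])
  show "\<exists>N. \<forall>m\<ge>N. \<bar>mollified_pairing g f \<pi> m\<bar> \<le> c"
    unfolding mollified_pairing_def by (intro exI allI impI bound mollify_seq[OF \<pi>])
qed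

lemma Jac_current_lin_function:
  assumes "f \<in> Lip_c" "h \<in> Lip_c" "\<And>b. \<pi> b \<in> Lip"
  shows "Jac_current g (\<lambda>x. s * f x + t * h x) \<pi> = s * Jac_current g f \<pi> + t * Jac_current g h \<pi>"
proof -
  have "mollified_pairing g (\<lambda>x. s * f x + t * h x) \<pi> m =
      s * mollified_pairing g f \<pi> m + t * mollified_pairing g h \<pi> m" for m
  proof -
    have "mollified_pairing g (\<lambda>x. s * f x + t * h x) \<pi> m =
      (LINT x|lebesgue. s * (g x * f x * Jac (\<lambda>b. mollify (1 / real (Suc m)) (\<pi> b)) x) +
        t * (g x * h x * Jac (\<lambda>b. mollify (1 / real (Suc m)) (\<pi> b)) x))"
      unfolding mollified_pairing_def by (simp add: algebra_simps)
    then show ?thesis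
      using pairing_integrable[OF assms(1), of \<pi> m, OF assms(3)] pairing_integrable[OF assms(2), of \<pi> m, OF assms(3)]
      by (simp add: mollified_pairing_def)
  qed
  then have "mollified_pairing g (\<lambda>x. s * f x + t * h x) \<pi> =
      (\<lambda>m. s * mollified_pairing g f \<pi> m + t * mollified_pairing g h \<pi> m)" by auto
  moreover have "(\<lambda>m. s * mollified_pairing g f \<pi> m + t * mollified_pairing g h \<pi> m) \<longlonglongrightarrow>
      s * Jac_current g f \<pi> + t * Jac_current g h \<pi>"
    by (intro tendsto_intros mollified_pairing_tendsto assms)
  ultimately show ?thesis unfolding Jac_current_def[of g "\<lambda>x. s * f x + t * h x"] by (simp add: limI)
qed

lemma Jac_mollify_lin:
  fixes \<pi> :: "'n \<Rightarrow> real ^ 'n \<Rightarrow> real"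
  assumes "\<sigma> \<in> Lip" "\<tau> \<in> Lip" "r > 0"
  shows "Jac (\<lambda>b. mollify r ((\<pi>(j := (\<lambda>x. s * \<sigma> x + t * \<tau> x))) b)) x =
    s * Jac (\<lambda>b. mollify r ((\<pi>(j := \<sigma>)) b)) x + t * Jac (\<lambda>b. mollify r ((\<pi>(j := \<tau>)) b)) x"
proof -
  have c: "continuous_on UNIV \<sigma>" "continuous_on UNIV \<tau>" using assms Lip_continuous by auto
  let ?G = "\<lambda>f. gradient (mollify r f) x"
  have rows: "(\<chi> b. ?G ((\<pi>(j := f)) b)) = (\<chi> b. if b = j then ?G f else ?G (\<pi> b))" for f
    by (auto simp: vec_eq_iff)
  have "mollify r (\<lambda>x. s * \<sigma> x + t * \<tau> x) = (\<lambda>x. s * mollify r \<sigma> x + t * mollify r \<tau> x)"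
    using mollify_lincomb[OF c assms(3)] by auto
  then have lin: "?G (\<lambda>x. s * \<sigma> x + t * \<tau> x) = s *s ?G \<sigma> + t *s ?G \<tau>"
    using gradient_lincomb[OF C2D(1)[OF C2_mollify[OF c(1) assms(3)]] C2D(1)[OF C2_mollify[OF c(2) assms(3)]],
        where a = s and b = t] by (simp add: scalar_mult_eq_scaleR)
  show ?thesis
    unfolding Jac_def rows lin det_row_add[of j "\<lambda>_. s *s ?G \<sigma>" "\<lambda>_. t *s ?G \<tau>"]
      det_row_mul[of j s "\<lambda>_. ?G \<sigma>"] det_row_mul[of j t "\<lambda>_. ?G \<tau>"] ..
qed

lemma Jac_current_lin_map:
  assumes "f \<in> Lip_c" "\<sigma> \<in> Lip" "\<tau> \<in> Lip" "\<And>b. \<pi> b \<in> Lip"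
  shows "Jac_current g f (\<pi>(j := (\<lambda>x. s * \<sigma> x + t * \<tau> x))) =
    s * Jac_current g f (\<pi>(j := \<sigma>)) + t * Jac_current g f (\<pi>(j := \<tau>))"
proof -
  have Lip: "(\<pi>(j := \<sigma>)) b \<in> Lip" "(\<pi>(j := \<tau>)) b \<in> Lip" for b using assms by auto
  have "mollified_pairing g f (\<pi>(j := (\<lambda>x. s * \<sigma> x + t * \<tau> x))) m =
      s * mollified_pairing g f (\<pi>(j := \<sigma>)) m + t * mollified_pairing g f (\<pi>(j := \<tau>)) m" for m
  proof -
    have "mollified_pairing g f (\<pi>(j := (\<lambda>x. s * \<sigma> x + t * \<tau> x))) m =
      (LINT x|lebesgue. s * (g x * f x * Jac (\<lambda>b. mollify (1 / real (Suc m)) ((\<pi>(j := \<sigma>)) b)) x) +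
        t * (g x * f x * Jac (\<lambda>b. mollify (1 / real (Suc m)) ((\<pi>(j := \<tau>)) b)) x))"
      unfolding mollified_pairing_def
      by (subst Jac_mollify_lin) (use assms in \<open>simp_all add: algebra_simps\<close>)
    then show ?thesis
      using pairing_integrable[OF assms(1), of "\<pi>(j := \<sigma>)" m, OF Lip(1)]
        pairing_integrable[OF assms(1), of "\<pi>(j := \<tau>)" m, OF Lip(2)]
      by (simp add: mollified_pairing_def)
  qed
  then have "mollified_pairing g f (\<pi>(j := (\<lambda>x. s * \<sigma> x + t * \<tau> x))) =
      (\<lambda>m. s * mollified_pairing g f (\<pi>(j := \<sigma>)) m + t * mollified_pairing g f (\<pi>(j := \<tau>)) m)" by auto
  moreover have "(\<lambda>m. s * mollified_pairing g f (\<pi>(j := \<sigma>)) m + t * mollified_pairing g f (\<pi>(j := \<tau>)) m) \<longlonglongrightarrow>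
      s * Jac_current g f (\<pi>(j := \<sigma>)) + t * Jac_current g f (\<pi>(j := \<tau>))"
    using Lip by (intro tendsto_intros mollified_pairing_tendsto assms(1)) auto
  ultimately show ?thesis
    unfolding Jac_current_def[of g f "\<pi>(j := (\<lambda>x. s * \<sigma> x + t * \<tau> x))"] by (simp add: limI)
qed

text \<open>Once the mollification radius is smaller than the distance from the support of
  \<open>f\<close> to the complement of \<open>U\<close>, the mollified component is constant on the
  open set where \<open>f\<close> does not vanish, and the Jacobian matrix has a zero row
  there.\<close>

lemma Jac_current_local:
  assumes f: "f \<in> Lip_c" and \<pi>: "\<And>b. \<pi> b \<in> Lip"
    and U: "open U" "spt f \<subseteq> U" "\<And>x. x \<in> U \<Longrightarrow> \<pi> j x = c"
  shows "Jac_current g f \<pi> = 0"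
proof -
  have cs: "compact (spt f)" using f by (simp add: Lip_c_def)
  obtain d where d: "d > 0" "\<And>x y. x \<in> spt f \<Longrightarrow> y \<in> - U \<Longrightarrow> d \<le> dist x y"
  proof -
    have "spt f \<inter> - U = {}" "closed (- U)" using U(1,2) by auto
    then show ?thesis using separate_compact_closed[OF cs, of "- U"] that by blast
  qed
  obtain M where M: "1 / d < real M" using reals_Archimedean2 by blast
  have "mollified_pairing g f \<pi> m = 0" if "m \<ge> M" for m
  proof -
    define r where "r = 1 / real (Suc m)"
    have "1 / d < real (Suc m)" using M that by linarith
    then have r: "r > 0" "r < d" using d(1) by (auto simp: r_def field_simps)
    have Jac0: "Jac (\<lambda>b. mollify r (\<pi> b)) x = 0" if "f x \<noteq> 0" for x
    proof -
      have "open {x. f x \<noteq> 0}"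
        by (rule open_Collect_neq) (use Lip_continuous[OF Lip_c_Lip[OF f]] in auto)
      moreover have "mollify r (\<pi> j) y = c" if "y \<in> {x. f x \<noteq> 0}" for y
      proof (rule mollify_locally_const[OF Lip_continuous[OF \<pi>] r(1)])
        fix z :: "real ^ 'n" assume z: "norm z \<le> r"
        have "y \<in> spt f" unfolding spt_def using that closure_subset[of "{x. f x \<noteq> 0}"] by auto
        then have "y - z \<in> U" using d(2)[of y "y - z"] z r by (auto simp: dist_norm)
        then show "\<pi> j (y - z) = c" by (rule U)
      qed
      ultimately have "gradient (mollify r (\<pi> j)) x = 0"
        using that by (intro gradient_locally_const[of "{x. f x \<noteq> 0}" x _ c]) auto
      then show ?thesis
        unfolding Jac_def by (intro det_zero_row(2)[of j]) (simp add: row_def vec_eq_iff)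
    qed
    have "mollified_pairing g f \<pi> m = (LINT x|lebesgue. 0 * g x)"
      unfolding mollified_pairing_def r_def[symmetric]
      by (rule Bochner_Integration.integral_cong) (use Jac0 in \<open>auto simp del: mult_eq_0_iff\<close>)
    then show ?thesis by simp
  qed
  then have "mollified_pairing g f \<pi> \<longlonglongrightarrow> 0"
    by (intro tendsto_eventually) (auto simp: eventually_sequentially)
  then show ?thesis unfolding Jac_current_def by (rule limI)
qed

lemma mollified_pairing_function_close:
  assumes f: "f \<in> Lip_c" "h \<in> Lip_c" and \<pi>: "\<And>b. L-lipschitz_on UNIV (\<pi> b)"
    and close: "\<And>x. norm x \<le> R \<Longrightarrow> \<bar>f x - h x\<bar> \<le> e" and e: "e \<ge> 0"
  shows "\<bar>mollified_pairing g f \<pi> m - mollified_pairing g h \<pi> m\<bar> \<le>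
    e * (fact CARD('n) * L ^ CARD('n) * (LINT x|lebesgue. \<bar>g x\<bar>))"
proof -
  let ?J = "Jac (\<lambda>b. mollify (1 / real (Suc m)) (\<pi> b))"
  have i: "integrable lebesgue (\<lambda>x. g x * f x)" "integrable lebesgue (\<lambda>x. g x * h x)"
    by (rule integrable_mult_Lip_c[OF g], rule f)+
  have L0: "L \<ge> 0" using \<pi> lipschitz_on_nonneg by blast
  have "mollified_pairing g f \<pi> m - mollified_pairing g h \<pi> m = (LINT x|lebesgue. (g x * f x - g x * h x) * ?J x)"
    using pairing_integrable[OF f(1), of \<pi> m, OF Lip_I[OF \<pi>]] pairing_integrable[OF f(2), of \<pi> m, OF Lip_I[OF \<pi>]]
    by (simp add: mollified_pairing_def left_diff_distrib)
  then have 1: "\<bar>mollified_pairing g f \<pi> m - mollified_pairing g h \<pi> m\<bar> \<le>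
    fact CARD('n) * L ^ CARD('n) * (LINT x|lebesgue. \<bar>g x * f x - g x * h x\<bar>)"
    using abs_integral_mult_le[of "\<lambda>x. g x * f x - g x * h x" ?J "fact CARD('n) * L ^ CARD('n)"]
      i continuous_Jac[of "\<lambda>b. mollify (1 / real (Suc m)) (\<pi> b)", OF mollify_seq(1)[OF \<pi>]]
      abs_Jac_le[of "\<lambda>b. mollify (1 / real (Suc m)) (\<pi> b)", OF mollify_seq(1,2)[OF \<pi>]] by simp
  have "(LINT x|lebesgue. \<bar>g x * f x - g x * h x\<bar>) \<le> (LINT x|lebesgue. e * \<bar>g x\<bar>)"
  proof (rule integral_mono)
    show "\<bar>g x * f x - g x * h x\<bar> \<le> e * \<bar>g x\<bar>" for x
    proof (cases "norm x \<le> R")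
      case True
      have "g x * f x - g x * h x = (f x - h x) * g x" by (simp add: algebra_simps)
      then show ?thesis using close[OF True] by (simp add: abs_mult mult_right_mono)
    qed (use supp in auto)
  qed (use i g in auto)
  then have 2: "fact CARD('n) * L ^ CARD('n) * (LINT x|lebesgue. \<bar>g x * f x - g x * h x\<bar>) \<le>
    fact CARD('n) * L ^ CARD('n) * (e * (LINT x|lebesgue. \<bar>g x\<bar>))"
    using L0 by (intro mult_left_mono) auto
  show ?thesis using order_trans[OF 1 2] by (simp add: mult_ac)
qed

text \<open>For each \<open>i\<close> an index \<open>\<mu> i \<ge> i\<close> is chosen at which the
  mollified pairing is close to its limit. The difference to the limit functional then splits into
  four parts: the error of this choice, the change from \<open>F i\<close> to \<open>f\<close>, the
  change from \<open>P i\<close> to \<open>\<pi>\<close> at the same radius, and the convergence of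
  the pairings of \<open>f\<close> and \<open>\<pi>\<close> along \<open>\<mu>\<close>.\<close>

lemma Jac_current_continuous:
  assumes F: "\<And>i. F i \<in> Lip_c" "f \<in> Lip_c" and P: "\<And>i j. P i j \<in> Lip" "\<And>j. \<pi> j \<in> Lip"
    and lim: "\<And>x. (\<lambda>i. F i x) \<longlonglongrightarrow> f x" "\<And>j x. (\<lambda>i. P i j x) \<longlonglongrightarrow> \<pi> j x"
    and L: "\<And>i. L-lipschitz_on UNIV (F i)" "\<And>i j. L-lipschitz_on UNIV (P i j)"
  shows "(\<lambda>i. Jac_current g (F i) (P i)) \<longlonglongrightarrow> Jac_current g f \<pi>"
proof -
  obtain L1 where L1: "L1 > 0" "\<And>j. L1-lipschitz_on UNIV (\<pi> j)" using Lip_family_bound[of \<pi>, OF P(2)] by blast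
  obtain L2 where L2: "L2-lipschitz_on UNIV f"
    using F(2) by (auto simp: Lip_c_def Lip_def Lipschitz_fun_on_def)
  define K where "K = max L (max L1 L2)"
  have K: "K-lipschitz_on UNIV (F i)" "K-lipschitz_on UNIV (P i j)" "K-lipschitz_on UNIV (\<pi> j)" "K-lipschitz_on UNIV f" for i j
    using lipschitz_on_le[OF L(1), of K] lipschitz_on_le[OF L(2), of K] lipschitz_on_le[OF L1(2), of K]
      lipschitz_on_le[OF L2, of K] by (auto simp: K_def)
  have K0: "K > 0" using L1 by (simp add: K_def)
  define A where "A i m = mollified_pairing g (F i) (P i) m" for i m
  have "\<exists>m\<ge>i. \<bar>A i m - Jac_current g (F i) (P i)\<bar> < 1 / real (Suc i)" for i
  proof -
    have "\<forall>\<^sub>F m in sequentially. dist (A i m) (Jac_current g (F i) (P i)) < 1 / real (Suc i)"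
      unfolding A_def by (rule tendstoD[OF mollified_pairing_tendsto]) (use F P in auto)
    then obtain N where "\<And>m. m \<ge> N \<Longrightarrow> \<bar>A i m - Jac_current g (F i) (P i)\<bar> < 1 / real (Suc i)"
      by (auto simp: eventually_sequentially dist_real_def)
    then show ?thesis by (intro exI[of _ "max i N"]) auto
  qed
  then obtain \<mu> where \<mu>: "\<And>i. \<mu> i \<ge> i" "\<And>i. \<bar>A i (\<mu> i) - Jac_current g (F i) (P i)\<bar> < 1 / real (Suc i)"
    by metis
  have \<mu>_lim: "filterlim \<mu> sequentially sequentially"
    using \<mu>(1) filterlim_ident
    by (rule filterlim_at_top_mono[rotated, OF always_eventually[OF allI]])
  have 1: "(\<lambda>i. Jac_current g (F i) (P i) - A i (\<mu> i)) \<longlonglongrightarrow> 0"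
    by (rule Lim_null_comparison[OF _ LIMSEQ_Suc[OF lim_1_over_n]])
       (use \<mu>(2) in \<open>auto simp: abs_minus_commute intro!: always_eventually less_imp_le\<close>)
  have 2: "(\<lambda>i. A i (\<mu> i) - mollified_pairing g f (P i) (\<mu> i)) \<longlonglongrightarrow> 0"
  proof (rule LIMSEQ_I)
    fix e :: real assume e: "e > 0"
    define C where "C = fact CARD('n) * K ^ CARD('n) * (LINT x|lebesgue. \<bar>g x\<bar>)"
    have C: "C \<ge> 0" using K0 by (auto simp: C_def intro!: mult_nonneg_nonneg)
    define d where "d = e / (2 * (C + 1))"
    have "e * (C / (2 * (C + 1))) < e * 1" using e C by (intro mult_strict_left_mono) auto
    then have d: "d > 0" "d * C < e" using e C by (auto simp: d_def)
    have "\<forall>\<^sub>F i in sequentially. \<forall>x\<in>cball 0 R. \<bar>F i x - f x\<bar> \<le> d"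
      by (rule equi_lipschitz_uniform_on_compact[OF K(1) K(4) lim(1) compact_cball d(1)])
    then obtain N where N: "\<And>i x. i \<ge> N \<Longrightarrow> norm x \<le> R \<Longrightarrow> \<bar>F i x - f x\<bar> \<le> d"
      unfolding eventually_sequentially Ball_def mem_cball_0 by blast
    show "\<exists>N. \<forall>i\<ge>N. norm (A i (\<mu> i) - mollified_pairing g f (P i) (\<mu> i) - 0) < e"
    proof (intro exI[of _ N] allI impI)
      fix i assume "i \<ge> N"
      then have "\<bar>mollified_pairing g (F i) (P i) (\<mu> i) - mollified_pairing g f (P i) (\<mu> i)\<bar> \<le> d * C"
        unfolding C_def by (intro mollified_pairing_function_close F K N) (use d in auto)
      then show "norm (A i (\<mu> i) - mollified_pairing g f (P i) (\<mu> i) - 0) < e" using d by (simp add: A_def)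
    qed
  qed
  have 3: "(\<lambda>i. mollified_pairing g f (P i) (\<mu> i) - mollified_pairing g f \<pi> (\<mu> i)) \<longlonglongrightarrow> 0"
  proof (rule LIMSEQ_I)
    fix e :: real assume e: "e > 0"
    obtain d where d: "d > 0" "\<forall>\<pi> \<sigma> m m'. (\<forall>b. K-lipschitz_on UNIV (\<pi> b)) \<and> (\<forall>b. K-lipschitz_on UNIV (\<sigma> b)) \<and>
      (\<forall>b x. norm x \<le> R + 1 \<longrightarrow>
        \<bar>mollify (1 / real (Suc m)) (\<pi> b) x - mollify (1 / real (Suc m')) (\<sigma> b) x\<bar> \<le> d)
      \<longrightarrow> \<bar>mollified_pairing g f \<pi> m - mollified_pairing g f \<sigma> m'\<bar> \<le> e / 2"
      using mollified_pairing_close[OF F(2) half_gt_zero[OF e], of K] by blast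
    have "\<forall>\<^sub>F i in sequentially. \<forall>x\<in>cball 0 (R + 2). \<bar>P i j x - \<pi> j x\<bar> \<le> d" for j
      by (rule equi_lipschitz_uniform_on_compact[OF K(2) K(3) lim(2) compact_cball d(1)])
    then have "\<forall>\<^sub>F i in sequentially. \<forall>j\<in>UNIV. \<forall>x\<in>cball 0 (R + 2). \<bar>P i j x - \<pi> j x\<bar> \<le> d"
      by (intro eventually_ball_finite) auto
    then obtain N where N: "\<And>i j x. i \<ge> N \<Longrightarrow> norm x \<le> R + 2 \<Longrightarrow> \<bar>P i j x - \<pi> j x\<bar> \<le> d"
      unfolding eventually_sequentially Ball_def mem_cball_0 by blast
    show "\<exists>N. \<forall>i\<ge>N. norm (mollified_pairing g f (P i) (\<mu> i) - mollified_pairing g f \<pi> (\<mu> i) - 0) < e"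
    proof (intro exI[of _ N] allI impI)
      fix i assume i: "i \<ge> N"
      have "\<bar>mollified_pairing g f (P i) (\<mu> i) - mollified_pairing g f \<pi> (\<mu> i)\<bar> \<le> e / 2"
      proof (rule d(2)[rule_format], intro conjI allI impI K)
        fix j and x :: "real ^ 'n" assume x: "norm x \<le> R + 1"
        show "\<bar>mollify (1 / real (Suc (\<mu> i))) (P i j) x - mollify (1 / real (Suc (\<mu> i))) (\<pi> j) x\<bar> \<le> d"
        proof (rule mollify_diff_le)
          fix y :: "real ^ 'n" assume "norm y \<le> 1 / real (Suc (\<mu> i))"
          also have "\<dots> \<le> 1" by simp
          finally have "norm (x - y) \<le> R + 2" using x norm_triangle_ineq4[of x y] by linarith
          then show "\<bar>P i j (x - y) - \<pi> j (x - y)\<bar> \<le> d" by (rule N[OF i])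
        qed (use Lip_continuous P in auto)
      qed
      then show "norm (mollified_pairing g f (P i) (\<mu> i) - mollified_pairing g f \<pi> (\<mu> i) - 0) < e" using e by simp
    qed
  qed
  have 4: "(\<lambda>i. mollified_pairing g f \<pi> (\<mu> i)) \<longlonglongrightarrow> Jac_current g f \<pi>"
    by (rule filterlim_compose[OF mollified_pairing_tendsto[OF F(2) P(2)] \<mu>_lim])
  from tendsto_add[OF tendsto_add[OF tendsto_add[OF 1 2] 3] 4] show ?thesis by simp
qed

lemma metric_current_Jac_current: "metric_current (Jac_current g)"
  unfolding metric_current_def
proof (intro conjI ballI allI impI)
  fix F :: "nat \<Rightarrow> real ^ 'n \<Rightarrow> real" and f and P :: "nat \<Rightarrow> 'n \<Rightarrow> real ^ 'n \<Rightarrow> real" and \<pi> L K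
  assume "(\<forall>i. F i \<in> Lip_c) \<and> f \<in> Lip_c \<and> (\<forall>i j. P i j \<in> Lip) \<and> (\<forall>j. \<pi> j \<in> Lip) \<and>
       (\<forall>x. (\<lambda>i. F i x) \<longlonglongrightarrow> f x) \<and> (\<forall>j x. (\<lambda>i. P i j x) \<longlonglongrightarrow> \<pi> j x) \<and>
       (\<forall>i. L-lipschitz_on UNIV (F i)) \<and> (\<forall>i j. L-lipschitz_on UNIV (P i j)) \<and>
       compact K \<and> (\<forall>i. spt (F i) \<subseteq> K) \<and> spt f \<subseteq> K"
  then show "(\<lambda>i. Jac_current g (F i) (P i)) \<longlonglongrightarrow> Jac_current g f \<pi>"
    by (intro Jac_current_continuous[of F f P \<pi> L]) auto
qed (auto intro: Jac_current_lin_function Jac_current_lin_map Jac_current_local)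

end

lemma Jac_current_zero:
  assumes "\<And>x. g x * f x = 0"
  shows "Jac_current g f \<pi> = 0"
proof -
  have "mollified_pairing g f \<pi> = (\<lambda>m. 0)"
    unfolding mollified_pairing_def[abs_def] assms by simp
  then show ?thesis by (simp add: Jac_current_def limI)
qed

text \<open>Mollification fixes the coordinate functions, and their Jacobian matrix is the
  identity.\<close>

lemma Jac_current_coordinates:
  fixes g :: "real ^ 'n::finite \<Rightarrow> real"
  shows "Jac_current g f (\<lambda>j x. x $ j) = (LINT x|lebesgue. g x * f x)"
proof -
  have "mollify (1 / real (Suc m)) (\<lambda>x :: real ^ 'n. x $ b) = (\<lambda>x. x $ b)" for m b
    using mollify_component[of "1 / real (Suc m)" b] by auto
  moreover have "Jac (\<lambda>b x :: real ^ 'n. x $ b) x = 1" for x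
  proof -
    have "(\<chi> b. axis b 1) = (mat 1 :: real ^ 'n ^ 'n)" by (auto simp: vec_eq_iff mat_def axis_def)
    then show ?thesis by (simp add: Jac_def gradient_component)
  qed
  ultimately have "mollified_pairing g f (\<lambda>j x. x $ j) = (\<lambda>m. LINT x|lebesgue. g x * f x)"
    unfolding mollified_pairing_def by auto
  then show ?thesis by (simp add: Jac_current_def limI)
qed

section \<open>Series of currents and the nonregularity hypothesis\<close>

text \<open>A bound of each summand in terms of a common Lipschitz constant and of the values on a
  bounded set is uniform along a convergent sequence of arguments, so the limit may be taken term by
  term.\<close>

lemma metric_current_suminf:
  fixes T :: "nat \<Rightarrow> ('a::metric_space \<Rightarrow> real) \<Rightarrow> ('k::finite \<Rightarrow> 'a \<Rightarrow> real) \<Rightarrow> real"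
  assumes T: "\<And>k. metric_current (T k)" and s: "summable s"
    and bound: "\<And>k f \<pi> L. \<lbrakk>f \<in> Lip_c; L > 0; L-lipschitz_on UNIV f; \<And>j. L-lipschitz_on UNIV (\<pi> j);
       \<And>x. x \<in> Q \<Longrightarrow> \<bar>f x\<bar> \<le> L\<rbrakk> \<Longrightarrow> \<bar>T k f \<pi>\<bar> \<le> s k * L ^ Suc CARD('k)"
    and Q: "bounded Q"
  shows "metric_current (\<lambda>f \<pi>. \<Sum>k. T k f \<pi>)"
proof -
  \<comment> \<open>one constant controls a convergent sequence of arguments\<close>
  have common: "\<exists>M>0. (\<forall>i. M-lipschitz_on UNIV (F i)) \<and> (\<forall>i j. M-lipschitz_on UNIV (P i j)) \<and> (\<forall>i. \<forall>x\<in>Q. \<bar>F i x\<bar> \<le> M)"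
    if F: "\<And>x. convergent (\<lambda>i. F i x)" "\<And>i. L-lipschitz_on UNIV (F i)" and P: "\<And>i j. L-lipschitz_on UNIV (P i j)"
    for F :: "nat \<Rightarrow> 'a \<Rightarrow> real" and P :: "nat \<Rightarrow> 'k \<Rightarrow> 'a \<Rightarrow> real" and L
  proof -
    have L0: "L \<ge> 0" using F(2) lipschitz_on_nonneg by blast
    obtain x0 :: 'a where True by blast
    obtain B where B: "\<And>x. x \<in> Q \<Longrightarrow> dist x0 x \<le> B" using Q bounded_any_center[of Q x0] by blast
    obtain A where A: "\<And>i. \<bar>F i x0\<bar> \<le> A"
      using convergent_imp_Bseq[OF F(1)[of x0]] by (auto simp: Bseq_def)
    define M where "M = max (L + 1) (A + L * \<bar>B\<bar>)"
    have "\<bar>F i x\<bar> \<le> M" if "x \<in> Q" for i x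
    proof -
      have "\<bar>F i x0 - F i x\<bar> \<le> L * dist x0 x" using lipschitz_onD[OF F(2), of x0 x i] by (simp add: dist_real_def)
      also have "\<dots> \<le> L * \<bar>B\<bar>" using B[OF that] L0 by (intro mult_left_mono) auto
      finally show ?thesis using A[of i] by (simp add: M_def)
    qed
    moreover have "L \<le> M" "M > 0" using L0 by (auto simp: M_def)
    ultimately show ?thesis using F(2) P lipschitz_on_le by blast
  qed
  have summ: "summable (\<lambda>k. T k f \<pi>)" if f: "f \<in> Lip_c" and \<pi>: "\<And>j. \<pi> j \<in> Lip" for f \<pi>
  proof -
    obtain L where L: "L-lipschitz_on UNIV f" using f by (auto simp: Lip_c_def Lip_def Lipschitz_fun_on_def)
    obtain N where N: "\<And>j. N-lipschitz_on UNIV (\<pi> j)" using Lip_family_bound[of \<pi>, OF \<pi>] by blast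
    have "(max L N)-lipschitz_on UNIV f" "\<And>j. (max L N)-lipschitz_on UNIV (\<pi> j)"
      using lipschitz_on_le[OF L, of "max L N"] lipschitz_on_le[OF N, of "max L N"] by auto
    then obtain M where M: "M > 0" "M-lipschitz_on UNIV f" "\<And>j. M-lipschitz_on UNIV (\<pi> j)" "\<And>x. x \<in> Q \<Longrightarrow> \<bar>f x\<bar> \<le> M"
      using common[of "\<lambda>_. f" "max L N" "\<lambda>_. \<pi>"] convergent_const by blast
    show ?thesis
      by (rule summable_comparison_test'[of "\<lambda>k. s k * M ^ Suc CARD('k)" 0])
         (use bound[OF f M] s in \<open>auto intro: summable_mult2 simp del: power_Suc\<close>)
  qed
  show ?thesis
    unfolding metric_current_def
  proof (intro conjI ballI allI impI)
    fix f g :: "'a \<Rightarrow> real" and \<pi> :: "'k \<Rightarrow> 'a \<Rightarrow> real" and a b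
    assume f: "f \<in> Lip_c" and g: "g \<in> Lip_c" and \<pi>: "\<forall>j. \<pi> j \<in> Lip"
    have "(\<Sum>k. T k (\<lambda>x. a * f x + b * g x) \<pi>) = (\<Sum>k. a * T k f \<pi> + b * T k g \<pi>)"
      using metric_current_lincomb[OF T, of \<pi>] f g \<pi> by simp
    also have "\<dots> = a * (\<Sum>k. T k f \<pi>) + b * (\<Sum>k. T k g \<pi>)"
      using summ[OF f] summ[OF g] \<pi>
      by (subst suminf_add[symmetric]) (auto intro: summable_mult simp: suminf_mult)
    finally show "(\<Sum>k. T k (\<lambda>x. a * f x + b * g x) \<pi>) = a * (\<Sum>k. T k f \<pi>) + b * (\<Sum>k. T k g \<pi>)" .
  next
    fix f :: "'a \<Rightarrow> real" and \<pi> :: "'k \<Rightarrow> 'a \<Rightarrow> real" and j and \<sigma> \<tau> :: "'a \<Rightarrow> real" and a b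
    assume f: "f \<in> Lip_c" and \<sigma>: "\<sigma> \<in> Lip" and \<tau>: "\<tau> \<in> Lip" and \<pi>: "\<forall>j. \<pi> j \<in> Lip"
    have "T k f (\<pi>(j := (\<lambda>x. a * \<sigma> x + b * \<tau> x))) = a * T k f (\<pi>(j := \<sigma>)) + b * T k f (\<pi>(j := \<tau>))" for k
      using T[of k] f \<sigma> \<tau> \<pi> unfolding metric_current_def by (elim conjE) blast
    then have "(\<Sum>k. T k f (\<pi>(j := (\<lambda>x. a * \<sigma> x + b * \<tau> x)))) = (\<Sum>k. a * T k f (\<pi>(j := \<sigma>)) + b * T k f (\<pi>(j := \<tau>)))"
      by simp
    also have "\<dots> = a * (\<Sum>k. T k f (\<pi>(j := \<sigma>))) + b * (\<Sum>k. T k f (\<pi>(j := \<tau>)))"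
      using summ[OF f, of "\<pi>(j := \<sigma>)"] summ[OF f, of "\<pi>(j := \<tau>)"] \<sigma> \<tau> \<pi>
      by (subst suminf_add[symmetric]) (auto intro: summable_mult simp: suminf_mult)
    finally show "(\<Sum>k. T k f (\<pi>(j := (\<lambda>x. a * \<sigma> x + b * \<tau> x)))) =
      a * (\<Sum>k. T k f (\<pi>(j := \<sigma>))) + b * (\<Sum>k. T k f (\<pi>(j := \<tau>)))" .
  next
    fix f :: "'a \<Rightarrow> real" and \<pi> :: "'k \<Rightarrow> 'a \<Rightarrow> real"
    assume f: "f \<in> Lip_c" and *: "(\<forall>j. \<pi> j \<in> Lip) \<and> (\<exists>j U c. open U \<and> spt f \<subseteq> U \<and> (\<forall>x\<in>U. \<pi> j x = c))"
    have "T k f \<pi> = 0" for k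
      using T[of k] f * unfolding metric_current_def by (elim conjE) blast
    then show "(\<Sum>k. T k f \<pi>) = 0" by simp
  next
    fix F :: "nat \<Rightarrow> 'a \<Rightarrow> real" and f :: "'a \<Rightarrow> real" and P :: "nat \<Rightarrow> 'k \<Rightarrow> 'a \<Rightarrow> real" and \<pi> L K
    assume *: "(\<forall>i. F i \<in> Lip_c) \<and> f \<in> Lip_c \<and> (\<forall>i j. P i j \<in> Lip) \<and> (\<forall>j. \<pi> j \<in> Lip) \<and>
       (\<forall>x. (\<lambda>i. F i x) \<longlonglongrightarrow> f x) \<and> (\<forall>j x. (\<lambda>i. P i j x) \<longlonglongrightarrow> \<pi> j x) \<and>
       (\<forall>i. L-lipschitz_on UNIV (F i)) \<and> (\<forall>i j. L-lipschitz_on UNIV (P i j)) \<and>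
       compact K \<and> (\<forall>i. spt (F i) \<subseteq> K) \<and> spt f \<subseteq> K"
    have lim: "(\<lambda>i. T k (F i) (P i)) \<longlonglongrightarrow> T k f \<pi>" for k
    proof -
      have "\<forall>F f P \<pi> L K.
       (\<forall>i. F i \<in> Lip_c) \<and> f \<in> Lip_c \<and> (\<forall>i j. P i j \<in> Lip) \<and> (\<forall>j. \<pi> j \<in> Lip) \<and>
       (\<forall>x. (\<lambda>i. F i x) \<longlonglongrightarrow> f x) \<and> (\<forall>j x. (\<lambda>i. P i j x) \<longlonglongrightarrow> \<pi> j x) \<and>
       (\<forall>i. L-lipschitz_on UNIV (F i)) \<and> (\<forall>i j. L-lipschitz_on UNIV (P i j)) \<and>
       compact K \<and> (\<forall>i. spt (F i) \<subseteq> K) \<and> spt f \<subseteq> K \<longrightarrow>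
       (\<lambda>i. T k (F i) (P i)) \<longlonglongrightarrow> T k f \<pi>"
        using T[of k] unfolding metric_current_def by (elim conjE)
      from this[rule_format, OF *] show ?thesis .
    qed
    have "convergent (\<lambda>i. F i x)" for x using * by (auto simp: convergent_def)
    moreover have "L-lipschitz_on UNIV (F i)" "L-lipschitz_on UNIV (P i j)" for i j using * by auto
    ultimately obtain M where M: "M > 0" "\<And>i. M-lipschitz_on UNIV (F i)" "\<And>i j. M-lipschitz_on UNIV (P i j)"
      "\<And>i x. x \<in> Q \<Longrightarrow> \<bar>F i x\<bar> \<le> M"
      using common[of F L P] by metis
    have b: "norm (T k (F i) (P i)) \<le> s k * M ^ Suc CARD('k)" for k i
      using bound[of "F i" M "P i" k] M * by auto
    show "(\<lambda>i. \<Sum>k. T k (F i) (P i)) \<longlonglongrightarrow> (\<Sum>k. T k f \<pi>)"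
      using tannerys_theorem[of "\<lambda>k i. T k (F i) (P i)" "\<lambda>k. T k f \<pi>" sequentially "\<lambda>k. s k * M ^ Suc CARD('k)",
        OF lim] b s by (auto intro!: summable_mult2 always_eventually simp del: power_Suc)
  qed
qed

lemma Lip_const_nonneg: "Lipschitz_fun_on S f \<Longrightarrow> Lip_const S f \<ge> 0"
  unfolding Lip_const_def Lipschitz_fun_on_def by (rule cInf_greatest) (auto intro: lipschitz_on_nonneg)

lemma Lip_const_le: "L-lipschitz_on S f \<Longrightarrow> Lip_const S f \<le> L"
  unfolding Lip_const_def by (rule cInf_lower) (auto intro!: bdd_belowI[of _ 0] lipschitz_on_nonneg)

lemma unit_cube_norm_le: "x \<in> unit_cube \<Longrightarrow> norm (x :: real ^ 'n::finite) \<le> real CARD('n)"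
proof -
  assume x: "x \<in> unit_cube"
  have "norm x \<le> (\<Sum>i\<in>UNIV. \<bar>x $ i\<bar>)" by (rule norm_le_l1_cart)
  also have "\<dots> \<le> (\<Sum>i\<in>(UNIV::'n set). 1)"
    by (rule sum_mono) (use x in \<open>auto simp: mem_box_cart\<close>)
  finally show ?thesis by simp
qed

text \<open>Derivatives within the cube are unique even at its boundary points, so the agreement
  holds everywhere on the cube.\<close>

lemma det_jacobian_unit_cube:
  fixes \<pi> :: "'n::finite \<Rightarrow> real ^ 'n \<Rightarrow> real"
  assumes "\<And>b. C2 (\<pi> b)" "x \<in> unit_cube"
  shows "det (jacobian (\<lambda>x. \<chi> b. \<pi> b x) (at x within unit_cube)) = Jac \<pi> x"
proof -
  have D: "((\<lambda>x. \<chi> b. \<pi> b x) has_derivative (\<lambda>v. \<chi> b. gradient (\<pi> b) x \<bullet> v)) (at x within unit_cube)"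
    unfolding has_derivative_componentwise_within[of "\<lambda>x. \<chi> b. \<pi> b x"]
    by (auto simp: Basis_vec_def inner_axis
        intro!: has_derivative_at_withinI has_derivative_gradient C2D(1) assms)
  then have "((\<lambda>x. \<chi> b. \<pi> b x) has_derivative frechet_derivative (\<lambda>x. \<chi> b. \<pi> b x) (at x within unit_cube)) (at x within unit_cube)"
    using differentiableI frechet_derivative_works by blast
  then have "frechet_derivative (\<lambda>x. \<chi> b. \<pi> b x) (at x within unit_cube) = (\<lambda>v. \<chi> b. gradient (\<pi> b) x \<bullet> v)"
    by (rule frechet_derivative_unique_within_closed_interval[rotated 2, OF _ D])
       (use assms(2) in \<open>auto simp: Basis_vec_def inner_axis\<close>)
  then have "jacobian (\<lambda>x. \<chi> b. \<pi> b x) (at x within unit_cube) = (\<chi> b. gradient (\<pi> b) x)"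
    by (simp add: jacobian_def matrix_def vec_eq_iff inner_axis)
  then show ?thesis by (simp add: Jac_def)
qed

text \<open>Nonregularity restated for a single constant \<open>L\<close> that bounds
  \<open>f\<close> and all the Lipschitz constants. It follows by homogeneity: dividing
  \<open>f\<close> by \<open>L ^ Suc CARD('n)\<close> makes the pair admissible in the
  supremum.\<close>

lemma strong_Lipschitz_nonregularity_normalised:
  assumes "strong_Lipschitz_nonregularity (unit_cube :: (real ^ 'n::finite) set)"
  shows "\<exists>w :: nat \<Rightarrow> real ^ 'n \<Rightarrow> real. \<forall>n\<ge>1.
    integrable lebesgue (w n) \<and> (\<forall>x. x \<notin> unit_cube \<longrightarrow> w n x = 0) \<and> (LINT x|lebesgue. \<bar>w n x\<bar>) = 1 \<and>
    (\<forall>f \<pi> L. L > 0 \<and> L-lipschitz_on UNIV f \<and> (\<forall>x\<in>unit_cube. \<bar>f x\<bar> \<le> L) \<and>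
        (\<forall>b. C2 (\<pi> b)) \<and> (\<forall>b. L-lipschitz_on UNIV (\<pi> b))
      \<longrightarrow> \<bar>LINT x|lebesgue. w n x * f x * Jac \<pi> x\<bar> \<le> L ^ Suc CARD('n) / real n)"
proof -
  let ?Q = "unit_cube :: (real ^ 'n) set"
  have "\<exists>u :: nat \<Rightarrow> real ^ 'n \<Rightarrow> real. \<forall>n\<ge>1.
       set_integrable lebesgue ?Q (u n) \<and>
       (LINT x:?Q|lebesgue. \<bar>u n x\<bar>) \<ge> 1 \<and>
       Sup {ereal \<bar>LINT x:?Q|lebesgue. u n x * f x * det (jacobian \<pi> (at x within ?Q))\<bar>
            | (f :: real ^ 'n \<Rightarrow> real) (\<pi> :: real ^ 'n \<Rightarrow> real ^ 'n).
              Lipschitz_fun_on ?Q f \<and> Lipschitz_fun_on ?Q \<pi> \<and>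
              max (Lip_const ?Q f) (SUP x\<in>?Q. \<bar>f x\<bar>)
                * (\<Prod>j\<in>UNIV. Lip_const ?Q (\<lambda>x. \<pi> x $ j)) \<le> 1}
         \<le> ereal (1 / real n)"
    using assms unfolding strong_Lipschitz_nonregularity_def .
  then obtain u :: "nat \<Rightarrow> real ^ 'n \<Rightarrow> real" where
    u: "\<And>n. n \<ge> 1 \<Longrightarrow> set_integrable lebesgue ?Q (u n)"
       "\<And>n. n \<ge> 1 \<Longrightarrow> (LINT x:?Q|lebesgue. \<bar>u n x\<bar>) \<ge> 1"
    and Sup: "\<And>n. n \<ge> 1 \<Longrightarrow>
       Sup {ereal \<bar>LINT x:?Q|lebesgue. u n x * f x * det (jacobian \<pi> (at x within ?Q))\<bar>
            | (f :: real ^ 'n \<Rightarrow> real) (\<pi> :: real ^ 'n \<Rightarrow> real ^ 'n).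
              Lipschitz_fun_on ?Q f \<and> Lipschitz_fun_on ?Q \<pi> \<and>
              max (Lip_const ?Q f) (SUP x\<in>?Q. \<bar>f x\<bar>)
                * (\<Prod>j\<in>UNIV. Lip_const ?Q (\<lambda>x. \<pi> x $ j)) \<le> 1}
         \<le> ereal (1 / real n)"
    by blast
  define N where "N n = (LINT x:?Q|lebesgue. \<bar>u n x\<bar>)" for n
  define w where "w n x = indicator ?Q x * u n x / N n" for n x
  have N: "N n \<ge> 1" if "n \<ge> 1" for n using u(2)[OF that] by (simp add: N_def)
  have admissible: "\<bar>LINT x:?Q|lebesgue. u n x * f x * det (jacobian \<pi> (at x within ?Q))\<bar> \<le> 1 / real n"
    if "n \<ge> 1" "Lipschitz_fun_on ?Q f" "Lipschitz_fun_on ?Q \<pi>"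
      "max (Lip_const ?Q f) (SUP x\<in>?Q. \<bar>f x\<bar>) * (\<Prod>j\<in>UNIV. Lip_const ?Q (\<lambda>x. \<pi> x $ j)) \<le> 1"
    for n f and \<pi> :: "real ^ 'n \<Rightarrow> real ^ 'n"
  proof -
    have "ereal \<bar>LINT x:?Q|lebesgue. u n x * f x * det (jacobian \<pi> (at x within ?Q))\<bar> \<le> ereal (1 / real n)"
      by (rule order_trans[OF Sup_upper Sup[OF that(1)]]) (use that(2-) in blast)
    then show ?thesis by simp
  qed
  show ?thesis
  proof (intro exI[of _ w] allI impI conjI)
    fix n :: nat assume n: "n \<ge> 1"
    show "integrable lebesgue (w n)"
      using u(1)[OF n] by (simp add: w_def[abs_def] set_integrable_def)
    show "w n x = 0" if "x \<notin> ?Q" for x using that by (simp add: w_def)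
    show "(LINT x|lebesgue. \<bar>w n x\<bar>) = 1"
    proof -
      have "(LINT x|lebesgue. \<bar>w n x\<bar>) = (LINT x|lebesgue. indicator ?Q x *\<^sub>R \<bar>u n x\<bar> / N n)"
        using N[OF n] by (intro Bochner_Integration.integral_cong) (auto simp: w_def abs_mult)
      also have "\<dots> = N n / N n" by (simp add: N_def set_lebesgue_integral_def)
      finally show ?thesis using N[OF n] by simp
    qed
    fix f :: "real ^ 'n \<Rightarrow> real" and \<pi> :: "'n \<Rightarrow> real ^ 'n \<Rightarrow> real" and L :: real
    assume "L > 0 \<and> L-lipschitz_on UNIV f \<and> (\<forall>x\<in>?Q. \<bar>f x\<bar> \<le> L) \<and>
        (\<forall>b. C2 (\<pi> b)) \<and> (\<forall>b. L-lipschitz_on UNIV (\<pi> b))"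
    then have L: "L > 0" and f: "L-lipschitz_on UNIV f" "\<And>x. x \<in> ?Q \<Longrightarrow> \<bar>f x\<bar> \<le> L"
      and \<pi>: "\<And>b. C2 (\<pi> b)" "\<And>b. L-lipschitz_on UNIV (\<pi> b)" by auto
    define c where "c = L ^ Suc CARD('n)"
    have c: "c > 0" using L by (simp add: c_def)
    define f1 where "f1 x = f x / c" for x
    define \<Psi> where "\<Psi> x = (\<chi> b. \<pi> b x)" for x
    have f1: "(L / c)-lipschitz_on ?Q f1"
      using lipschitz_on_cmult_real[OF lipschitz_on_subset[OF f(1)], of ?Q "1 / c"] c
      by (simp add: f1_def[abs_def] divide_inverse mult.commute)
    have sup: "(SUP x\<in>?Q. \<bar>f1 x\<bar>) \<le> L / c"
    proof (rule cSUP_least)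
      have "0 \<in> ?Q" by (simp add: mem_box_cart)
      then show "?Q \<noteq> {}" by blast
    qed (use f(2) c in \<open>auto simp: f1_def abs_divide divide_right_mono\<close>)
    have \<Psi>j: "L-lipschitz_on ?Q (\<lambda>x. \<Psi> x $ j)" for j
      using lipschitz_on_subset[OF \<pi>(2)] by (simp add: \<Psi>_def)
    have \<Psi>: "Lipschitz_fun_on ?Q \<Psi>"
      unfolding Lipschitz_fun_on_def
    proof (intro exI lipschitz_onI)
      fix x y assume xy: "x \<in> ?Q" "y \<in> ?Q"
      have "dist (\<Psi> x) (\<Psi> y) \<le> (\<Sum>j\<in>UNIV. \<bar>(\<Psi> x - \<Psi> y) $ j\<bar>)"
        unfolding dist_norm by (rule norm_le_l1_cart)
      also have "\<dots> \<le> (\<Sum>j\<in>(UNIV :: 'n set). L * dist x y)"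
        by (rule sum_mono) (use lipschitz_onD[OF \<Psi>j xy] in \<open>simp add: dist_real_def\<close>)
      finally show "dist (\<Psi> x) (\<Psi> y) \<le> (real CARD('n) * L) * dist x y" by simp
    qed (use L in simp)
    have "max (Lip_const ?Q f1) (SUP x\<in>?Q. \<bar>f1 x\<bar>) * (\<Prod>j\<in>UNIV. Lip_const ?Q (\<lambda>x. \<Psi> x $ j)) \<le>
        (L / c) * (\<Prod>j\<in>(UNIV :: 'n set). L)"
    proof (rule mult_mono)
      show "max (Lip_const ?Q f1) (SUP x\<in>?Q. \<bar>f1 x\<bar>) \<le> L / c" using Lip_const_le[OF f1] sup by simp
      show "(\<Prod>j\<in>UNIV. Lip_const ?Q (\<lambda>x. \<Psi> x $ j)) \<le> (\<Prod>j\<in>(UNIV :: 'n set). L)"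
        by (rule prod_mono) (use \<Psi>j Lip_const_le Lip_const_nonneg Lipschitz_fun_on_def in blast)
      show "0 \<le> (\<Prod>j\<in>UNIV. Lip_const ?Q (\<lambda>x. \<Psi> x $ j))"
        by (rule prod_nonneg) (use \<Psi>j Lip_const_nonneg Lipschitz_fun_on_def in blast)
    qed (use L c in simp)
    also have "\<dots> = 1" using L by (simp add: c_def)
    finally have "\<bar>LINT x:?Q|lebesgue. u n x * f1 x * det (jacobian \<Psi> (at x within ?Q))\<bar> \<le> 1 / real n"
      using f1 by (intro admissible[OF n _ \<Psi>]) (auto simp: Lipschitz_fun_on_def)
    also have "(LINT x:?Q|lebesgue. u n x * f1 x * det (jacobian \<Psi> (at x within ?Q))) =
        (LINT x|lebesgue. (N n / c) * (w n x * f x * Jac \<pi> x))"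
      unfolding set_lebesgue_integral_def
    proof (rule Bochner_Integration.integral_cong[OF refl])
      fix x :: "real ^ 'n"
      show "indicator ?Q x *\<^sub>R (u n x * f1 x * det (jacobian \<Psi> (at x within ?Q))) =
        (N n / c) * (w n x * f x * Jac \<pi> x)"
      proof (cases "x \<in> ?Q")
        case True
        then show ?thesis
          using det_jacobian_unit_cube[of \<pi>, OF \<pi>(1) True] N[OF n] c
          by (simp add: \<Psi>_def[abs_def] w_def f1_def)
      qed (simp add: w_def)
    qed
    finally have "(N n / c) * \<bar>LINT x|lebesgue. w n x * f x * Jac \<pi> x\<bar> \<le> 1 / real n"
      using N[OF n] c by (simp add: abs_mult)
    then have "N n * \<bar>LINT x|lebesgue. w n x * f x * Jac \<pi> x\<bar> \<le> c / real n"
      using c by (simp add: field_simps)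
    moreover have "\<bar>LINT x|lebesgue. w n x * f x * Jac \<pi> x\<bar> \<le> N n * \<bar>LINT x|lebesgue. w n x * f x * Jac \<pi> x\<bar>"
      using mult_right_mono[OF N[OF n], of "\<bar>LINT x|lebesgue. w n x * f x * Jac \<pi> x\<bar>"] by simp
    ultimately show "\<bar>LINT x|lebesgue. w n x * f x * Jac \<pi> x\<bar> \<le> L ^ Suc CARD('n) / real n"
      by (simp only: c_def)
  qed
qed

text \<open>Applied below with \<open>a n\<close> a power of the Lipschitz constant of the
  \<open>n\<close>-th norming test function: the weights \<open>4 ^ j\<close> then leave a factor
  \<open>(1 / 2) ^ j\<close> both in the convergence of the series and in the terms that follow a
  hump.\<close>

lemma fast_growing_subsequence:
  fixes a :: "nat \<Rightarrow> real"
  assumes a: "\<And>n. a n \<ge> 1"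
  obtains \<nu> :: "nat \<Rightarrow> nat" where "\<And>k. \<nu> k \<ge> 1" "\<And>k. 8 ^ k \<le> real (\<nu> k)"
    "\<And>k j. k < j \<Longrightarrow> 8 ^ j * a (\<nu> k) \<le> real (\<nu> j)"
proof -
  define step where "step k m = m + nat \<lceil>8 ^ Suc k * (\<Sum>i\<le>m. a i)\<rceil>" for k m
  define \<nu> where "\<nu> = rec_nat 1 step"
  have \<nu>: "\<nu> 0 = 1" "\<nu> (Suc k) = step k (\<nu> k)" for k by (simp_all add: \<nu>_def)
  have mono: "\<nu> k \<le> \<nu> j" if "k \<le> j" for k j
    using that by (rule lift_Suc_mono_le[rotated]) (simp add: \<nu> step_def)
  have grow: "8 ^ Suc j * a i \<le> real (\<nu> (Suc j))" if "i \<le> \<nu> j" for i j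
  proof -
    have "a i \<le> (\<Sum>i\<le>\<nu> j. a i)"
      by (rule member_le_sum) (use that a in \<open>auto intro: order_trans[of 0 1]\<close>)
    then have "8 ^ Suc j * a i \<le> 8 ^ Suc j * (\<Sum>i\<le>\<nu> j. a i)" by (intro mult_left_mono) auto
    also have "\<dots> \<le> real (nat \<lceil>8 ^ Suc j * (\<Sum>i\<le>\<nu> j. a i)\<rceil>)" by (rule real_nat_ceiling_ge)
    also have "\<dots> \<le> real (\<nu> (Suc j))" by (simp add: \<nu> step_def)
    finally show ?thesis .
  qed
  show ?thesis
  proof (rule that[of \<nu>])
    show "\<nu> k \<ge> 1" for k using mono[of 0 k] \<nu> by simp
    show "8 ^ j * a (\<nu> k) \<le> real (\<nu> j)" if "k < j" for k j
      using that grow[OF mono, of k "j - 1"] by (cases j) auto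
    show "8 ^ k \<le> real (\<nu> k)" for k
    proof (cases k)
      case (Suc j)
      have "8 ^ Suc j * 1 \<le> 8 ^ Suc j * a (\<nu> j)" using a by (intro mult_left_mono) auto
      also have "\<dots> \<le> real (\<nu> (Suc j))" by (rule grow) simp
      finally show ?thesis by (simp add: Suc)
    qed (simp add: \<nu>)
  qed
qed

text \<open>Approximating half the sign of \<open>g\<close> leaves room for an error while keeping
  \<open>\<phi>\<close> bounded by one; any constant below \<open>1 / 2\<close> could be reached,
  and \<open>2 / 5\<close> exceeds the \<open>1 / 3\<close> that the earlier terms of the series can
  consume.\<close>

lemma norming_test_function:
  fixes g :: "real ^ 'n::finite \<Rightarrow> real"
  assumes g: "integrable lebesgue g" and supp: "\<And>x. norm x > R \<Longrightarrow> g x = 0" and R: "R > 0"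
    and norm1: "(LINT x|lebesgue. \<bar>g x\<bar>) = 1"
  obtains \<phi> where "smooth_alg \<phi>" "\<And>x. norm x > R + 1 \<Longrightarrow> \<phi> x = 0" "\<And>x. \<bar>\<phi> x\<bar> \<le> 1"
    "(LINT x|lebesgue. g x * \<phi> x) \<ge> 2 / 5"
proof -
  have [measurable]: "g \<in> borel_measurable lebesgue" using g by simp
  define s where "s x = sgn (g x) / 2" for x
  have sm: "s \<in> borel_measurable lebesgue" unfolding s_def[abs_def] by measurable
  obtain h where h: "\<And>n. smooth_alg (h n)" "\<And>n x. norm x > R + 1 \<Longrightarrow> h n x = 0"
    "\<And>n x. \<bar>h n x\<bar> \<le> 1 / 2 + 1 / 2" "AE x in lebesgue. (\<lambda>n. h n x) \<longlonglongrightarrow> s x"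
    by (rule test_function_approx[OF sm, of "1 / 2" R "1 / 2"])
       (use supp R in \<open>auto simp: s_def abs_sgn_eq\<close>)
  have [measurable]: "h n \<in> borel_measurable lebesgue" for n
    using smooth_alg_integrable_lebesgue[OF h(1,2)] by auto
  have "(\<lambda>n. LINT x|lebesgue. g x * h n x) \<longlonglongrightarrow> (LINT x|lebesgue. g x * s x)"
  proof (rule integral_dominated_convergence[where w = "\<lambda>x. \<bar>g x\<bar>"])
    show "AE x in lebesgue. (\<lambda>n. g x * h n x) \<longlonglongrightarrow> g x * s x"
      using h(4) by eventually_elim (intro tendsto_intros)
    show "AE x in lebesgue. norm (g x * h n x) \<le> \<bar>g x\<bar>" for n
    proof (intro always_eventually allI)
      fix x
      show "norm (g x * h n x) \<le> \<bar>g x\<bar>"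
        using mult_left_mono[of "\<bar>h n x\<bar>" 1 "\<bar>g x\<bar>"] h(3)[of n x] by (simp add: abs_mult)
    qed
  qed (use g sm in auto)
  moreover have "(LINT x|lebesgue. g x * s x) = (LINT x|lebesgue. \<bar>g x\<bar> / 2)"
    by (rule Bochner_Integration.integral_cong) (auto simp: s_def abs_sgn)
  ultimately have "(\<lambda>n. LINT x|lebesgue. g x * h n x) \<longlonglongrightarrow> 1 / 2" using norm1 by simp
  then have "\<forall>\<^sub>F n in sequentially. (LINT x|lebesgue. g x * h n x) > 2 / 5"
    by (rule order_tendstoD) simp
  then obtain n where "(LINT x|lebesgue. g x * h n x) > 2 / 5" by (auto simp: eventually_sequentially)
  then show ?thesis using that[of "h n"] h by auto
qed

section \<open>The gliding hump\<close>

text \<open>The terms before \<open>k\<close> sum to less than \<open>4 ^ k / 3\<close>, those after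
  \<open>k\<close> to at most one, and \<open>2 / 5 - 1 / 3 = 1 / 15\<close>.\<close>

lemma suminf_gliding_hump_lower_bound:
  fixes t :: "nat \<Rightarrow> real"
  assumes all: "\<And>j. \<bar>t j\<bar> \<le> 4 ^ j" and hump: "t k \<ge> 2 / 5 * 4 ^ k"
    and tail: "\<And>j. j > k \<Longrightarrow> \<bar>t j\<bar> \<le> (1 / 2) ^ j"
  shows "(\<Sum>j. t j) \<ge> 4 ^ k / 15 - 1"
proof -
  have geo: "summable (\<lambda>j. (1 / 2 :: real) ^ (j + Suc k))"
    using summable_ignore_initial_segment[OF summable_geometric[of "1 / 2 :: real"], of "Suc k"] by simp
  have tb: "norm (t (j + Suc k)) \<le> (1 / 2) ^ (j + Suc k)" for j using tail[of "j + Suc k"] by simp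
  have sum_t: "summable t"
    using summable_comparison_test'[OF geo, of 0 "\<lambda>j. t (j + Suc k)"] tb summable_iff_shift[of t "Suc k"] by blast
  have "\<bar>\<Sum>j. t (j + Suc k)\<bar> \<le> (\<Sum>j. (1 / 2) ^ (j + Suc k))"
    using tb by (intro norm_suminf_le[where 'a = real, unfolded real_norm_def] geo) auto
  also have "\<dots> = (\<Sum>j. (1 / 2) ^ j) * (1 / 2) ^ Suc k"
    unfolding power_add by (rule suminf_mult2[symmetric]) (simp add: summable_geometric)
  also have "\<dots> = (1 / 2) ^ k" by (simp add: suminf_geometric)
  also have "\<dots> \<le> 1" by (simp add: power_le_one)
  finally have tail_le: "\<bar>\<Sum>j. t (j + Suc k)\<bar> \<le> 1" .
  have "\<bar>\<Sum>j<k. t j\<bar> \<le> (\<Sum>j<k. 4 ^ j)"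
    by (rule order_trans[OF sum_abs]) (rule sum_mono, rule all)
  also have "\<dots> = (4 ^ k - 1) / 3" by (induction k) (auto simp: field_simps)
  finally have head_le: "\<bar>\<Sum>j<k. t j\<bar> \<le> (4 ^ k - 1) / 3" .
  have "(\<Sum>j. t j) = (\<Sum>j. t (j + Suc k)) + ((\<Sum>j<k. t j) + t k)"
    using suminf_split_initial_segment[OF sum_t, of "Suc k"] by simp
  then show ?thesis using tail_le head_le hump by (simp add: field_simps)
qed

theorem theorem1p6:
  assumes "strong_Lipschitz_nonregularity (unit_cube :: (real ^ 'n::finite) set)"
  shows "\<exists>T :: (real ^ 'n \<Rightarrow> real) \<Rightarrow> ('n \<Rightarrow> real ^ 'n \<Rightarrow> real) \<Rightarrow> real.
    metric_current T \<and> current_support T \<subseteq> unit_cube \<and>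
    \<not> (\<exists>u. set_integrable lebesgue unit_cube u \<and>
         (\<forall>\<phi>\<in>test_functions.
            T \<phi> (\<lambda>j x. x $ j) = (LINT x:unit_cube|lebesgue. u x * \<phi> x)))"
proof -
  let ?Q = "unit_cube :: (real ^ 'n) set"
  define R where "R = real CARD('n)"
  have R: "R > 0" by (simp add: R_def)
  obtain w :: "nat \<Rightarrow> real ^ 'n \<Rightarrow> real" where w: "\<forall>n\<ge>1.
    integrable lebesgue (w n) \<and> (\<forall>x. x \<notin> ?Q \<longrightarrow> w n x = 0) \<and> (LINT x|lebesgue. \<bar>w n x\<bar>) = 1 \<and>
    (\<forall>f \<pi> L. L > 0 \<and> L-lipschitz_on UNIV f \<and> (\<forall>x\<in>?Q. \<bar>f x\<bar> \<le> L) \<and>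
        (\<forall>b. C2 (\<pi> b)) \<and> (\<forall>b. L-lipschitz_on UNIV (\<pi> b))
      \<longrightarrow> \<bar>LINT x|lebesgue. w n x * f x * Jac \<pi> x\<bar> \<le> L ^ Suc CARD('n) / real n)"
    using strong_Lipschitz_nonregularity_normalised[OF assms] by (elim exE)
  have w_int: "integrable lebesgue (w n)" and w_out: "x \<notin> ?Q \<Longrightarrow> w n x = 0"
    and w_norm: "(LINT x|lebesgue. \<bar>w n x\<bar>) = 1" if "n \<ge> 1" for n x
    using w that by blast+
  have w_weak: "\<bar>LINT x|lebesgue. w n x * f x * Jac \<pi> x\<bar> \<le> L ^ Suc CARD('n) / real n"
    if "n \<ge> 1" "L > 0" "L-lipschitz_on UNIV f" "\<And>x. x \<in> ?Q \<Longrightarrow> \<bar>f x\<bar> \<le> L"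
      "\<And>b. C2 (\<pi> b)" "\<And>b. L-lipschitz_on UNIV (\<pi> b)" for n f \<pi> L
    using w that by blast
  have w_supp: "w n x = 0" if "n \<ge> 1" "norm x > R" for n x
    using w_out[OF that(1)] unit_cube_norm_le[of x] that(2) by (fastforce simp: R_def)
  have "\<exists>\<phi>. smooth_alg \<phi> \<and> (\<forall>x. norm x > R + 1 \<longrightarrow> \<phi> x = 0) \<and> (\<forall>x. \<bar>\<phi> x\<bar> \<le> 1) \<and>
      (n \<ge> 1 \<longrightarrow> (LINT x|lebesgue. w n x * \<phi> x) \<ge> 2 / 5)" for n
  proof (cases "n \<ge> 1")
    case True
    show ?thesis
      using norming_test_function[OF w_int[OF True] w_supp[OF True] R w_norm[OF True]] by metis
  next
    case False
    then show ?thesis by (intro exI[of _ "\<lambda>_. 0"]) (auto intro: smooth_alg.const)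
  qed
  then obtain \<phi> where \<phi>: "\<And>n. smooth_alg (\<phi> n)" "\<And>n x. norm x > R + 1 \<Longrightarrow> \<phi> n x = 0" "\<And>n x. \<bar>\<phi> n x\<bar> \<le> 1"
    and \<phi>_norming: "\<And>n. n \<ge> 1 \<Longrightarrow> (LINT x|lebesgue. w n x * \<phi> n x) \<ge> 2 / 5"
    by metis
  have "\<exists>A\<ge>1. A-lipschitz_on UNIV (\<phi> n)" for n
  proof -
    obtain L where "L-lipschitz_on UNIV (\<phi> n)"
      using C1_zero_outside_lipschitz[OF smooth_alg_differentiable(1)[OF \<phi>(1)] smooth_alg_continuous_gradient[OF \<phi>(1)] \<phi>(2)]
      by metis
    then show ?thesis by (intro exI[of _ "max 1 L"]) (auto intro: lipschitz_on_le)
  qed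
  then obtain A where A: "\<And>n. A n \<ge> 1" "\<And>n. (A n)-lipschitz_on UNIV (\<phi> n)" by metis
  have \<phi>_Lip_c: "\<phi> n \<in> Lip_c" for n
    using A(2) compact_spt[of "R + 1" "\<phi> n"] \<phi>(2) by (auto simp: Lip_c_def intro: Lip_I)
  have \<phi>_test: "\<phi> n \<in> test_functions" for n
    using smooth_alg_C_k[OF \<phi>(1)] compact_spt[of "R + 1" "\<phi> n"] \<phi>(2) by (auto simp: test_functions_def)
  obtain \<nu> :: "nat \<Rightarrow> nat" where \<nu>: "\<And>k. \<nu> k \<ge> 1" "\<And>k. 8 ^ k \<le> real (\<nu> k)"
    "\<And>k j. k < j \<Longrightarrow> 8 ^ j * A (\<nu> k) ^ Suc CARD('n) \<le> real (\<nu> j)"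
    using fast_growing_subsequence[of "\<lambda>n. A n ^ Suc CARD('n)"] A(1) one_le_power by metis
  \<comment> \<open>The weights grow geometrically so that each term of the series dominates the sum
    of all earlier ones.\<close>
  define v where "v k x = 4 ^ k * w (\<nu> k) x" for k x
  have v_int: "integrable lebesgue (v k)" for k
    using w_int[OF \<nu>(1)] by (simp add: v_def[abs_def])
  have v_supp: "v k x = 0" if "norm x > R" for k x using w_supp[OF \<nu>(1) that] by (simp add: v_def)
  have v_out: "v k x = 0" if "x \<notin> ?Q" for k x using w_out[OF \<nu>(1) that] by (simp add: v_def)
  define T where "T f \<pi> = (\<Sum>k. Jac_current (v k) f \<pi>)" for f and \<pi> :: "'n \<Rightarrow> real ^ 'n \<Rightarrow> real"
  have weak: "\<bar>Jac_current (v k) f \<pi>\<bar> \<le> 4 ^ k * (L ^ Suc CARD('n) / real (\<nu> k))"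
    if "f \<in> Lip_c" "L > 0" "L-lipschitz_on UNIV f" "\<And>j. L-lipschitz_on UNIV (\<pi> j)" "\<And>x. x \<in> ?Q \<Longrightarrow> \<bar>f x\<bar> \<le> L"
    for k f \<pi> L
  proof (rule Jac_current_bound[OF v_int v_supp R that(1,4)])
    fix \<sigma> :: "'n \<Rightarrow> real ^ 'n \<Rightarrow> real"
    assume \<sigma>: "\<And>b. C2 (\<sigma> b)" "\<And>b. L-lipschitz_on UNIV (\<sigma> b)"
    have "(LINT x|lebesgue. v k x * f x * Jac \<sigma> x) = (LINT x|lebesgue. 4 ^ k * (w (\<nu> k) x * f x * Jac \<sigma> x))"
      by (simp add: v_def mult.assoc)
    then have "\<bar>LINT x|lebesgue. v k x * f x * Jac \<sigma> x\<bar> = 4 ^ k * \<bar>LINT x|lebesgue. w (\<nu> k) x * f x * Jac \<sigma> x\<bar>"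
      by (simp add: abs_mult)
    also have "\<dots> \<le> 4 ^ k * (L ^ Suc CARD('n) / real (\<nu> k))"
      by (intro mult_left_mono w_weak \<nu>(1) that \<sigma>) auto
    finally show "\<bar>LINT x|lebesgue. v k x * f x * Jac \<sigma> x\<bar> \<le> 4 ^ k * (L ^ Suc CARD('n) / real (\<nu> k))" .
  qed
  have current: "metric_current T"
    unfolding T_def[abs_def]
  proof (rule metric_current_suminf[where s = "\<lambda>k. (1 / 2) ^ k" and Q = ?Q])
    show "metric_current (Jac_current (v k))" for k
      by (rule metric_current_Jac_current[OF v_int v_supp R])
    fix k and f :: "real ^ 'n \<Rightarrow> real" and \<pi> :: "'n \<Rightarrow> real ^ 'n \<Rightarrow> real" and L :: real
    assume *: "f \<in> Lip_c" "L > 0" "L-lipschitz_on UNIV f" "\<And>j. L-lipschitz_on UNIV (\<pi> j)" "\<And>x. x \<in> ?Q \<Longrightarrow> \<bar>f x\<bar> \<le> L"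
    have "\<bar>Jac_current (v k) f \<pi>\<bar> \<le> 4 ^ k * (L ^ Suc CARD('n) / real (\<nu> k))"
      by (intro weak *)
    also have "\<dots> \<le> 4 ^ k * (L ^ Suc CARD('n) / 8 ^ k)"
      using *(2) \<nu>(1)[of k] \<nu>(2)[of k] by (intro mult_left_mono divide_left_mono mult_pos_pos) auto
    also have "\<dots> = (4 / 8) ^ k * L ^ Suc CARD('n)" unfolding power_divide by simp
    finally show "\<bar>Jac_current (v k) f \<pi>\<bar> \<le> (1 / 2) ^ k * L ^ Suc CARD('n)"
      by simp
  qed (auto simp: summable_geometric)
  have "current_carrier T ?Q"
    unfolding current_carrier_def
  proof (intro conjI ballI allI impI closed_cbox)
    fix f :: "real ^ 'n \<Rightarrow> real" and \<pi> :: "'n \<Rightarrow> real ^ 'n \<Rightarrow> real"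
    assume "(\<forall>j. \<pi> j \<in> Lip) \<and> (\<forall>x\<in>?Q. f x = 0)"
    then have "v k x * f x = 0" for k x using v_out by (cases "x \<in> ?Q") auto
    then show "T f \<pi> = 0" by (simp add: T_def Jac_current_zero)
  qed
  then have support: "current_support T \<subseteq> ?Q" by (rule current_carrier_support(2)[OF current])
  \<comment> \<open>A density \<open>u\<close> would bound \<open>T\<close> on the norming test
    functions by the norm of \<open>u\<close>.\<close>
  have not_repr: False
    if u: "set_integrable lebesgue ?Q u" and
      repr: "\<forall>\<phi>\<in>test_functions. T \<phi> (\<lambda>j x. x $ j) = (LINT x:?Q|lebesgue. u x * \<phi> x)" for u
  proof -
    define U where "U = (LINT x|lebesgue. \<bar>indicator ?Q x * u x\<bar>)"
    have ui: "integrable lebesgue (\<lambda>x. indicator ?Q x * u x)" using u by (simp add: set_integrable_def)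
    have upper: "T (\<phi> n) (\<lambda>j x. x $ j) \<le> U" for n
    proof -
      have "T (\<phi> n) (\<lambda>j x. x $ j) = (LINT x|lebesgue. (indicator ?Q x * u x) * \<phi> n x)"
        using repr \<phi>_test by (simp add: set_lebesgue_integral_def mult.assoc)
      also have "\<dots> \<le> 1 * U"
        unfolding U_def
        by (rule order_trans[OF abs_ge_self abs_integral_mult_le[OF ui smooth_alg_continuous[OF \<phi>(1)] \<phi>(3)]])
      finally show ?thesis by simp
    qed
    have lower: "T (\<phi> (\<nu> k)) (\<lambda>j x. x $ j) \<ge> 4 ^ k / 15 - 1" for k
      unfolding T_def
    proof (rule suminf_gliding_hump_lower_bound)
      have eq: "Jac_current (v j) (\<phi> (\<nu> k)) (\<lambda>j x. x $ j) = 4 ^ j * (LINT x|lebesgue. w (\<nu> j) x * \<phi> (\<nu> k) x)" for j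
        by (simp add: Jac_current_coordinates v_def mult.assoc)
      show "\<bar>Jac_current (v j) (\<phi> (\<nu> k)) (\<lambda>j x. x $ j)\<bar> \<le> 4 ^ j" for j
        using abs_integral_mult_le[OF w_int[OF \<nu>(1)[of j]] smooth_alg_continuous[OF \<phi>(1)[of "\<nu> k"]] \<phi>(3)] w_norm[OF \<nu>(1)[of j]]
        by (simp add: eq abs_mult)
      show "2 / 5 * 4 ^ k \<le> Jac_current (v k) (\<phi> (\<nu> k)) (\<lambda>j x. x $ j)"
        using \<phi>_norming[OF \<nu>(1)[of k]] by (simp add: eq)
      show "\<bar>Jac_current (v j) (\<phi> (\<nu> k)) (\<lambda>j x. x $ j)\<bar> \<le> (1 / 2) ^ j" if "j > k" for j
      proof -
        let ?A = "A (\<nu> k)"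
        have "1-lipschitz_on UNIV (\<lambda>x :: real ^ 'n. x $ b)" for b
          by (rule lipschitz_onI) (auto simp: dist_real_def dist_norm component_le_norm_cart simp flip: vector_minus_component)
        then have "?A-lipschitz_on UNIV (\<lambda>x :: real ^ 'n. x $ b)" for b using A(1) lipschitz_on_le by blast
        moreover have "\<bar>\<phi> (\<nu> k) x\<bar> \<le> ?A" for x using \<phi>(3)[of "\<nu> k" x] A(1)[of "\<nu> k"] by linarith
        moreover have "?A > 0" using A(1)[of "\<nu> k"] by linarith
        ultimately have "\<bar>Jac_current (v j) (\<phi> (\<nu> k)) (\<lambda>j x. x $ j)\<bar> \<le> 4 ^ j * (?A ^ Suc CARD('n) / real (\<nu> j))"
          by (intro weak \<phi>_Lip_c A(2))
        also have "\<dots> \<le> 4 ^ j * (1 / 8 ^ j)"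
          using \<nu>(3)[OF that] \<nu>(1)[of j] by (intro mult_left_mono) (auto simp: field_simps)
        also have "\<dots> = (4 / 8) ^ j" unfolding power_divide by simp
        finally show ?thesis by simp
      qed
    qed
    obtain k where "15 * (U + 1) < 4 ^ k" using real_arch_pow[of 4 "15 * (U + 1)"] by auto
    then show False using lower[of k] upper[of "\<nu> k"] by simp
  qed
  show ?thesis
    using current support not_repr by blast
qed

end
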